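(* There exists a dense $G_\delta$ subset $E\subset[0,1]$ such that for every $\alpha\in E$, the closure $\overline{\mathcal{A}_\alpha}$ of $\mathcal{A}_\alpha$ in $(\mathrm{Diff}(\mathbb{T}^2),\tau)$ contains a subset which is dense in $\overline{\mathcal{A}_\alpha}$ and consists of diffeomorphisms that are minimal (every orbit is dense) and not ergodic with respect to Lebesgue measure on $\mathbb{T}^2$.
   Context: $\mathbb{T}^2=\mathbb{R}^2/\mathbb{Z}^2$. $\mathrm{Diff}(\mathbb{T}^2)$ is the set of real-analytic diffeomorphisms of $\mathbb{T}^2$ homotopic to the identity; each has a lift $F(x,y)=(x+f_1(x,y),y+f_2(x,y))$ with $f_1,f_2$ real-analytic and $\mathbb{Z}^2$-periodic. For $r>0$ let $A^r=\{(x,y)\in\mathbb{C}^2:|\mathrm{Im}\,x|<r,\ |\mathrm{Im}\,y|<r\}$, and let $\mathrm{Diff}_r(\mathbb{T}^2)$ be the set of those $F$ for which $f_1,f_2$ extend holomorphically to $A^r$ with finite sup norm; it carries the topology $\tau_r$ of the distance $|F-G|_r=\max_{i=1,2}\sup_{A^r}|f_i-g_i|$. The topology $\tau$ on $\mathrm{Diff}(\mathbb{T}^2)=\bigcup_{r>0}\mathrm{Diff}_r(\mathbb{T}^2)$ is the inductive limit topology: a set $O$ is open iff $O\cap\mathrm{Diff}_r(\mathbb{T}^2)$ is $\tau_r$-open for every $r>0$. $R_\alpha(x,y)=(x+\alpha,y)$. $\mathcal{A}_\alpha$ is the set of $F\in\mathrm{Diff}(\mathbb{T}^2)$ such that $F=T^{-1}\circ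 R_\alpha\circ T$ for some real-analytic area-preserving diffeomorphism $T$ of $\mathbb{T}^2$. *)

theory Defs
  imports "HOL-Analysis.Analysis"
begin

text \<open>Points of the plane are pairs; lifts of torus maps are maps on real \<times> real.\<close>

definition Z2 :: "(real \<times> real) set" where
  "Z2 = {k. fst k \<in> \<int> \<and> snd k \<in> \<int>}"

definition periodic2 :: "(real \<times> real \<Rightarrow> real) \<Rightarrow> bool" where
  "periodic2 f \<longleftrightarrow> (\<forall>p k. k \<in> Z2 \<longrightarrow> f (p + k) = f p)"

definition strip :: "real \<Rightarrow> (complex \<times> complex) set" where
  "strip r = {(z, w). \<bar>Im z\<bar> < r \<and> \<bar>Im w\<bar> < r}"

text \<open>Holomorphy in two complex variables (Osgood: continuous and separately holomorphic).\<close>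
definition holo2 :: "(complex \<times> complex \<Rightarrow> complex) \<Rightarrow> (complex \<times> complex) set \<Rightarrow> bool" where
  "holo2 g S \<longleftrightarrow> continuous_on S g \<and>
     (\<forall>z w. (z, w) \<in> S \<longrightarrow>
        (\<lambda>u. g (u, w)) field_differentiable at z \<and> (\<lambda>u. g (z, u)) field_differentiable at w)"

definition hol_ext :: "real \<Rightarrow> (real \<times> real \<Rightarrow> real) \<Rightarrow> (complex \<times> complex \<Rightarrow> complex) \<Rightarrow> bool" where
  "hol_ext r f g \<longleftrightarrow> holo2 g (strip r) \<and> bounded (g ` strip r) \<and>
     (\<forall>x y. g (complex_of_real x, complex_of_real y) = complex_of_real (f (x, y)))"

definition an_per :: "real \<Rightarrow> (real \<times> real \<Rightarrow> real) \<Rightarrow> bool" where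
  "an_per r f \<longleftrightarrow> periodic2 f \<and> (\<exists>g. hol_ext r f g)"

text \<open>The (unique) holomorphic extension.\<close>
definition ext :: "real \<Rightarrow> (real \<times> real \<Rightarrow> real) \<Rightarrow> complex \<times> complex \<Rightarrow> complex" where
  "ext r f = (SOME g. hol_ext r f g)"

definition id_plus_an :: "real \<Rightarrow> (real \<times> real \<Rightarrow> real \<times> real) \<Rightarrow> bool" where
  "id_plus_an r F \<longleftrightarrow> an_per r (\<lambda>p. fst (F p - p)) \<and> an_per r (\<lambda>p. snd (F p - p))"

text \<open>Diff(T^2): lifts of real-analytic diffeomorphisms homotopic to the identity.\<close>
definition Diff_all :: "(real \<times> real \<Rightarrow> real \<times> real) set" where
  "Diff_all = {F. (\<exists>r>0. id_plus_an r F) \<and>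
      (\<exists>G. (\<exists>r>0. id_plus_an r G) \<and> G \<circ> F = id \<and> F \<circ> G = id)}"

definition Diff_r :: "real \<Rightarrow> (real \<times> real \<Rightarrow> real \<times> real) set" where
  "Diff_r r = {F \<in> Diff_all. id_plus_an r F}"

definition dist_r :: "real \<Rightarrow> (real \<times> real \<Rightarrow> real \<times> real) \<Rightarrow> (real \<times> real \<Rightarrow> real \<times> real) \<Rightarrow> real" where
  "dist_r r F G = max (SUP z\<in>strip r. cmod (ext r (\<lambda>p. fst (F p - G p)) z))
                      (SUP z\<in>strip r. cmod (ext r (\<lambda>p. snd (F p - G p)) z))"

text \<open>Open sets of the inductive limit topology tau.\<close>
definition tau_open :: "(real \<times> real \<Rightarrow> real \<times> real) set \<Rightarrow> bool" where
  "tau_open U \<longleftrightarrow> U \<subseteq> Diff_all \<and>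
     (\<forall>r>0. \<forall>F\<in>U \<inter> Diff_r r. \<exists>e>0. \<forall>G\<in>Diff_r r. dist_r r F G < e \<longrightarrow> G \<in> U)"

lemma istopology_tau_open: "istopology tau_open"
  unfolding istopology_def
proof (intro conjI allI impI)
  fix S T assume S: "tau_open S" and T: "tau_open T"
  show "tau_open (S \<inter> T)"
    unfolding tau_open_def
  proof (intro conjI allI impI ballI)
    show "S \<inter> T \<subseteq> Diff_all" using S unfolding tau_open_def by blast
  next
    fix r :: real and F assume r: "r > 0" and F: "F \<in> S \<inter> T \<inter> Diff_r r"
    obtain e1 where e1: "e1 > 0" "\<forall>G\<in>Diff_r r. dist_r r F G < e1 \<longrightarrow> G \<in> S"
      using S r F unfolding tau_open_def by blast
    obtain e2 where e2: "e2 > 0" "\<forall>G\<in>Diff_r r. dist_r r F G < e2 \<longrightarrow> G \<in> T"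
      using T r F unfolding tau_open_def by blast
    show "\<exists>e>0. \<forall>G\<in>Diff_r r. dist_r r F G < e \<longrightarrow> G \<in> S \<inter> T"
      using e1 e2 by (intro exI[of _ "min e1 e2"]) auto
  qed
next
  fix K assume K: "\<forall>k\<in>K. tau_open k"
  show "tau_open (\<Union>K)"
    unfolding tau_open_def
  proof (intro conjI allI impI ballI)
    show "\<Union>K \<subseteq> Diff_all" using K unfolding tau_open_def by blast
  next
    fix r :: real and F assume r: "r > 0" and F: "F \<in> \<Union>K \<inter> Diff_r r"
    then obtain k where k: "k \<in> K" "F \<in> k" by blast
    then obtain e where "e > 0" "\<forall>G\<in>Diff_r r. dist_r r F G < e \<longrightarrow> G \<in> k"
      using K r F unfolding tau_open_def by blast
    then show "\<exists>e>0. \<forall>G\<in>Diff_r r. dist_r r F G < e \<longrightarrow> G \<in> \<Union>K"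
      using k by blast
  qed
qed

definition tau :: "(real \<times> real \<Rightarrow> real \<times> real) topology" where
  "tau = topology tau_open"

lemma openin_tau: "openin tau = tau_open"
  unfolding tau_def using istopology_tau_open by (simp add: topology_inverse')

definition Rot :: "real \<Rightarrow> real \<times> real \<Rightarrow> real \<times> real" where
  "Rot \<alpha> p = (fst p + \<alpha>, snd p)"

text \<open>Lifts of real-analytic self-maps of T^2 (arbitrary homotopy class):
  T(p) = M p + t(p) with M an integer matrix and t real-analytic, Z^2-periodic.\<close>
definition torus_an_map :: "(real \<times> real \<Rightarrow> real \<times> real) \<Rightarrow> bool" where
  "torus_an_map T \<longleftrightarrow> (\<exists>a b c d :: int. \<exists>r>0.
      an_per r (\<lambda>p. fst (T p) - (of_int a * fst p + of_int b * snd p)) \<and>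
      an_per r (\<lambda>p. snd (T p) - (of_int c * fst p + of_int d * snd p)))"

definition analytic_diffeo :: "(real \<times> real \<Rightarrow> real \<times> real) \<Rightarrow> bool" where
  "analytic_diffeo T \<longleftrightarrow> torus_an_map T \<and>
     (\<exists>S. torus_an_map S \<and> S \<circ> T = id \<and> T \<circ> S = id)"

text \<open>A_alpha: F = T^{-1} o R_alpha o T on T^2 (i.e. modulo Z^2), T area-preserving
  real-analytic diffeomorphism (its lift preserves Lebesgue measure).\<close>
definition A_set :: "real \<Rightarrow> (real \<times> real \<Rightarrow> real \<times> real) set" where
  "A_set \<alpha> = {F \<in> Diff_all. \<exists>T S. analytic_diffeo T \<and> T \<in> borel_measurable borel \<and> distr lborel lborel T = lborel \<and>
       S \<circ> T = id \<and> T \<circ> S = id \<and> (\<forall>p. F p - S (Rot \<alpha> (T p)) \<in> Z2)}"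

definition minimal_T2 :: "(real \<times> real \<Rightarrow> real \<times> real) \<Rightarrow> bool" where
  "minimal_T2 F \<longleftrightarrow> (\<forall>p. closure {(F ^^ n) p + k | n k. k \<in> Z2} = UNIV)"

text \<open>Ergodicity w.r.t. Lebesgue measure on T^2: every invariant measurable subset of T^2
  (a Z^2-periodic subset of the plane) has measure 0 or 1.\<close>
definition ergodic_T2 :: "(real \<times> real \<Rightarrow> real \<times> real) \<Rightarrow> bool" where
  "ergodic_T2 F \<longleftrightarrow> (\<forall>B \<in> sets lebesgue.
      (\<forall>p k. k \<in> Z2 \<longrightarrow> (p + k \<in> B \<longleftrightarrow> p \<in> B)) \<longrightarrow> F -` B = B \<longrightarrow>
      measure lebesgue (B \<inter> ({0..<1} \<times> {0..<1})) = 0 \<or>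
      measure lebesgue (B \<inter> ({0..<1} \<times> {0..<1})) = 1)"

end

theory Submission
  imports Defs "HOL-Complex_Analysis.Complex_Analysis"
begin

text \<open>
  Furstenberg's skew products \<open>(x, y) \<mapsto> (x + \<alpha>, y + \<phi> x)\<close> over a Liouville rotation do the job, where
  \<open>\<phi> = \<Sum>k. h\<^sub>k (x + \<alpha>) - h\<^sub>k x\<close> for non-negative trigonometric polynomials \<open>h\<^sub>k\<close> of height 2 and tiny mean.
  If the frequency of \<open>h\<^sub>k\<close> is a very good denominator of \<open>\<alpha>\<close>, the \<open>k\<close>-th term is as small as desired on a
  complex strip. The series \<open>\<Sum>k. h\<^sub>k\<close> converges almost everywhere and solves the cohomological equation, so
  the skew product is not ergodic. The partial sums \<open>g\<^sub>n\<close> oscillate by more than 1 on ever shorter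
  intervals, so finite orbit segments of the approximations, which are rotations conjugated by the
  area-preserving shears \<open>(x, y) \<mapsto> (x, y - g\<^sub>n x)\<close>, are increasingly dense; choosing the later terms small
  enough preserves this in the limit, which is therefore minimal. Conjugating by an analytic
  area-preserving \<open>T\<close> moves these examples arbitrarily close to any given element of \<open>A_set \<alpha>\<close>.
\<close>

subsection \<open>Holomorphic functions of two variables\<close>

text \<open>Two demands conflict. A continuous solution \<open>u\<close> of
  \<open>\<phi> x = u (x + \<alpha>) - u x\<close> would make the vertical translates of its graph
  invariant and rule out minimality, whereas a measurable solution already destroys ergodicity.
  Hence every term keeps height 2 while the means are summable, and non-negativity turns summable
  means into convergence almost everywhere.

  Approximation in \<open>tau\<close> is carried out inside one fixed strip. There a kernel of
  frequency up to \<open>M * q\<close> is only bounded by a multiple of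
  \<open>exp (2 * pi * M * q)\<close>, and translation by \<alpha> gains only the factor
  \<open>\<bar>q * \<alpha> - p\<bar>\<close>. So the Liouville condition has to be exponential, at
  every rate.

  Errors in \<open>\<phi>\<close> accumulate along orbits. The n-th approximation is dense at scale
  \<open>\<epsilon> n\<close> within \<open>N n\<close> steps, and
  \<open>\<epsilon> (Suc n) = \<epsilon> n / (2 * (N n + 1))\<close> makes the whole remaining tail
  at most \<open>\<epsilon> n / (N n + 1)\<close>, harmless during those steps.

  Since \<open>T\<close> may lie in any homotopy class, a perturbed map is compared with
  \<open>F\<close>, and its inverse with the inverse of \<open>F\<close>, to see that both are the
  identity plus a periodic analytic map.\<close>

lemma mem_strip: "(z, w) \<in> strip r \<longleftrightarrow> \<bar>Im z\<bar> < r \<and> \<bar>Im w\<bar> < r"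
  by (simp add: strip_def)

lemma strip_mono: "r \<le> s \<Longrightarrow> strip r \<subseteq> strip s"
  by (auto simp: strip_def)

lemma real_mem_strip: "0 < r \<Longrightarrow> (complex_of_real x, complex_of_real y) \<in> strip r"
  by (simp add: mem_strip)

lemma open_strip: "open (strip r)"
proof -
  have "strip r = {p. \<bar>Im (fst p)\<bar> < r} \<inter> {p. \<bar>Im (snd p)\<bar> < r}"
    by (auto simp: strip_def)
  moreover have "open {p::complex \<times> complex. \<bar>Im (fst p)\<bar> < r}" "open {p::complex \<times> complex. \<bar>Im (snd p)\<bar> < r}"
    by (intro open_Collect_less continuous_intros)+
  ultimately show ?thesis by auto
qed

lemma holo2_subset: "holo2 g S \<Longrightarrow> T \<subseteq> S \<Longrightarrow> holo2 g T"
  unfolding holo2_def by (meson continuous_on_subset subsetD)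

lemma holo2_const: "holo2 (\<lambda>_. c) S"
  unfolding holo2_def by simp

lemma holo2_fst: "holo2 fst S"
  unfolding holo2_def by (auto intro!: continuous_on_fst continuous_on_id)

lemma holo2_snd: "holo2 snd S"
  unfolding holo2_def by (auto intro!: continuous_on_snd continuous_on_id)

lemma holo2_add: "holo2 f S \<Longrightarrow> holo2 g S \<Longrightarrow> holo2 (\<lambda>p. f p + g p) S"
  unfolding holo2_def by (auto intro!: continuous_intros field_differentiable_add)

lemma holo2_diff: "holo2 f S \<Longrightarrow> holo2 g S \<Longrightarrow> holo2 (\<lambda>p. f p - g p) S"
  unfolding holo2_def by (auto intro!: continuous_intros field_differentiable_diff)

lemma holo2_cmult: "holo2 f S \<Longrightarrow> holo2 (\<lambda>p. c * f p) S"
  unfolding holo2_def by (auto intro!: continuous_intros field_differentiable_mult)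

lemma holo2_compose1:
  assumes "\<Phi> holomorphic_on U" "open U" "holo2 A S" "\<And>p. p \<in> S \<Longrightarrow> A p \<in> U"
  shows "holo2 (\<lambda>p. \<Phi> (A p)) S"
  unfolding holo2_def
proof (intro conjI allI impI)
  show "continuous_on S (\<lambda>p. \<Phi> (A p))"
    using assms by (intro continuous_on_compose2[OF holomorphic_on_imp_continuous_on[OF assms(1)]])
      (auto simp: holo2_def)
next
  fix z w assume zw: "(z, w) \<in> S"
  have d: "\<Phi> field_differentiable at (A (z, w))"
    using assms zw holomorphic_on_imp_differentiable_at by blast
  show "(\<lambda>u. \<Phi> (A (u, w))) field_differentiable at z"
    using field_differentiable_compose[of "\<lambda>u. A (u, w)" z \<Phi>] d assms(3) zw
    unfolding holo2_def by (auto simp: o_def)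
  show "(\<lambda>u. \<Phi> (A (z, u))) field_differentiable at w"
    using field_differentiable_compose[of "\<lambda>u. A (z, u)" w \<Phi>] d assms(3) zw
    unfolding holo2_def by (auto simp: o_def)
qed

lemma holo2_section_holomorphic:
  assumes "holo2 g S" "\<And>u. u \<in> U \<Longrightarrow> (z, u) \<in> S"
  shows "(\<lambda>u. g (z, u)) holomorphic_on U"
  unfolding holomorphic_on_def
  using assms by (auto simp: holo2_def intro: field_differentiable_at_within)

lemma holo2_section_holomorphic':
  assumes "holo2 g S" "\<And>u. u \<in> U \<Longrightarrow> (u, w) \<in> S"
  shows "(\<lambda>u. g (u, w)) holomorphic_on U"
  unfolding holomorphic_on_def
  using assms by (auto simp: holo2_def intro: field_differentiable_at_within)

text \<open>By Cauchy's estimate a partial derivative is controlled by the function on a small polydisc,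
  so uniform continuity passes to it.\<close>

lemma holo2_partial_continuous:
  assumes g: "holo2 g S" and "open S" and zw: "(z, w) \<in> S"
  shows "isCont (\<lambda>p. deriv (\<lambda>u. g (fst p, u)) (snd p)) (z, w)"
proof -
  obtain e where e: "e > 0" "cball (z, w) e \<subseteq> S"
    using \<open>open S\<close> zw open_contains_cball by blast
  \<comment> \<open>The second disc of \<open>K\<close> needs radius \<open>2 * s\<close>, since
    circles of radius \<open>s\<close> around points \<open>s\<close>-close to \<open>w\<close> must
    fit. Then \<open>s + 2 * s \<le> e\<close> keeps \<open>K\<close> inside the ball.\<close>
  define s where "s = e / 4"
  have s: "s > 0" using e by (simp add: s_def)
  define K where "K = cball z s \<times> cball w (2 * s)"
  have KS: "K \<subseteq> S"
  proof
    fix p assume "p \<in> K"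
    then have "dist z (fst p) \<le> s" "dist w (snd p) \<le> 2 * s" by (auto simp: K_def)
    moreover have "dist (z, w) p \<le> dist z (fst p) + dist w (snd p)"
      by (cases p) (simp add: dist_Pair_Pair real_sqrt_sum_squares_triangle_ineq sqrt_sum_squares_le_sum)
    ultimately have "dist (z, w) p \<le> e" using s by (simp add: s_def)
    then show "p \<in> S" using e by auto
  qed
  have unif: "uniformly_continuous_on K g"
    using g KS unfolding holo2_def K_def
    by (intro compact_uniformly_continuous compact_Times) (auto intro: continuous_on_subset)
  show ?thesis
    unfolding isCont_def LIM_def
  proof (intro allI impI)
    fix \<epsilon> :: real assume "\<epsilon> > 0"
    then have "\<epsilon> * s / 2 > 0" using s by simp
    then obtain \<delta> where \<delta>: "\<delta> > 0"
      "\<And>p p'. p \<in> K \<Longrightarrow> p' \<in> K \<Longrightarrow> dist p' p < \<delta> \<Longrightarrow> dist (g p') (g p) < \<epsilon> * s / 2"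
      using unif unfolding uniformly_continuous_on_def by metis
    show "\<exists>d>0. \<forall>p. p \<noteq> (z, w) \<and> dist p (z, w) < d \<longrightarrow>
      dist (deriv (\<lambda>u. g (fst p, u)) (snd p)) (deriv (\<lambda>u. g (fst (z, w), u)) (snd (z, w))) < \<epsilon>"
    proof (intro exI[of _ "min \<delta> s"] conjI allI impI)
      show "min \<delta> s > 0" using \<delta> s by simp
      fix p assume p: "p \<noteq> (z, w) \<and> dist p (z, w) < min \<delta> s"
      obtain x y where xy: "p = (x, y)" by (cases p)
      have dx: "dist z x < s" and dy: "dist w y < s"
        using p dist_fst_le[of p "(z, w)"] dist_snd_le[of p "(z, w)"] by (auto simp: xy dist_commute)
      have inK: "(x, y + u) \<in> K \<and> (z, w + u) \<in> K" if "norm u \<le> s" for u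
      proof -
        have "dist w (y + u) \<le> dist w y + norm u" by norm
        moreover have "dist w (w + u) \<le> norm u" by norm
        ultimately show ?thesis using dx dy that s by (auto simp: K_def)
      qed
      \<comment> \<open>Both sections are recentred at 0, so the derivative of \<open>f\<close> at 0
        is the difference of the two partial derivatives, and Cauchy's estimate on one circle of
        radius \<open>s\<close> bounds it.\<close>
      define f where "f = (\<lambda>u. g (x, y + u) - g (z, w + u))"
      have fd1: "(\<lambda>u. g (x, y + u)) holomorphic_on cball 0 s"
      proof -
        have "(\<lambda>u. g (x, u)) holomorphic_on (\<lambda>u. y + u) ` cball 0 s"
          by (rule holo2_section_holomorphic[OF g]) (use inK KS in fastforce)
        then have "(\<lambda>u. g (x, u)) \<circ> (\<lambda>u. y + u) holomorphic_on cball 0 s"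
          by (intro holomorphic_on_compose holomorphic_intros)
        then show ?thesis by (simp add: o_def)
      qed
      have fd2: "(\<lambda>u. g (z, w + u)) holomorphic_on cball 0 s"
      proof -
        have "(\<lambda>u. g (z, u)) holomorphic_on (\<lambda>u. w + u) ` cball 0 s"
          by (rule holo2_section_holomorphic[OF g]) (use inK KS in fastforce)
        then have "(\<lambda>u. g (z, u)) \<circ> (\<lambda>u. w + u) holomorphic_on cball 0 s"
          by (intro holomorphic_on_compose holomorphic_intros)
        then show ?thesis by (simp add: o_def)
      qed
      have holf: "f holomorphic_on cball 0 s"
        unfolding f_def using fd1 fd2 by (intro holomorphic_intros)
      have "norm ((deriv ^^ 1) f 0) \<le> fact 1 * (\<epsilon> * s / 2) / s ^ 1"
      proof (rule Cauchy_inequality)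
        show "f holomorphic_on ball 0 s" using holf holomorphic_on_subset by force
        show "continuous_on (cball 0 s) f" using holf by (rule holomorphic_on_imp_continuous_on)
        show "0 < s" by fact
        fix u :: complex assume "norm (0 - u) = s"
        then have u: "norm u \<le> s" by simp
        have "dist (x, y + u) (z, w + u) = dist p (z, w)"
          by (simp add: xy dist_Pair_Pair)
        then have "dist (g (x, y + u)) (g (z, w + u)) < \<epsilon> * s / 2"
          using \<delta>(2) inK[OF u] p by auto
        then show "norm (f u) \<le> \<epsilon> * s / 2" by (simp add: f_def dist_norm)
      qed
      then have b: "norm (deriv f 0) \<le> \<epsilon> / 2" using s by simp
      have xyS: "(x, y) \<in> S" using inK[of 0] KS s by auto
      have D1: "((\<lambda>u. g (x, u)) has_field_derivative deriv (\<lambda>u. g (x, u)) y) (at y)"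
        using g xyS unfolding holo2_def by (metis DERIV_deriv_iff_field_differentiable)
      have D2: "((\<lambda>u. g (z, u)) has_field_derivative deriv (\<lambda>u. g (z, u)) w) (at w)"
        using g zw unfolding holo2_def by (metis DERIV_deriv_iff_field_differentiable)
      have "(f has_field_derivative (deriv (\<lambda>u. g (x, u)) y - deriv (\<lambda>u. g (z, u)) w)) (at 0)"
        unfolding f_def
        using DERIV_shift[of "\<lambda>u. g (x, u)" _ 0 y] DERIV_shift[of "\<lambda>u. g (z, u)" _ 0 w] D1 D2
        by (intro DERIV_diff) (auto simp: add.commute)
      then have "deriv f 0 = deriv (\<lambda>u. g (x, u)) y - deriv (\<lambda>u. g (z, u)) w"
        by (rule DERIV_imp_deriv)
      then show "dist (deriv (\<lambda>u. g (fst p, u)) (snd p)) (deriv (\<lambda>u. g (fst (z, w), u)) (snd (z, w))) < \<epsilon>"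
        using b \<open>\<epsilon> > 0\<close> by (simp add: xy dist_norm)
    qed
  qed
qed

text \<open>Total differentiability needs existence of both partial derivatives but continuity of
  only one of them; the second one is continuous by \<open>holo2_partial_continuous\<close>. This
  gives the chain rule behind all compositions of two-variable extensions.\<close>

lemma holo2_has_derivative:
  assumes g: "holo2 g S" and "open S" and zw: "(z, w) \<in> S"
  shows "(g has_derivative
    (\<lambda>(h, k). deriv (\<lambda>u. g (u, w)) z * h + deriv (\<lambda>u. g (z, u)) w * k)) (at (z, w))"
proof -
  obtain X Y where XY: "open X" "open Y" "z \<in> X" "w \<in> Y" "X \<times> Y \<subseteq> S"
    using \<open>open S\<close> zw by (metis open_prod_elim mem_Sigma_iff)
  obtain e where e: "e > 0" "ball w e \<subseteq> Y" using XY open_contains_ball by blast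
  have sub: "X \<times> ball w e \<subseteq> S" using XY e by blast
  have "((\<lambda>(x, y). g (x, y)) has_derivative
      (\<lambda>(h, k). deriv (\<lambda>u. g (u, w)) z * h + blinfun_mult_right (deriv (\<lambda>u. g (z, u)) w) k))
      (at (z, w) within X \<times> ball w e)"
  proof (rule has_derivative_partialsI[where fy = "\<lambda>x y. blinfun_mult_right (deriv (\<lambda>u. g (x, u)) y)"])
    have "((\<lambda>u. g (u, w)) has_field_derivative deriv (\<lambda>u. g (u, w)) z) (at z)"
      using g zw unfolding holo2_def by (metis DERIV_deriv_iff_field_differentiable)
    then show "((\<lambda>x. g (x, w)) has_derivative (*) (deriv (\<lambda>u. g (u, w)) z)) (at z within X)"
      by (simp add: has_field_derivative_def has_derivative_at_withinI)
    show "((\<lambda>y. g (x, y)) has_derivative blinfun_apply (blinfun_mult_right (deriv (\<lambda>u. g (x, u)) y)))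
        (at y within ball w e)" if "x \<in> X" "y \<in> ball w e" for x y
    proof -
      have "((\<lambda>u. g (x, u)) has_field_derivative deriv (\<lambda>u. g (x, u)) y) (at y)"
        using g sub that unfolding holo2_def by (metis DERIV_deriv_iff_field_differentiable mem_Sigma_iff subsetD)
      then show ?thesis
        by (simp add: has_field_derivative_def has_derivative_at_withinI blinfun_mult_right.rep_eq)
    qed
    have "isCont (\<lambda>p. blinfun_mult_right (deriv (\<lambda>u. g (fst p, u)) (snd p))) (z, w)"
      by (intro bounded_linear.isCont[OF bounded_linear_blinfun_mult_right]
          holo2_partial_continuous[OF assms])
    then show "continuous (at (z, w) within X \<times> ball w e)
        (\<lambda>(x, y). blinfun_mult_right (deriv (\<lambda>u. g (x, u)) y))"
      unfolding case_prod_beta by (rule continuous_at_imp_continuous_at_within)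
  qed (use e in auto)
  moreover have "at (z, w) within X \<times> ball w e = at (z, w)"
    using XY e by (intro at_within_open) (auto intro: open_Times)
  ultimately show ?thesis by (simp add: blinfun_mult_right.rep_eq)
qed

lemma holo2_chain:
  assumes g: "holo2 g S" "open S" and ab: "(a u, b u) \<in> S"
    and a: "a field_differentiable at u" and b: "b field_differentiable at u"
  shows "(\<lambda>u. g (a u, b u)) field_differentiable at u"
proof -
  obtain a' b' where a': "(a has_field_derivative a') (at u)" and b': "(b has_field_derivative b') (at u)"
    using a b unfolding field_differentiable_def by blast
  define p where "p = deriv (\<lambda>v. g (v, b u)) (a u)"
  define q where "q = deriv (\<lambda>v. g (a u, v)) (b u)"
  have "((\<lambda>u. (a u, b u)) has_derivative (\<lambda>h. (a' * h, b' * h))) (at u)"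
    using a' b' by (intro has_derivative_Pair) (auto simp: has_field_derivative_def)
  from has_derivative_compose[OF this holo2_has_derivative[OF g ab]]
  have "((\<lambda>u. g (a u, b u)) has_derivative (\<lambda>h. (p * a' + q * b') * h)) (at u)"
    by (simp add: p_def q_def algebra_simps)
  then show ?thesis unfolding field_differentiable_def has_field_derivative_def by blast
qed

lemma holo2_compose:
  assumes g: "holo2 g S" "open S" and A: "holo2 A R" and B: "holo2 B R"
    and m: "\<And>p. p \<in> R \<Longrightarrow> (A p, B p) \<in> S"
  shows "holo2 (\<lambda>p. g (A p, B p)) R"
  unfolding holo2_def
proof (intro conjI allI impI)
  show "continuous_on R (\<lambda>p. g (A p, B p))"
    using g A B m unfolding holo2_def
    by (intro continuous_on_compose2[where g = g and f = "\<lambda>p. (A p, B p)" and t = S] continuous_intros) auto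
next
  fix z w assume zw: "(z, w) \<in> R"
  show "(\<lambda>u. g (A (u, w), B (u, w))) field_differentiable at z"
    using A B zw unfolding holo2_def by (intro holo2_chain[OF g] m) auto
  show "(\<lambda>u. g (A (z, u), B (z, u))) field_differentiable at w"
    using A B zw unfolding holo2_def by (intro holo2_chain[OF g] m) auto
qed

section \<open>Cauchy estimates and uniqueness of extensions on strips\<close>

lemma bounded_holomorphic_half_strip_Lipschitz:
  assumes r: "r > 0" and hol: "f holomorphic_on {z. \<bar>Im z\<bar> < r}"
    and b: "\<And>z. \<bar>Im z\<bar> < r \<Longrightarrow> norm (f z) \<le> C"
    and z: "\<bar>Im z\<bar> < r / 2" and w: "\<bar>Im w\<bar> < r / 2"
  shows "norm (f z - f w) \<le> (4 * C / r) * norm (z - w)"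
proof -
  define U where "U = {z. \<bar>Im z\<bar> < r}"
  have oU: "open U" unfolding U_def by (intro open_Collect_less continuous_intros)
  have conv: "convex {z. \<bar>Im z\<bar> < r / 2}"
  proof -
    have "{z. \<bar>Im z\<bar> < r / 2} = {z. Im z < r / 2} \<inter> {z. Im z > - (r / 2)}" by auto
    then show ?thesis by (metis convex_Int convex_halfspace_Im_lt convex_halfspace_Im_gt)
  qed
  show ?thesis
  proof (rule field_differentiable_bound[OF conv, of f "deriv f"])
    fix u assume u: "u \<in> {z. \<bar>Im z\<bar> < r / 2}"
    have uU: "u \<in> U" using u r by (auto simp: U_def)
    show "(f has_field_derivative deriv f u) (at u within {z. \<bar>Im z\<bar> < r / 2})"
      using holomorphic_derivI[OF hol[folded U_def] oU uU] by (rule has_field_derivative_at_within)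
    \<comment> \<open>Halving the strip leaves room for discs of one fixed radius around all its
      points, so the derivative bound is uniform although the strip is unbounded.\<close>
    have sub: "cball u (r / 4) \<subseteq> U"
    proof
      fix v assume "v \<in> cball u (r / 4)"
      then have "\<bar>Im (u - v)\<bar> \<le> r / 4" using abs_Im_le_cmod[of "u - v"] by (auto simp: dist_norm)
      moreover have "\<bar>Im v\<bar> \<le> \<bar>Im u\<bar> + \<bar>Im (u - v)\<bar>" by simp
      moreover have "\<bar>Im u\<bar> < r / 2" using u by simp
      ultimately have "\<bar>Im v\<bar> < r" using r by linarith
      then show "v \<in> U" by (simp add: U_def)
    qed
    have "norm ((deriv ^^ 1) f u) \<le> fact 1 * C / (r / 4) ^ 1"
    proof (rule Cauchy_inequality)
      show "f holomorphic_on ball u (r / 4)"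
        using hol sub ball_subset_cball unfolding U_def by (meson holomorphic_on_subset order_trans)
      show "continuous_on (cball u (r / 4)) f"
        using hol sub unfolding U_def by (meson holomorphic_on_imp_continuous_on holomorphic_on_subset)
      show "0 < r / 4" using r by simp
      fix v assume "norm (u - v) = r / 4"
      then have "v \<in> U" using sub by (auto simp: dist_norm)
      then show "norm (f v) \<le> C" using b by (auto simp: U_def)
    qed
    then show "norm (deriv f u) \<le> 4 * C / r" using r by (simp add: field_simps)
  qed (use z w in auto)
qed

lemma hol_ext_Lipschitz:
  assumes r: "r > 0" and g: "hol_ext r f g"
  shows "\<exists>L\<ge>0. \<forall>z w z' w'. (z, w) \<in> strip (r / 2) \<longrightarrow> (z', w') \<in> strip (r / 2) \<longrightarrow>
    norm (g (z, w) - g (z', w')) \<le> L * (norm (z - z') + norm (w - w'))"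
proof -
  have h: "holo2 g (strip r)" using g by (simp add: hol_ext_def)
  obtain C where C: "\<And>p. p \<in> strip r \<Longrightarrow> norm (g p) \<le> C"
    using g unfolding hol_ext_def bounded_iff by auto
  have C0: "C \<ge> 0" using order_trans[OF norm_ge_zero C[of "(0, 0)"]] r by (simp add: mem_strip)
  show ?thesis
  proof (intro exI[of _ "4 * C / r"] conjI allI impI)
    show "0 \<le> 4 * C / r" using C0 r by simp
    fix z w z' w' assume p: "(z, w) \<in> strip (r / 2)" and p': "(z', w') \<in> strip (r / 2)"
    have "norm (g (z, w) - g (z', w)) \<le> (4 * C / r) * norm (z - z')"
      by (rule bounded_holomorphic_half_strip_Lipschitz[where f = "\<lambda>u. g (u, w)"])
        (use p p' r in \<open>auto simp: mem_strip intro: holo2_section_holomorphic'[OF h] C\<close>)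
    moreover have "norm (g (z', w) - g (z', w')) \<le> (4 * C / r) * norm (w - w')"
      by (rule bounded_holomorphic_half_strip_Lipschitz[where f = "\<lambda>u. g (z', u)"])
        (use p p' r in \<open>auto simp: mem_strip intro: holo2_section_holomorphic[OF h] C\<close>)
    moreover have "norm (g (z, w) - g (z', w')) \<le> norm (g (z, w) - g (z', w)) + norm (g (z', w) - g (z', w'))"
      by norm
    ultimately show "norm (g (z, w) - g (z', w')) \<le> 4 * C / r * (norm (z - z') + norm (w - w'))"
      by (simp add: distrib_left)
  qed
qed

lemma holomorphic_strip_zero:
  assumes r: "r > 0" and hol: "f holomorphic_on {z. \<bar>Im z\<bar> < r}"
    and 0: "\<And>x. f (complex_of_real x) = 0" and z: "\<bar>Im z\<bar> < r"
  shows "f z = 0"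
proof (rule analytic_continuation[where f = f and w = z and S = "{z. \<bar>Im z\<bar> < r}" and U = \<real> and \<xi> = 0])
  show "open {z. \<bar>Im z\<bar> < r}" by (intro open_Collect_less continuous_intros)
  have "{z. \<bar>Im z\<bar> < r} = {z. Im z < r} \<inter> {z. Im z > - r}" by auto
  then show "connected {z. \<bar>Im z\<bar> < r}"
    by (simp add: convex_connected convex_Int convex_halfspace_Im_lt convex_halfspace_Im_gt)
  show "0 islimpt (\<real> :: complex set)"
    unfolding islimpt_approachable
  proof (intro allI impI)
    fix e :: real assume "e > 0"
    then show "\<exists>x'\<in>\<real>. x' \<noteq> 0 \<and> dist x' (0::complex) < e"
      by (intro bexI[of _ "complex_of_real (e / 2)"]) auto
  qed
  show "\<real> \<subseteq> {z. \<bar>Im z\<bar> < r}" using r by (auto simp: complex_is_Real_iff)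
  show "f u = 0" if "u \<in> \<real>" for u using that 0 by (auto elim: Reals_cases)
qed (use assms in auto)

text \<open>The identity theorem is applied twice: in the first variable with the second one real,
  then in the second variable. Without this, nothing would be known about the extension that
  \<open>ext\<close> picks by \<open>SOME\<close>.\<close>

lemma hol_ext_unique:
  assumes r: "r > 0" and g: "hol_ext r f g" and h: "hol_ext r f h" and p: "p \<in> strip r"
  shows "g p = h p"
proof -
  define d where "d = (\<lambda>p. g p - h p)"
  have d: "holo2 d (strip r)" unfolding d_def using g h by (intro holo2_diff) (auto simp: hol_ext_def)
  have d0: "d (complex_of_real x, complex_of_real y) = 0" for x y
    using g h by (simp add: hol_ext_def d_def)
  have d1: "d (z, complex_of_real y) = 0" if "\<bar>Im z\<bar> < r" for z y
    by (rule holomorphic_strip_zero[OF r holo2_section_holomorphic'[OF d] _ that])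
      (use r d0 in \<open>auto simp: mem_strip\<close>)
  obtain z w where zw: "p = (z, w)" by (cases p)
  have "d (z, w) = 0"
    by (rule holomorphic_strip_zero[OF r holo2_section_holomorphic[OF d]])
      (use p d1 in \<open>auto simp: mem_strip zw\<close>)
  then show ?thesis by (simp add: zw d_def)
qed

text \<open>Any explicit extension may replace the chosen one. Only upper bounds on
  \<open>dist_r\<close> occur in the argument, so this is its sole access to the distance.\<close>

lemma SUP_ext_le:
  assumes r: "r > 0" and g: "hol_ext r f g" and c: "\<And>p. p \<in> strip r \<Longrightarrow> norm (g p) \<le> c"
  shows "(SUP z\<in>strip r. cmod (ext r f z)) \<le> c"
proof (rule cSUP_least)
  show "strip r \<noteq> {}" using real_mem_strip[OF r] by blast
  fix z assume z: "z \<in> strip r"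
  have "hol_ext r f (ext r f)" unfolding ext_def using g by (metis someI)
  then show "cmod (ext r f z) \<le> c" using hol_ext_unique[OF r _ g z] c[OF z] by metis
qed

lemma hol_ext_mono: "hol_ext r f g \<Longrightarrow> s \<le> r \<Longrightarrow> hol_ext s f g"
  unfolding hol_ext_def by (meson bounded_subset holo2_subset image_mono strip_mono)

lemma an_per_mono: "an_per r f \<Longrightarrow> s \<le> r \<Longrightarrow> an_per s f"
  unfolding an_per_def using hol_ext_mono by blast

lemma an_per_add:
  assumes "an_per r f" "an_per r g"
  shows "an_per r (\<lambda>p. f p + g p)"
proof -
  obtain f' g' where "hol_ext r f f'" "hol_ext r g g'" using assms unfolding an_per_def by blast
  then have "hol_ext r (\<lambda>p. f p + g p) (\<lambda>p. f' p + g' p)"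
    unfolding hol_ext_def by (auto intro!: holo2_add bounded_plus_comp)
  then show ?thesis using assms unfolding an_per_def periodic2_def by auto
qed

lemma an_per_cmult:
  assumes "an_per r f"
  shows "an_per r (\<lambda>p. c * f p)"
proof -
  obtain f' where f': "hol_ext r f f'" using assms unfolding an_per_def by blast
  have "bounded ((\<lambda>p. of_real c * f' p) ` strip r)"
    using bounded_scaling[of "f' ` strip r" c] f' by (simp add: hol_ext_def image_image scaleR_conv_of_real)
  then have "hol_ext r (\<lambda>p. c * f p) (\<lambda>p. of_real c * f' p)"
    using f' unfolding hol_ext_def by (auto intro!: holo2_cmult)
  then show ?thesis using assms unfolding an_per_def periodic2_def by auto
qed

lemma an_per_const: "an_per r (\<lambda>_. c)"
  unfolding an_per_def periodic2_def hol_ext_def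
  by (auto intro!: exI[of _ "\<lambda>_. complex_of_real c"] holo2_const simp: image_constant_conv)

lemma an_per_continuous:
  assumes "an_per r f" "r > 0"
  shows "continuous_on UNIV f"
proof -
  obtain g where g: "hol_ext r f g" using assms unfolding an_per_def by blast
  have "continuous_on UNIV (g \<circ> (\<lambda>p. (complex_of_real (fst p), complex_of_real (snd p))))"
  proof (rule continuous_on_compose)
    show "continuous_on UNIV (\<lambda>p::real \<times> real. (complex_of_real (fst p), complex_of_real (snd p)))"
      by (intro continuous_intros)
    have "range (\<lambda>p::real \<times> real. (complex_of_real (fst p), complex_of_real (snd p))) \<subseteq> strip r"
      using assms(2) by (auto simp: real_mem_strip)
    then show "continuous_on (range (\<lambda>p::real \<times> real. (complex_of_real (fst p), complex_of_real (snd p)))) g"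
      using g unfolding hol_ext_def holo2_def by (meson continuous_on_subset)
  qed
  then have "continuous_on UNIV (\<lambda>p. Re (g (complex_of_real (fst p), complex_of_real (snd p))))"
    unfolding o_def by (rule continuous_on_Re)
  moreover have "Re (g (complex_of_real (fst p), complex_of_real (snd p))) = f p" for p
    using g by (simp add: hol_ext_def)
  ultimately show ?thesis by simp
qed

subsection \<open>Torus maps and skew perturbations of conjugated rotations\<close>

text \<open>The linear part of a torus map makes its complexification unbounded on a strip, so a
  Lipschitz constant takes the place of the sup bound in \<open>hol_ext\<close>.\<close>

definition torus_ext ::
  "(real \<times> real \<Rightarrow> real \<times> real) \<Rightarrow> real \<Rightarrow> real \<Rightarrow> (complex \<times> complex \<Rightarrow> complex) \<Rightarrow>
    (complex \<times> complex \<Rightarrow> complex) \<Rightarrow> bool" where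
  "torus_ext T r L T1 T2 \<longleftrightarrow> 0 < r \<and> 0 \<le> L \<and> holo2 T1 (strip r) \<and> holo2 T2 (strip r) \<and>
    (\<forall>x y. T1 (complex_of_real x, complex_of_real y) = complex_of_real (fst (T (x, y)))) \<and>
    (\<forall>x y. T2 (complex_of_real x, complex_of_real y) = complex_of_real (snd (T (x, y)))) \<and>
    (\<forall>z w z' w'. (z, w) \<in> strip r \<longrightarrow> (z', w') \<in> strip r \<longrightarrow>
      norm (T1 (z, w) - T1 (z', w')) \<le> L * (norm (z - z') + norm (w - w')) \<and>
      norm (T2 (z, w) - T2 (z', w')) \<le> L * (norm (z - z') + norm (w - w')))"

lemma affine_plus_an_per_ext:
  fixes a b :: int
  assumes "an_per r (\<lambda>p. f p - (of_int a * fst p + of_int b * snd p))" "r > 0"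
  shows "\<exists>L\<ge>0. \<exists>g. holo2 g (strip (r / 2)) \<and>
    (\<forall>x y. g (complex_of_real x, complex_of_real y) = complex_of_real (f (x, y))) \<and>
    (\<forall>z w z' w'. (z, w) \<in> strip (r / 2) \<longrightarrow> (z', w') \<in> strip (r / 2) \<longrightarrow>
      norm (g (z, w) - g (z', w')) \<le> L * (norm (z - z') + norm (w - w')))"
proof -
  obtain h where h: "hol_ext r (\<lambda>p. f p - (of_int a * fst p + of_int b * snd p)) h"
    using assms unfolding an_per_def by blast
  obtain L where L: "L \<ge> 0" "\<And>z w z' w'. (z, w) \<in> strip (r / 2) \<Longrightarrow> (z', w') \<in> strip (r / 2) \<Longrightarrow>
      norm (h (z, w) - h (z', w')) \<le> L * (norm (z - z') + norm (w - w'))"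
    using hol_ext_Lipschitz[OF assms(2) h] by blast
  define g where "g = (\<lambda>p. h p + (of_int a * fst p + of_int b * snd p))"
  define K where "K = L + \<bar>of_int a\<bar> + \<bar>of_int b\<bar>"
  have "holo2 h (strip (r / 2))"
    using h assms(2) holo2_subset[OF _ strip_mono[of "r / 2" r]] by (simp add: hol_ext_def)
  then have "holo2 g (strip (r / 2))"
    unfolding g_def by (intro holo2_add holo2_cmult holo2_fst holo2_snd)
  moreover have "\<forall>x y. g (complex_of_real x, complex_of_real y) = complex_of_real (f (x, y))"
    using h by (simp add: hol_ext_def g_def)
  moreover have "norm (g (z, w) - g (z', w')) \<le> K * (norm (z - z') + norm (w - w'))"
    if "(z, w) \<in> strip (r / 2)" "(z', w') \<in> strip (r / 2)" for z w z' w'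
  proof -
    have "g (z, w) - g (z', w') = (h (z, w) - h (z', w')) + (of_int a * (z - z') + of_int b * (w - w'))"
      by (simp add: g_def algebra_simps)
    also have "norm \<dots> \<le> norm (h (z, w) - h (z', w')) + (norm (of_int a * (z - z')) + norm (of_int b * (w - w')))"
      by (intro norm_triangle_le add_mono order_refl norm_triangle_ineq)
    also have "\<dots> \<le> L * (norm (z - z') + norm (w - w')) + (\<bar>of_int a\<bar> * norm (z - z') + \<bar>of_int b\<bar> * norm (w - w'))"
      using L(2)[OF that] by (simp add: norm_mult)
    also have "\<dots> \<le> K * (norm (z - z') + norm (w - w'))"
      by (simp add: K_def algebra_simps)
    finally show ?thesis .
  qed
  moreover have "K \<ge> 0" using L by (simp add: K_def)
  ultimately show ?thesis by blast
qed

lemma torus_an_map_ext: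
  assumes "torus_an_map T"
  shows "\<exists>r L T1 T2. torus_ext T r L T1 T2"
proof -
  obtain a b c d :: int and r where r: "r > 0"
    and 1: "an_per r (\<lambda>p. fst (T p) - (of_int a * fst p + of_int b * snd p))"
    and 2: "an_per r (\<lambda>p. snd (T p) - (of_int c * fst p + of_int d * snd p))"
    using assms unfolding torus_an_map_def by blast
  obtain L T1 where T1: "L \<ge> 0" "holo2 T1 (strip (r / 2))"
    "\<And>x y. T1 (complex_of_real x, complex_of_real y) = complex_of_real (fst (T (x, y)))"
    "\<And>z w z' w'. (z, w) \<in> strip (r / 2) \<Longrightarrow> (z', w') \<in> strip (r / 2) \<Longrightarrow>
      norm (T1 (z, w) - T1 (z', w')) \<le> L * (norm (z - z') + norm (w - w'))"
    using affine_plus_an_per_ext[OF 1 r] by blast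
  obtain K T2 where T2: "K \<ge> 0" "holo2 T2 (strip (r / 2))"
    "\<And>x y. T2 (complex_of_real x, complex_of_real y) = complex_of_real (snd (T (x, y)))"
    "\<And>z w z' w'. (z, w) \<in> strip (r / 2) \<Longrightarrow> (z', w') \<in> strip (r / 2) \<Longrightarrow>
      norm (T2 (z, w) - T2 (z', w')) \<le> K * (norm (z - z') + norm (w - w'))"
    using affine_plus_an_per_ext[OF 2 r] by blast
  have m: "L * u \<le> max L K * u" "K * u \<le> max L K * u" if "u \<ge> 0" for u
    using that by (auto intro: mult_right_mono)
  have "torus_ext T (r / 2) (max L K) T1 T2"
    unfolding torus_ext_def
  proof (intro conjI allI impI)
    fix z w z' w' assume zw: "(z, w) \<in> strip (r / 2)" "(z', w') \<in> strip (r / 2)"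
    show "norm (T1 (z, w) - T1 (z', w')) \<le> max L K * (norm (z - z') + norm (w - w'))"
      by (rule order_trans[OF T1(4)[OF zw] m(1)]) simp
    show "norm (T2 (z, w) - T2 (z', w')) \<le> max L K * (norm (z - z') + norm (w - w'))"
      by (rule order_trans[OF T2(4)[OF zw] m(2)]) simp
  qed (use r T1 T2 in auto)
  then show ?thesis by blast
qed

text \<open>Real points go to real points, so the imaginary part of an image is at most the distance
  to the image of the real part, which the Lipschitz bound controls.\<close>

lemma torus_ext_strip:
  assumes T: "torus_ext T r L T1 T2" and "\<delta> > 0"
  shows "\<exists>\<rho>>0. \<rho> \<le> r \<and> (\<forall>p\<in>strip \<rho>. (T1 p, T2 p) \<in> strip \<delta>)"
proof (intro exI[of _ "min r (\<delta> / (2 * L + 1))"] conjI ballI)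
  have r: "r > 0" and L: "L \<ge> 0" using T by (auto simp: torus_ext_def)
  show "min r (\<delta> / (2 * L + 1)) > 0" using r L assms(2) by simp
  fix p assume "p \<in> strip (min r (\<delta> / (2 * L + 1)))"
  then obtain z w where zw: "p = (z, w)" "\<bar>Im z\<bar> < r" "\<bar>Im w\<bar> < r"
    "\<bar>Im z\<bar> < \<delta> / (2 * L + 1)" "\<bar>Im w\<bar> < \<delta> / (2 * L + 1)"
    by (cases p) (auto simp: mem_strip)
  have n: "norm (u - complex_of_real (Re u)) = \<bar>Im u\<bar>" for u
    by (simp add: cmod_def)
  have in_strip: "(z, w) \<in> strip r" "(complex_of_real (Re z), complex_of_real (Re w)) \<in> strip r"
    using zw r by (auto simp: mem_strip)
  \<comment> \<open>In the width \<open>\<delta> / (2 * L + 1)\<close> the \<open>2 * L\<close>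
    accounts for the two coordinates; the extra 1 makes the inequality strict and covers
    \<open>L = 0\<close>.\<close>
  have b: "L * (\<bar>Im z\<bar> + \<bar>Im w\<bar>) < \<delta>"
  proof -
    have "L * (\<bar>Im z\<bar> + \<bar>Im w\<bar>) \<le> L * (2 * (\<delta> / (2 * L + 1)))"
      using zw L by (intro mult_left_mono) auto
    also have "\<dots> < \<delta>" using L assms(2) by (simp add: field_simps)
    finally show ?thesis .
  qed
  define z' w' where "z' = complex_of_real (Re z)" and "w' = complex_of_real (Re w)"
  have T12: "norm (T1 (z, w) - T1 (z', w')) \<le> L * (norm (z - z') + norm (w - w'))"
      "norm (T2 (z, w) - T2 (z', w')) \<le> L * (norm (z - z') + norm (w - w'))"
    using T in_strip unfolding torus_ext_def z'_def w'_def by blast+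
  have "Im (T1 (z', w')) = 0" "Im (T2 (z', w')) = 0"
    using T by (simp_all add: torus_ext_def z'_def w'_def)
  then have "\<bar>Im (T1 (z, w))\<bar> \<le> norm (T1 (z, w) - T1 (z', w'))" "\<bar>Im (T2 (z, w))\<bar> \<le> norm (T2 (z, w) - T2 (z', w'))"
    using abs_Im_le_cmod[of "T1 (z, w) - T1 (z', w')"] abs_Im_le_cmod[of "T2 (z, w) - T2 (z', w')"] by auto
  then show "(T1 p, T2 p) \<in> strip \<delta>"
    using T12 b n unfolding z'_def w'_def zw(1) mem_strip by fastforce
qed simp

lemma Z2_add: "k \<in> Z2 \<Longrightarrow> l \<in> Z2 \<Longrightarrow> k + l \<in> Z2"
  by (auto simp: Z2_def)

lemma Z2_minus: "k \<in> Z2 \<Longrightarrow> - k \<in> Z2"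
  by (auto simp: Z2_def)

text \<open>The vector \<open>m\<close> is the image of \<open>k\<close> under the integer matrix,
  hence independent of \<open>p\<close>: the map descends to the torus.\<close>

lemma torus_an_map_shift:
  assumes "torus_an_map T" "k \<in> Z2"
  shows "\<exists>m\<in>Z2. \<forall>p. T (p + k) = T p + m"
proof -
  obtain a b c d :: int and r
    where 1: "an_per r (\<lambda>p. fst (T p) - (of_int a * fst p + of_int b * snd p))"
    and 2: "an_per r (\<lambda>p. snd (T p) - (of_int c * fst p + of_int d * snd p))"
    using assms unfolding torus_an_map_def by blast
  define m where "m = (of_int a * fst k + of_int b * snd k, of_int c * fst k + of_int d * snd k)"
  have "T (p + k) = T p + m" for p
  proof (rule prod_eqI)
    have "fst (T (p + k)) - (of_int a * fst (p + k) + of_int b * snd (p + k)) =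
        fst (T p) - (of_int a * fst p + of_int b * snd p)"
      using 1 assms(2) unfolding an_per_def periodic2_def by blast
    then show "fst (T (p + k)) = fst (T p + m)" by (simp add: m_def algebra_simps)
    have "snd (T (p + k)) - (of_int c * fst (p + k) + of_int d * snd (p + k)) =
        snd (T p) - (of_int c * fst p + of_int d * snd p)"
      using 2 assms(2) unfolding an_per_def periodic2_def by blast
    then show "snd (T (p + k)) = snd (T p + m)" by (simp add: m_def algebra_simps)
  qed
  moreover have "m \<in> Z2" using assms(2) by (auto simp: m_def Z2_def)
  ultimately show ?thesis by blast
qed

lemma torus_an_map_continuous:
  assumes "torus_an_map T"
  shows "continuous_on UNIV T"
proof -
  obtain a b c d :: int and r where r: "r > 0"
    and 1: "an_per r (\<lambda>p. fst (T p) - (of_int a * fst p + of_int b * snd p))"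
    and 2: "an_per r (\<lambda>p. snd (T p) - (of_int c * fst p + of_int d * snd p))"
    using assms unfolding torus_an_map_def by blast
  have "continuous_on UNIV (\<lambda>p. ((fst (T p) - (of_int a * fst p + of_int b * snd p)) + (of_int a * fst p + of_int b * snd p),
      (snd (T p) - (of_int c * fst p + of_int d * snd p)) + (of_int c * fst p + of_int d * snd p)))"
    by (intro continuous_on_Pair continuous_on_add an_per_continuous[OF 1 r] an_per_continuous[OF 2 r])
      (intro continuous_intros)+
  then show ?thesis by simp
qed

lemma an_per_compose_torus:
  assumes f: "an_per r f" "r > 0" and T: "torus_an_map T"
  shows "\<exists>\<rho>>0. an_per \<rho> (\<lambda>p. f (T p))"
proof -
  obtain g where g: "hol_ext r f g" using f unfolding an_per_def by blast
  obtain s L T1 T2 where s: "torus_ext T s L T1 T2" using torus_an_map_ext[OF T] by blast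
  obtain \<rho> where \<rho>: "\<rho> > 0" "\<rho> \<le> s" "\<And>p. p \<in> strip \<rho> \<Longrightarrow> (T1 p, T2 p) \<in> strip r"
    using torus_ext_strip[OF s f(2)] by blast
  have "holo2 T1 (strip \<rho>)" "holo2 T2 (strip \<rho>)"
    using s strip_mono[OF \<rho>(2)] holo2_subset unfolding torus_ext_def by blast+
  then have "holo2 (\<lambda>p. g (T1 p, T2 p)) (strip \<rho>)"
    using g \<rho>(3) by (intro holo2_compose[of g, OF _ open_strip]) (auto simp: hol_ext_def)
  moreover have "bounded ((\<lambda>p. g (T1 p, T2 p)) ` strip \<rho>)"
    using g \<rho>(3) by (auto simp: hol_ext_def intro: bounded_subset)
  moreover have "g (T1 (complex_of_real x, complex_of_real y), T2 (complex_of_real x, complex_of_real y)) =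
      complex_of_real (f (T (x, y)))" for x y
    using g s by (simp add: hol_ext_def torus_ext_def)
  ultimately have "hol_ext \<rho> (\<lambda>p. f (T p)) (\<lambda>p. g (T1 p, T2 p))"
    unfolding hol_ext_def by simp
  moreover have "periodic2 (\<lambda>p. f (T p))"
    unfolding periodic2_def
  proof (intro allI impI)
    fix p k assume "k \<in> Z2"
    then obtain m where "m \<in> Z2" "\<And>p. T (p + k) = T p + m" using torus_an_map_shift[OF T] by blast
    then show "f (T (p + k)) = f (T p)" using f(1) unfolding an_per_def periodic2_def by metis
  qed
  ultimately show ?thesis using \<rho> unfolding an_per_def by blast
qed

lemma torus_an_map_compose:
  assumes P: "torus_an_map P" and Q: "torus_an_map Q"
  shows "torus_an_map (P \<circ> Q)"
proof -
  obtain a b c d :: int and r where r: "r > 0"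
    and 1: "an_per r (\<lambda>p. fst (P p) - (of_int a * fst p + of_int b * snd p))"
    and 2: "an_per r (\<lambda>p. snd (P p) - (of_int c * fst p + of_int d * snd p))"
    using P unfolding torus_an_map_def by blast
  obtain a' b' c' d' :: int and r' where r': "r' > 0"
    and Q1: "an_per r' (\<lambda>p. fst (Q p) - (of_int a' * fst p + of_int b' * snd p))"
    and Q2: "an_per r' (\<lambda>p. snd (Q p) - (of_int c' * fst p + of_int d' * snd p))"
    using Q unfolding torus_an_map_def by blast
  obtain r1 where r1: "r1 > 0" "an_per r1 (\<lambda>p. fst (P (Q p)) - (of_int a * fst (Q p) + of_int b * snd (Q p)))"
    using an_per_compose_torus[OF 1 r Q] by blast
  obtain r2 where r2: "r2 > 0" "an_per r2 (\<lambda>p. snd (P (Q p)) - (of_int c * fst (Q p) + of_int d * snd (Q p)))"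
    using an_per_compose_torus[OF 2 r Q] by blast
  define s where "s = min r' (min r1 r2)"
  have s: "s > 0" "s \<le> r'" "s \<le> r1" "s \<le> r2" using r' r1 r2 by (auto simp: s_def)
  note m = an_per_mono[OF Q1 s(2)] an_per_mono[OF Q2 s(2)] an_per_mono[OF r1(2) s(3)] an_per_mono[OF r2(2) s(4)]
  have "an_per s (\<lambda>p. (fst (P (Q p)) - (of_int a * fst (Q p) + of_int b * snd (Q p))) +
      (of_int a * (fst (Q p) - (of_int a' * fst p + of_int b' * snd p)) +
       of_int b * (snd (Q p) - (of_int c' * fst p + of_int d' * snd p))))"
    by (intro an_per_add an_per_cmult m)
  then have A: "an_per s (\<lambda>p. fst ((P \<circ> Q) p) - (of_int (a * a' + b * c') * fst p + of_int (a * b' + b * d') * snd p))"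
    by (simp add: algebra_simps)
  have "an_per s (\<lambda>p. (snd (P (Q p)) - (of_int c * fst (Q p) + of_int d * snd (Q p))) +
      (of_int c * (fst (Q p) - (of_int a' * fst p + of_int b' * snd p)) +
       of_int d * (snd (Q p) - (of_int c' * fst p + of_int d' * snd p))))"
    by (intro an_per_add an_per_cmult m)
  then have B: "an_per s (\<lambda>p. snd ((P \<circ> Q) p) - (of_int (c * a' + d * c') * fst p + of_int (c * b' + d * d') * snd p))"
    by (simp add: algebra_simps)
  show ?thesis unfolding torus_an_map_def using s(1) A B by blast
qed

lemma torus_an_map_translation: "torus_an_map (\<lambda>p. p + k)"
proof -
  have "an_per 1 (\<lambda>p. fst (p + k) - (of_int 1 * fst p + of_int 0 * snd p))"
    "an_per 1 (\<lambda>p. snd (p + k) - (of_int 0 * fst p + of_int 1 * snd p))"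
    using an_per_const[of 1 "fst k"] an_per_const[of 1 "snd k"] by simp_all
  then show ?thesis unfolding torus_an_map_def using zero_less_one by blast
qed

section \<open>Skew products over a rotation and their conjugates\<close>

definition sk :: "real \<Rightarrow> (real \<Rightarrow> real) \<Rightarrow> real \<times> real \<Rightarrow> real \<times> real" where
  "sk \<alpha> \<phi> p = (fst p + \<alpha>, snd p + \<phi> (fst p))"

text \<open>Smallness is measured on a complex strip, not on the real line. The width 1 is a
  convenient choice, shared by all terms because trigonometric polynomials are entire. With an
  arbitrary constant in place of \<delta> the predicate merely says that the function is periodic
  with a bounded holomorphic extension.\<close>

definition small_skew :: "real \<Rightarrow> (real \<Rightarrow> real) \<Rightarrow> (complex \<Rightarrow> complex) \<Rightarrow> bool" where
  "small_skew \<delta> \<phi> \<Phi> \<longleftrightarrow> \<Phi> holomorphic_on {z. \<bar>Im z\<bar> < 1} \<and> (\<forall>z. \<bar>Im z\<bar> < 1 \<longrightarrow> norm (\<Phi> z) \<le> \<delta>) \<and>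
    (\<forall>x. \<Phi> (complex_of_real x) = complex_of_real (\<phi> x)) \<and> (\<forall>x. \<phi> (x + 1) = \<phi> x)"

lemma periodic_Ints:
  fixes f :: "real \<Rightarrow> 'a"
  assumes "\<And>x. f (x + 1) = f x" "k \<in> \<int>"
  shows "f (x + k) = f x"
proof -
  have nat: "f (x + real n) = f x" for n x
    by (induction n) (use assms(1) in \<open>auto simp: algebra_simps\<close>, metis add.assoc add.commute)
  obtain j :: int where j: "k = of_int j" using assms(2) Ints_cases by blast
  show ?thesis
  proof (cases "j \<ge> 0")
    case True
    then show ?thesis using nat[of x "nat j"] j by simp
  next
    case False
    then show ?thesis using nat[of "x + k" "nat (- j)"] j by simp
  qed
qed

lemma sk_shift:
  assumes "\<And>x. \<phi> (x + 1) = \<phi> x" "m \<in> Z2"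
  shows "sk \<alpha> \<phi> (q + m) = sk \<alpha> \<phi> q + m"
  using periodic_Ints[of \<phi> "fst m", OF assms(1)] assms(2)
  by (auto simp: sk_def Z2_def prod_eq_iff)

text \<open>The function \<open>c\<close> stands for one coordinate of the outer map. The two
  arguments of \<open>Q\<close> share their first component and differ in the second by
  \<open>\<Phi>1 - \<Phi>2\<close> at \<open>T1 p\<close>, so the Lipschitz bound gives
  \<open>K * \<eta>\<close>. Passing to the difference makes the result bounded, which
  \<open>Q\<close> itself need not be.\<close>

lemma coordinate_difference_ext:
  assumes P: "holo2 Q (strip r)" and Q_real: "\<And>x y. Q (complex_of_real x, complex_of_real y) = complex_of_real (c (x, y))"
    and Lip: "\<And>z w z' w'. (z, w) \<in> strip r \<Longrightarrow> (z', w') \<in> strip r \<Longrightarrow>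
      norm (Q (z, w) - Q (z', w')) \<le> K * (norm (z - z') + norm (w - w'))" and K: "K \<ge> 0"
    and T: "torus_ext T s L T1 T2" and \<rho>: "\<rho> \<le> s" "\<And>p. p \<in> strip \<rho> \<Longrightarrow> (T1 p, T2 p) \<in> strip (min 1 (r / 2))"
    and r: "r > 0"
    and 1: "small_skew (r / 4) \<phi>1 \<Phi>1" and 2: "small_skew (r / 4) \<phi>2 \<Phi>2"
    and \<eta>: "\<And>z. \<bar>Im z\<bar> < 1 \<Longrightarrow> norm (\<Phi>1 z - \<Phi>2 z) \<le> \<eta>"
  shows "\<exists>g. hol_ext \<rho> (\<lambda>p. c (sk \<alpha> \<phi>1 (T p)) - c (sk \<alpha> \<phi>2 (T p))) g \<and> (\<forall>p\<in>strip \<rho>. norm (g p) \<le> K * \<eta>)"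
proof -
  define a where "a = (\<lambda>p. T1 p + complex_of_real \<alpha>)"
  define b1 where "b1 = (\<lambda>p. T2 p + \<Phi>1 (T1 p))"
  define b2 where "b2 = (\<lambda>p. T2 p + \<Phi>2 (T1 p))"
  define g where "g = (\<lambda>p. Q (a p, b1 p) - Q (a p, b2 p))"
  have hT: "holo2 T1 (strip \<rho>)" "holo2 T2 (strip \<rho>)"
    using T strip_mono[OF \<rho>(1)] holo2_subset unfolding torus_ext_def by blast+
  have Im1: "\<bar>Im (T1 p)\<bar> < 1" "\<bar>Im (T1 p)\<bar> < r / 2" "\<bar>Im (T2 p)\<bar> < r / 2" if "p \<in> strip \<rho>" for p
    using \<rho>(2)[OF that] by (auto simp: mem_strip)
  have o: "open {z. \<bar>Im z\<bar> < 1}" by (intro open_Collect_less continuous_intros)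
  have ha: "holo2 a (strip \<rho>)" unfolding a_def by (intro holo2_add hT holo2_const)
  have hb1: "holo2 b1 (strip \<rho>)"
    unfolding b1_def using 1 Im1(1)
    by (intro holo2_add[OF hT(2)] holo2_compose1[OF _ o hT(1)]) (auto simp: small_skew_def)
  have hb2: "holo2 b2 (strip \<rho>)"
    unfolding b2_def using 2 Im1(1)
    by (intro holo2_add[OF hT(2)] holo2_compose1[OF _ o hT(1)]) (auto simp: small_skew_def)
  \<comment> \<open>The imaginary parts add up to less than \<open>r / 2 + r / 4\<close>: the first
    summand comes from \<open>T\<close>, the second from the skew term.\<close>
  have m1: "(a p, b1 p) \<in> strip r" if p: "p \<in> strip \<rho>" for p
  proof -
    have "norm (\<Phi>1 (T1 p)) \<le> r / 4" using 1 Im1[OF p] by (simp add: small_skew_def)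
    then have "\<bar>Im (\<Phi>1 (T1 p))\<bar> \<le> r / 4" using abs_Im_le_cmod order_trans by blast
    then show ?thesis using Im1(2,3)[OF p] r by (simp add: mem_strip a_def b1_def)
  qed
  have m2: "(a p, b2 p) \<in> strip r" if p: "p \<in> strip \<rho>" for p
  proof -
    have "norm (\<Phi>2 (T1 p)) \<le> r / 4" using 2 Im1[OF p] by (simp add: small_skew_def)
    then have "\<bar>Im (\<Phi>2 (T1 p))\<bar> \<le> r / 4" using abs_Im_le_cmod order_trans by blast
    then show ?thesis using Im1(2,3)[OF p] r by (simp add: mem_strip a_def b2_def)
  qed
  have "holo2 g (strip \<rho>)"
    unfolding g_def
    by (rule holo2_diff[OF holo2_compose[OF P open_strip ha hb1 m1] holo2_compose[OF P open_strip ha hb2 m2]])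
  moreover have bd: "norm (g p) \<le> K * \<eta>" if p: "p \<in> strip \<rho>" for p
  proof -
    have "norm (g p) \<le> K * norm (\<Phi>1 (T1 p) - \<Phi>2 (T1 p))"
      using Lip[OF m1[OF p] m2[OF p]] by (simp add: g_def b1_def b2_def)
    also have "\<dots> \<le> K * \<eta>" using K \<eta> Im1[OF p] by (intro mult_left_mono) auto
    finally show ?thesis .
  qed
  moreover have "bounded (g ` strip \<rho>)" unfolding bounded_iff using bd by (intro exI[of _ "K * \<eta>"]) blast
  moreover have "g (complex_of_real x, complex_of_real y) =
      complex_of_real (c (sk \<alpha> \<phi>1 (T (x, y))) - c (sk \<alpha> \<phi>2 (T (x, y))))" for x y
  proof -
    have T': "T1 (complex_of_real x, complex_of_real y) = complex_of_real (fst (T (x, y)))"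
      "T2 (complex_of_real x, complex_of_real y) = complex_of_real (snd (T (x, y)))"
      using T by (auto simp: torus_ext_def)
    have "\<Phi>1 (complex_of_real u) = complex_of_real (\<phi>1 u)" "\<Phi>2 (complex_of_real u) = complex_of_real (\<phi>2 u)" for u
      using 1 2 by (auto simp: small_skew_def)
    then show ?thesis
      by (simp add: g_def a_def b1_def b2_def T' sk_def Q_real flip: of_real_add)
  qed
  ultimately show ?thesis unfolding hol_ext_def by blast
qed

text \<open>The quantifiers matter: \<rho>, \<delta> and \<open>L\<close> are fixed before \<alpha>
  and the skew functions, so a whole family of perturbations lives in one strip with one Lipschitz
  constant.\<close>

definition skew_controlled ::
  "(real \<times> real \<Rightarrow> real \<times> real) \<Rightarrow> (real \<times> real \<Rightarrow> real \<times> real) \<Rightarrow> real \<Rightarrow> real \<Rightarrow> real \<Rightarrow> bool" where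
  "skew_controlled P T \<rho> \<delta> L \<longleftrightarrow> (\<forall>\<alpha> \<phi>1 \<phi>2 \<Phi>1 \<Phi>2 \<eta>. small_skew \<delta> \<phi>1 \<Phi>1 \<longrightarrow> small_skew \<delta> \<phi>2 \<Phi>2 \<longrightarrow>
    (\<forall>z. \<bar>Im z\<bar> < 1 \<longrightarrow> norm (\<Phi>1 z - \<Phi>2 z) \<le> \<eta>) \<longrightarrow>
    periodic2 (\<lambda>p. fst (P (sk \<alpha> \<phi>1 (T p)) - P (sk \<alpha> \<phi>2 (T p)))) \<and>
    periodic2 (\<lambda>p. snd (P (sk \<alpha> \<phi>1 (T p)) - P (sk \<alpha> \<phi>2 (T p)))) \<and>
    (\<exists>g. hol_ext \<rho> (\<lambda>p. fst (P (sk \<alpha> \<phi>1 (T p)) - P (sk \<alpha> \<phi>2 (T p)))) g \<and> (\<forall>p\<in>strip \<rho>. norm (g p) \<le> L * \<eta>)) \<and>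
    (\<exists>g. hol_ext \<rho> (\<lambda>p. snd (P (sk \<alpha> \<phi>1 (T p)) - P (sk \<alpha> \<phi>2 (T p)))) g \<and> (\<forall>p\<in>strip \<rho>. norm (g p) \<le> L * \<eta>)))"

lemma skew_controlled_exists:
  assumes P: "torus_an_map P" and T: "torus_an_map T"
  shows "\<exists>\<rho>>0. \<exists>\<delta>>0. \<exists>L\<ge>0. skew_controlled P T \<rho> \<delta> L"
proof -
  obtain r K P1 P2 where P': "torus_ext P r K P1 P2" using torus_an_map_ext[OF P] by blast
  obtain s L T1 T2 where T': "torus_ext T s L T1 T2" using torus_an_map_ext[OF T] by blast
  have r: "r > 0" and K: "K \<ge> 0" using P' by (auto simp: torus_ext_def)
  have r4: "r / 4 > 0" and "min 1 (r / 2) > 0" using r by simp_all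
  then obtain \<rho> where \<rho>: "\<rho> > 0" "\<rho> \<le> s" "\<And>p. p \<in> strip \<rho> \<Longrightarrow> (T1 p, T2 p) \<in> strip (min 1 (r / 2))"
    using torus_ext_strip[OF T'] by blast
  \<comment> \<open>A lattice shift of \<open>p\<close> changes both terms by the same vector
    \<open>l\<close>, which cancels in the difference.\<close>
  have per: "P (sk \<alpha> \<phi>1 (T (p + k))) - P (sk \<alpha> \<phi>2 (T (p + k))) = P (sk \<alpha> \<phi>1 (T p)) - P (sk \<alpha> \<phi>2 (T p))"
    if "\<And>x. \<phi>1 (x + 1) = \<phi>1 x" "\<And>x. \<phi>2 (x + 1) = \<phi>2 x" and k: "k \<in> Z2" for \<alpha> \<phi>1 \<phi>2 p k
  proof -
    obtain m where m: "m \<in> Z2" "\<And>p. T (p + k) = T p + m" using torus_an_map_shift[OF T k] by blast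
    obtain l where l: "\<And>p. P (p + m) = P p + l" using torus_an_map_shift[OF P m(1)] by blast
    show ?thesis by (simp add: m(2) sk_shift[of \<phi>1 m, OF that(1) m(1)] sk_shift[of \<phi>2 m, OF that(2) m(1)] l)
  qed
  show ?thesis
    unfolding skew_controlled_def
  proof (rule exI[of _ \<rho>], rule conjI[OF \<rho>(1)], rule exI[of _ "r / 4"], rule conjI[OF r4],
      rule exI[of _ K], rule conjI[OF K], intro allI impI conjI)
    fix \<alpha> \<phi>1 \<phi>2 \<Phi>1 \<Phi>2 \<eta>
    assume 1: "small_skew (r / 4) \<phi>1 \<Phi>1" and 2: "small_skew (r / 4) \<phi>2 \<Phi>2"
      and \<eta>: "\<forall>z. \<bar>Im z\<bar> < 1 \<longrightarrow> norm (\<Phi>1 z - \<Phi>2 z) \<le> \<eta>"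
    have p: "\<phi>1 (x + 1) = \<phi>1 x" "\<phi>2 (x + 1) = \<phi>2 x" for x
      using 1 2 by (auto simp: small_skew_def)
    show "periodic2 (\<lambda>p. fst (P (sk \<alpha> \<phi>1 (T p)) - P (sk \<alpha> \<phi>2 (T p))))"
      "periodic2 (\<lambda>p. snd (P (sk \<alpha> \<phi>1 (T p)) - P (sk \<alpha> \<phi>2 (T p))))"
      unfolding periodic2_def using per[of \<phi>1 \<phi>2, OF p] by simp_all
    have "\<exists>g. hol_ext \<rho> (\<lambda>p. fst (P (sk \<alpha> \<phi>1 (T p))) - fst (P (sk \<alpha> \<phi>2 (T p)))) g \<and> (\<forall>p\<in>strip \<rho>. norm (g p) \<le> K * \<eta>)"
      using P' \<eta> by (intro coordinate_difference_ext[where c = "\<lambda>p. fst (P p)" and Q = P1, OF _ _ _ K T' \<rho>(2,3) r 1 2])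
        (auto simp: torus_ext_def)
    then show "\<exists>g. hol_ext \<rho> (\<lambda>p. fst (P (sk \<alpha> \<phi>1 (T p)) - P (sk \<alpha> \<phi>2 (T p)))) g \<and> (\<forall>p\<in>strip \<rho>. norm (g p) \<le> K * \<eta>)"
      by simp
    have "\<exists>g. hol_ext \<rho> (\<lambda>p. snd (P (sk \<alpha> \<phi>1 (T p))) - snd (P (sk \<alpha> \<phi>2 (T p)))) g \<and> (\<forall>p\<in>strip \<rho>. norm (g p) \<le> K * \<eta>)"
      using P' \<eta> by (intro coordinate_difference_ext[where c = "\<lambda>p. snd (P p)" and Q = P2, OF _ _ _ K T' \<rho>(2,3) r 1 2])
        (auto simp: torus_ext_def)
    then show "\<exists>g. hol_ext \<rho> (\<lambda>p. snd (P (sk \<alpha> \<phi>1 (T p)) - P (sk \<alpha> \<phi>2 (T p)))) g \<and> (\<forall>p\<in>strip \<rho>. norm (g p) \<le> K * \<eta>)"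
      by simp
  qed
qed

lemma Rot_eq_sk: "Rot \<alpha> = sk \<alpha> (\<lambda>_. 0)"
  by (auto simp: Rot_def sk_def)

lemma small_skew_zero: "\<delta> \<ge> 0 \<Longrightarrow> small_skew \<delta> (\<lambda>_. 0) (\<lambda>_. 0)"
  by (simp add: small_skew_def)

lemma small_skew_mono: "small_skew \<delta> \<phi> \<Phi> \<Longrightarrow> \<delta> \<le> \<delta>' \<Longrightarrow> small_skew \<delta>' \<phi> \<Phi>"
  unfolding small_skew_def by (meson order_trans)

lemma small_skew_minus: "small_skew \<delta> \<phi> \<Phi> \<Longrightarrow> small_skew \<delta> (\<lambda>x. - \<phi> x) (\<lambda>z. - \<Phi> z)"
  unfolding small_skew_def by (auto intro!: holomorphic_intros)

lemma small_skew_shift: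
  assumes "small_skew \<delta> \<phi> \<Phi>"
  shows "small_skew \<delta> (\<lambda>x. \<phi> (x + a)) (\<lambda>z. \<Phi> (z + complex_of_real a))"
proof -
  have "(\<Phi> \<circ> (\<lambda>z. z + complex_of_real a)) holomorphic_on {z. \<bar>Im z\<bar> < 1}"
    using assms unfolding small_skew_def
    by (intro holomorphic_on_compose_gen[where t = "{z. \<bar>Im z\<bar> < 1}"] holomorphic_intros) auto
  moreover have "\<phi> (x + 1 + a) = \<phi> (x + a)" for x
    using assms unfolding small_skew_def by (metis add.assoc add.commute)
  moreover have "\<Phi> (complex_of_real x + complex_of_real a) = complex_of_real (\<phi> (x + a))" for x
    using assms unfolding small_skew_def by (simp flip: of_real_add)
  ultimately show ?thesis
    using assms unfolding small_skew_def by (auto simp: o_def)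
qed

lemma id_plus_an_continuous:
  assumes "id_plus_an r F" "r > 0"
  shows "continuous_on UNIV F"
proof -
  have "continuous_on UNIV (\<lambda>p. fst (F p - p))" "continuous_on UNIV (\<lambda>p. snd (F p - p))"
    using assms an_per_continuous unfolding id_plus_an_def by blast+
  then have "continuous_on UNIV (\<lambda>p. (fst (F p - p) + fst p, snd (F p - p) + snd p))"
    by (intro continuous_on_Pair continuous_on_add continuous_on_fst[OF continuous_on_id]
      continuous_on_snd[OF continuous_on_id])
  then show ?thesis by simp
qed

lemma Ints_valued_constant:
  fixes f :: "real \<times> real \<Rightarrow> real"
  assumes "continuous_on UNIV f" "\<And>p. f p \<in> \<int>"
  shows "f p = f q"
proof -
  have "f constant_on UNIV"
  proof (rule continuous_discrete_range_constant[OF connected_UNIV assms(1)])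
    fix p
    have "1 \<le> norm (f q - f p)" if "f q \<noteq> f p" for q
    proof -
      have "f q - f p \<in> \<int>" "f q - f p \<noteq> 0" using assms(2) that by auto
      then show ?thesis using Ints_nonzero_abs_ge1 by fastforce
    qed
    then show "\<exists>e>0. \<forall>q. q \<in> UNIV \<and> f q \<noteq> f p \<longrightarrow> e \<le> norm (f q - f p)"
      by (intro exI[of _ 1]) auto
  qed
  then show ?thesis unfolding constant_on_def by (metis UNIV_I)
qed

text \<open>In \<open>A_set\<close> the conjugacy holds only modulo \<open>Z2\<close>. The
  discrepancy is continuous with values in a discrete set, hence a single vector \<open>k\<close> on
  the connected plane. The inverse \<open>S\<close>, there merely set-theoretic, coincides with the
  analytic inverse of \<open>T\<close>.\<close>

lemma A_set_conjugacy:
  assumes "F \<in> A_set \<alpha>"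
  obtains T S k where "torus_an_map T" "torus_an_map S" "T \<in> borel_measurable borel"
    "distr lborel lborel T = lborel" "S \<circ> T = id" "T \<circ> S = id" "k \<in> Z2" "F = (\<lambda>p. S (Rot \<alpha> (T p)) + k)"
proof -
  obtain T S where T: "analytic_diffeo T" "T \<in> borel_measurable borel" "distr lborel lborel T = lborel"
    and ST: "S \<circ> T = id" "T \<circ> S = id" and F: "\<And>p. F p - S (Rot \<alpha> (T p)) \<in> Z2"
    using assms unfolding A_set_def by blast
  obtain S' where S': "torus_an_map S'" "T \<circ> S' = id" and tT: "torus_an_map T"
    using T(1) unfolding analytic_diffeo_def by blast
  have "S = S \<circ> (T \<circ> S')" by (simp add: S'(2))
  also have "\<dots> = S'" by (simp add: ST(1) flip: comp_assoc)
  finally have tS: "torus_an_map S" using S' by simp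
  obtain r where "r > 0" "id_plus_an r F" using assms unfolding A_set_def Diff_all_def by blast
  then have cF: "continuous_on UNIV F" using id_plus_an_continuous by blast
  have cR: "continuous_on UNIV (Rot \<alpha>)" unfolding Rot_def by (intro continuous_intros)
  have "continuous_on UNIV (S \<circ> (Rot \<alpha> \<circ> T))"
    using torus_an_map_continuous[OF tS] torus_an_map_continuous[OF tT] cR
    by (intro continuous_on_compose) (auto intro: continuous_on_subset)
  then have cD: "continuous_on UNIV (\<lambda>p. F p - S (Rot \<alpha> (T p)))"
    using cF by (intro continuous_on_diff) (auto simp: o_def)
  have "fst (F p - S (Rot \<alpha> (T p))) = fst (F 0 - S (Rot \<alpha> (T 0)))" for p
    using cD F by (intro Ints_valued_constant[of "\<lambda>p. fst (F p - S (Rot \<alpha> (T p)))"] continuous_on_fst) (auto simp: Z2_def)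
  moreover have "snd (F p - S (Rot \<alpha> (T p))) = snd (F 0 - S (Rot \<alpha> (T 0)))" for p
    using cD F by (intro Ints_valued_constant[of "\<lambda>p. snd (F p - S (Rot \<alpha> (T p)))"] continuous_on_snd) (auto simp: Z2_def)
  ultimately have "F p - S (Rot \<alpha> (T p)) = F 0 - S (Rot \<alpha> (T 0))" for p
    by (rule prod_eqI)
  then have "F = (\<lambda>p. S (Rot \<alpha> (T p)) + (F 0 - S (Rot \<alpha> (T 0))))"
    by (metis add.commute diff_add_cancel)
  then show ?thesis using that tT tS T ST F by blast
qed

lemma dist_r_le:
  assumes r: "r > 0" and "hol_ext r (\<lambda>p. fst (F p - G p)) f" "\<And>p. p \<in> strip r \<Longrightarrow> norm (f p) \<le> c"
    and "hol_ext r (\<lambda>p. snd (F p - G p)) g" "\<And>p. p \<in> strip r \<Longrightarrow> norm (g p) \<le> c"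
  shows "dist_r r F G \<le> c"
  unfolding dist_r_def using assms by (intro max.boundedI SUP_ext_le) auto

lemma id_plus_an_perturb:
  assumes "id_plus_an r F" "an_per s (\<lambda>p. fst (G p - F p))" "an_per s (\<lambda>p. snd (G p - F p))"
  shows "id_plus_an (min s r) G"
proof -
  have m: "min s r \<le> s" "min s r \<le> r" by auto
  have "an_per (min s r) (\<lambda>p. fst (G p - F p) + fst (F p - p))"
    using assms by (intro an_per_add an_per_mono[OF _ m(1)] an_per_mono[OF _ m(2)]) (auto simp: id_plus_an_def)
  moreover have "an_per (min s r) (\<lambda>p. snd (G p - F p) + snd (F p - p))"
    using assms by (intro an_per_add an_per_mono[OF _ m(1)] an_per_mono[OF _ m(2)]) (auto simp: id_plus_an_def)
  ultimately show ?thesis unfolding id_plus_an_def by simp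
qed

text \<open>Membership in \<open>Diff_all\<close> also concerns the inverse, which is again a
  conjugated skew product, over the rotation by \<open>- \<alpha>\<close>. The map and its inverse
  are each a controlled perturbation of the ones belonging to \<open>\<phi> = 0\<close>, that is, of
  \<open>F\<close> and \<open>F'\<close>, for which the required form is known.\<close>

lemma skew_family_Diff_r:
  assumes F: "F \<in> Diff_all" and F_eq: "F = (\<lambda>p. S (Rot \<alpha> (T p)) + k)"
    and T: "torus_an_map T" and S: "torus_an_map S" and ST: "S \<circ> T = id" and TS: "T \<circ> S = id"
  shows "\<exists>\<rho>>0. \<exists>\<delta>>0. \<exists>L\<ge>0.
    (\<forall>\<phi> \<Phi>. small_skew \<delta> \<phi> \<Phi> \<longrightarrow> (\<lambda>p. S (sk \<alpha> \<phi> (T p)) + k) \<in> Diff_r \<rho>) \<and>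
    (\<forall>\<phi>1 \<phi>2 \<Phi>1 \<Phi>2 \<eta>. small_skew \<delta> \<phi>1 \<Phi>1 \<longrightarrow> small_skew \<delta> \<phi>2 \<Phi>2 \<longrightarrow>
      (\<forall>z. \<bar>Im z\<bar> < 1 \<longrightarrow> norm (\<Phi>1 z - \<Phi>2 z) \<le> \<eta>) \<longrightarrow>
      dist_r \<rho> (\<lambda>p. S (sk \<alpha> \<phi>1 (T p)) + k) (\<lambda>p. S (sk \<alpha> \<phi>2 (T p)) + k) \<le> L * \<eta>)"
proof -
  define P where "P = (\<lambda>p. p + k) \<circ> S"
  define Q where "Q = T \<circ> (\<lambda>p. p + - k)"
  have P: "torus_an_map P" and Q: "torus_an_map Q"
    unfolding P_def Q_def by (intro torus_an_map_compose torus_an_map_translation S T)+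
  obtain \<rho>1 \<delta>1 L1 where 1: "\<rho>1 > 0" "\<delta>1 > 0" "L1 \<ge> 0" and c1: "skew_controlled P T \<rho>1 \<delta>1 L1"
    using skew_controlled_exists[OF P T] by blast
  note D1 = c1[unfolded skew_controlled_def, rule_format]
  obtain \<rho>2 \<delta>2 L2 where 2: "\<rho>2 > 0" "\<delta>2 > 0" "L2 \<ge> 0" and c2: "skew_controlled S Q \<rho>2 \<delta>2 L2"
    using skew_controlled_exists[OF S Q] by blast
  note D2 = c2[unfolded skew_controlled_def, rule_format]
  obtain r where r: "r > 0" "id_plus_an r F" using F unfolding Diff_all_def by blast
  obtain F' r' where r': "r' > 0" "id_plus_an r' F'" "F' \<circ> F = id" "F \<circ> F' = id"
    using F unfolding Diff_all_def by blast
  have STp: "S (T p) = p" "T (S p) = p" for p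
    using fun_cong[OF ST, of p] fun_cong[OF TS, of p] by auto
  define D where "D = (\<lambda>\<phi> p. P (sk \<alpha> \<phi> (T p)))"
  \<comment> \<open>Solving \<open>(x', y') = (x + \<alpha>, y + \<phi> x)\<close> for
    \<open>(x, y)\<close> gives the skew function \<open>- \<phi> (x' - \<alpha>)\<close>. The outer
    translation by \<open>k\<close> has to be undone first, which is the purpose of
    \<open>Q\<close>.\<close>
  define D' where "D' = (\<lambda>\<phi> p. S (sk (- \<alpha>) (\<lambda>x. - \<phi> (x + - \<alpha>)) (Q p)))"
  have inv: "D \<phi> \<circ> D' \<phi> = id" "D' \<phi> \<circ> D \<phi> = id" for \<phi>
    by (auto simp: D_def D'_def P_def Q_def STp sk_def fun_eq_iff)
  have FD: "F = D (\<lambda>_. 0)"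
    by (simp add: F_eq D_def P_def Rot_eq_sk)
  \<comment> \<open>Uniqueness of inverses identifies the given analytic inverse with the explicit
    one, so it can serve as the base point for \<open>D2\<close>.\<close>
  have "F' = F' \<circ> (F \<circ> D' (\<lambda>_. 0))" by (simp add: FD inv)
  also have "\<dots> = D' (\<lambda>_. 0)" by (simp add: r' flip: comp_assoc)
  finally have FD': "F' = D' (\<lambda>_. 0)" .
  \<comment> \<open>The widths \<open>\<rho>2\<close> and \<open>r'\<close> do not enter:
    \<open>Diff_r\<close> fixes the strip for the map only, its inverse may use any strip.\<close>
  define \<rho> where "\<rho> = min \<rho>1 r"
  define \<delta> where "\<delta> = min \<delta>1 \<delta>2"
  have \<rho>: "\<rho> > 0" "\<rho> \<le> \<rho>1" and \<delta>: "\<delta> > 0" "\<delta> \<le> \<delta>1" "\<delta> \<le> \<delta>2" using 1 2 r by (auto simp: \<rho>_def \<delta>_def)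
  have "D \<phi> \<in> Diff_r \<rho>" if \<phi>: "small_skew \<delta> \<phi> \<Phi>" for \<phi> \<Phi>
  proof -
    have s1: "small_skew \<delta>1 \<phi> \<Phi>" and s2: "small_skew \<delta>2 \<phi> \<Phi>"
      using small_skew_mono[OF \<phi>] \<delta> by blast+
    have b1: "norm (\<Phi> z - 0) \<le> \<delta>1" if "\<bar>Im z\<bar> < 1" for z using s1 that by (simp add: small_skew_def)
    have "an_per \<rho>1 (\<lambda>p. fst (D \<phi> p - F p))" "an_per \<rho>1 (\<lambda>p. snd (D \<phi> p - F p))"
      using D1[OF s1 small_skew_zero[OF less_imp_le[OF 1(2)]] b1, of \<alpha>] unfolding FD D_def an_per_def by auto
    then have idD: "id_plus_an \<rho> (D \<phi>)" using id_plus_an_perturb[OF r(2)] unfolding \<rho>_def by blast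
    define \<phi>' \<Phi>' where "\<phi>' = (\<lambda>x. - \<phi> (x + - \<alpha>))" and "\<Phi>' = (\<lambda>z. - \<Phi> (z + complex_of_real (- \<alpha>)))"
    have s2': "small_skew \<delta>2 \<phi>' \<Phi>'"
      unfolding \<phi>'_def \<Phi>'_def using s2 by (intro small_skew_minus small_skew_shift)
    have b2: "norm (\<Phi>' z - 0) \<le> \<delta>2" if "\<bar>Im z\<bar> < 1" for z using s2' that by (simp add: small_skew_def)
    have "an_per \<rho>2 (\<lambda>p. fst (D' \<phi> p - F' p))" "an_per \<rho>2 (\<lambda>p. snd (D' \<phi> p - F' p))"
      using D2[OF s2' small_skew_zero[OF less_imp_le[OF 2(2)]] b2, of "- \<alpha>"] unfolding FD' D'_def \<phi>'_def an_per_def by auto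
    then have "id_plus_an (min \<rho>2 r') (D' \<phi>)" using id_plus_an_perturb[OF r'(2)] by blast
    moreover have "min \<rho>2 r' > 0" using 2 r' by simp
    ultimately show ?thesis
      using idD \<rho>(1) inv unfolding Diff_r_def Diff_all_def by blast
  qed
  moreover have "dist_r \<rho> (D \<phi>1) (D \<phi>2) \<le> L1 * \<eta>"
    if s: "small_skew \<delta> \<phi>1 \<Phi>1" "small_skew \<delta> \<phi>2 \<Phi>2"
      and \<eta>: "\<forall>z. \<bar>Im z\<bar> < 1 \<longrightarrow> norm (\<Phi>1 z - \<Phi>2 z) \<le> \<eta>" for \<phi>1 \<phi>2 \<Phi>1 \<Phi>2 \<eta>
  proof -
    obtain f g where f: "hol_ext \<rho>1 (\<lambda>p. fst (D \<phi>1 p - D \<phi>2 p)) f" "\<And>p. p \<in> strip \<rho>1 \<Longrightarrow> norm (f p) \<le> L1 * \<eta>"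
      and g: "hol_ext \<rho>1 (\<lambda>p. snd (D \<phi>1 p - D \<phi>2 p)) g" "\<And>p. p \<in> strip \<rho>1 \<Longrightarrow> norm (g p) \<le> L1 * \<eta>"
      using D1[OF small_skew_mono[OF s(1) \<delta>(2)] small_skew_mono[OF s(2) \<delta>(2)] \<eta>[rule_format], of \<alpha>] unfolding D_def by blast
    show ?thesis
      by (rule dist_r_le[OF \<rho>(1) hol_ext_mono[OF f(1) \<rho>(2)] _ hol_ext_mono[OF g(1) \<rho>(2)]])
        (use f(2) g(2) strip_mono[OF \<rho>(2)] in auto)
  qed
  moreover have "D \<phi> = (\<lambda>p. S (sk \<alpha> \<phi> (T p)) + k)" for \<phi>
    by (simp add: D_def P_def)
  ultimately have "(\<forall>\<phi> \<Phi>. small_skew \<delta> \<phi> \<Phi> \<longrightarrow> (\<lambda>p. S (sk \<alpha> \<phi> (T p)) + k) \<in> Diff_r \<rho>) \<and>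
    (\<forall>\<phi>1 \<phi>2 \<Phi>1 \<Phi>2 \<eta>. small_skew \<delta> \<phi>1 \<Phi>1 \<longrightarrow> small_skew \<delta> \<phi>2 \<Phi>2 \<longrightarrow>
      (\<forall>z. \<bar>Im z\<bar> < 1 \<longrightarrow> norm (\<Phi>1 z - \<Phi>2 z) \<le> \<eta>) \<longrightarrow>
      dist_r \<rho> (\<lambda>p. S (sk \<alpha> \<phi>1 (T p)) + k) (\<lambda>p. S (sk \<alpha> \<phi>2 (T p)) + k) \<le> L1 * \<eta>)"
    by simp
  then show ?thesis using \<rho>(1) \<delta>(1) 1(3) by blast
qed

subsection \<open>Area-preserving shears\<close>

lemma torus_an_map_shear:
  assumes h: "small_skew C h H"
  shows "torus_an_map (sk 0 h)"
proof -
  have o: "open {z. \<bar>Im z\<bar> < 1}" by (intro open_Collect_less continuous_intros)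
  have "holo2 (\<lambda>p. H (fst p)) (strip 1)"
    using h by (intro holo2_compose1[OF _ o holo2_fst]) (auto simp: small_skew_def strip_def)
  moreover have "bounded ((\<lambda>p. H (fst p)) ` strip 1)"
    using h unfolding bounded_iff small_skew_def strip_def by (intro exI[of _ C]) auto
  ultimately have "hol_ext 1 (\<lambda>p. h (fst p)) (\<lambda>p. H (fst p))"
    using h by (simp add: hol_ext_def small_skew_def)
  moreover have "periodic2 (\<lambda>p. h (fst p))"
    using h periodic_Ints[of h] by (auto simp: periodic2_def Z2_def small_skew_def)
  ultimately have "an_per 1 (\<lambda>p. h (fst p))" unfolding an_per_def by blast
  then have "an_per 1 (\<lambda>p. snd (sk 0 h p) - (of_int 0 * fst p + of_int 1 * snd p))"
    "an_per 1 (\<lambda>p. fst (sk 0 h p) - (of_int 1 * fst p + of_int 0 * snd p))"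
    using an_per_const[of 1 0] by (simp_all add: sk_def)
  then show ?thesis unfolding torus_an_map_def using zero_less_one by blast
qed

lemma small_skew_continuous:
  assumes "small_skew C h H"
  shows "continuous_on UNIV h"
proof -
  have "continuous_on UNIV (H \<circ> complex_of_real)"
    using assms unfolding small_skew_def
    by (intro continuous_on_compose continuous_on_subset[OF holomorphic_on_imp_continuous_on] continuous_intros) auto
  then have "continuous_on UNIV (\<lambda>x. Re (H (complex_of_real x)))"
    unfolding o_def by (rule continuous_on_Re)
  then show ?thesis using assms by (simp add: small_skew_def)
qed

lemma shear_measurable:
  assumes [measurable]: "h \<in> borel_measurable borel"
  shows "sk \<alpha> h \<in> borel_measurable borel"
  unfolding sk_def[abs_def] borel_prod[symmetric] by measurable

lemma emeasure_lborel_vimage_add: "B \<in> sets borel \<Longrightarrow> emeasure lborel ((\<lambda>y::'a::euclidean_space. y + c) -` B) = emeasure lborel B"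
  by (subst (2) lborel_distr_plus[of c, symmetric]) (simp add: emeasure_distr add.commute[of _ c])

text \<open>By Tonelli: each vertical section of the preimage is a translate of the corresponding
  section of \<open>A\<close>.\<close>

lemma shear_preserves_lborel:
  assumes h: "h \<in> borel_measurable borel"
  shows "distr lborel lborel (sk 0 h) = lborel"
proof (rule measure_eqI)
  fix A assume "A \<in> sets (distr lborel lborel (sk 0 h))"
  then have A: "A \<in> sets borel" by simp
  note m = shear_measurable[OF h, of 0]
  have A': "sk 0 h -` A \<in> sets borel" using measurable_sets_borel[OF m A] .
  have pm: "X \<in> sets borel \<Longrightarrow> X \<in> sets (lborel \<Otimes>\<^sub>M lborel)" for X :: "(real \<times> real) set"
    by (simp only: lborel_prod sets_lborel)
  have sec: "Pair x -` A \<in> sets borel" for x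
    using sets_Pair1[OF pm[OF A], of x] by simp
  have "emeasure (distr lborel lborel (sk 0 h)) A = emeasure lborel (sk 0 h -` A)"
    using m A by (subst emeasure_distr) auto
  also have "\<dots> = emeasure (lborel \<Otimes>\<^sub>M lborel) (sk 0 h -` A)" by (simp add: lborel_prod)
  also have "\<dots> = (\<integral>\<^sup>+ x. emeasure lborel (Pair x -` (sk 0 h -` A)) \<partial>lborel)"
    by (rule lborel.emeasure_pair_measure_alt[OF pm[OF A']])
  also have "\<dots> = (\<integral>\<^sup>+ x. emeasure lborel (Pair x -` A) \<partial>lborel)"
  proof (rule nn_integral_cong)
    fix x
    have "Pair x -` (sk 0 h -` A) = (\<lambda>y. y + h x) -` (Pair x -` A)" by (auto simp: sk_def)
    then show "emeasure lborel (Pair x -` (sk 0 h -` A)) = emeasure lborel (Pair x -` A)"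
      using emeasure_lborel_vimage_add[OF sec] by simp
  qed
  also have "\<dots> = emeasure (lborel \<Otimes>\<^sub>M lborel) A"
    by (rule lborel.emeasure_pair_measure_alt[OF pm[OF A], symmetric])
  finally show "emeasure (distr lborel lborel (sk 0 h)) A = emeasure lborel A" by (simp add: lborel_prod)
qed simp

text \<open>A coboundary skew product factors as
  \<open>sk 0 g \<circ> Rot \<alpha> \<circ> sk 0 (- g)\<close>. The shears are therefore absorbed
  into the conjugacy, giving the area-preserving \<open>T'\<close> below.\<close>

lemma coboundary_skew_in_A_set:
  assumes T: "torus_an_map T" "T \<in> borel_measurable borel" "distr lborel lborel T = lborel"
    and S: "torus_an_map S" and ST: "S \<circ> T = id" and TS: "T \<circ> S = id" and k: "k \<in> Z2"
    and g: "small_skew C g G" and F: "(\<lambda>p. S (sk \<alpha> (\<lambda>x. g (x + \<alpha>) - g x) (T p)) + k) \<in> Diff_all"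
  shows "(\<lambda>p. S (sk \<alpha> (\<lambda>x. g (x + \<alpha>) - g x) (T p)) + k) \<in> A_set \<alpha>"
proof -
  define T' where "T' = sk 0 (\<lambda>x. - g x) \<circ> T"
  define S' where "S' = S \<circ> sk 0 g"
  have STp: "S (T p) = p" "T (S p) = p" for p
    using fun_cong[OF ST, of p] fun_cong[OF TS, of p] by auto
  have tT': "torus_an_map T'" and tS': "torus_an_map S'"
    unfolding T'_def S'_def using torus_an_map_shear[OF g] torus_an_map_shear[OF small_skew_minus[OF g]] T S
    by (auto intro: torus_an_map_compose)
  have inv: "S' \<circ> T' = id" "T' \<circ> S' = id"
    by (auto simp: T'_def S'_def fun_eq_iff sk_def STp)
  have mg: "(\<lambda>x. - g x) \<in> borel_measurable borel"
    using small_skew_continuous[OF g] by (intro borel_measurable_continuous_onI continuous_intros)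
  have mT': "T' \<in> borel_measurable borel"
    unfolding T'_def using T(2) shear_measurable[OF mg, of 0] by (rule measurable_comp)
  have "distr lborel lborel T' = distr (distr lborel lborel T) lborel (sk 0 (\<lambda>x. - g x))"
    unfolding T'_def using T(2) shear_measurable[OF mg, of 0] by (subst distr_distr) auto
  also have "\<dots> = lborel" by (simp add: T(3) shear_preserves_lborel[OF mg])
  finally have dT': "distr lborel lborel T' = lborel" .
  have "S (sk \<alpha> (\<lambda>x. g (x + \<alpha>) - g x) (T p)) + k - S' (Rot \<alpha> (T' p)) = k" for p
    by (simp add: S'_def T'_def sk_def Rot_def algebra_simps)
  then have "\<forall>p. S (sk \<alpha> (\<lambda>x. g (x + \<alpha>) - g x) (T p)) + k - S' (Rot \<alpha> (T' p)) \<in> Z2"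
    using k by simp
  moreover have "analytic_diffeo T'" unfolding analytic_diffeo_def using tT' tS' inv by blast
  ultimately show ?thesis
    unfolding A_set_def using F inv mT' dT' by blast
qed

subsection \<open>Coboundaries over a Liouville rotation\<close>

text \<open>Classical Liouville numbers only ask for polynomial rates. Exponential ones are needed
  to beat the growth of frequency-\<open>q\<close> terms on the strip, and the rate \<open>n\<close>
  must be arbitrary because it has to exceed \<open>2 * pi * M\<close> for every order
  \<open>M\<close> of a kernel. The strict lower bound excludes rational \<alpha>.\<close>

definition liouville :: "real \<Rightarrow> bool" where
  "liouville \<alpha> \<longleftrightarrow> (\<forall>n::nat. \<exists>q::nat. \<exists>p::int. n \<le> q \<and> 0 < \<bar>real q * \<alpha> - of_int p\<bar> \<and>
    \<bar>real q * \<alpha> - of_int p\<bar> < exp (- (real n * real q)))"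

text \<open>The m-th iterate of the rotation conjugated by the shear along \<open>g\<close> appears
  in its telescoped closed form. The bound \<open>N\<close> is uniform in the starting point and the
  target, which lets it enter the choice of the next \<epsilon>.\<close>

definition orbit_dense :: "real \<Rightarrow> (real \<Rightarrow> real) \<Rightarrow> real \<Rightarrow> nat \<Rightarrow> bool" where
  "orbit_dense \<alpha> g \<epsilon> N \<longleftrightarrow> (\<forall>x0 y0 x1 y1. \<exists>m\<le>N. \<exists>a b::int. \<bar>x0 + real m * \<alpha> - of_int a - x1\<bar> < \<epsilon> \<and>
    \<bar>y0 + g (x0 + real m * \<alpha>) - g x0 - of_int b - y1\<bar> < \<epsilon>)"

text \<open>One good denominator \<open>q\<close> suffices: \<open>q\<close> rotations move a point
  by the tiny non-zero amount \<theta> modulo 1, and the multiples of \<theta> up to about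
  \<open>1 / \<bar>\<theta>\<bar>\<close> already form a net of the circle.\<close>

lemma liouville_rotation_dense:
  assumes "liouville \<alpha>" "\<delta> > 0"
  shows "\<exists>N. \<forall>x x1. \<exists>m\<le>N. \<exists>a::int. \<bar>x + real m * \<alpha> - of_int a - x1\<bar> < \<delta>"
proof -
  obtain n :: nat where n: "1 / \<delta> < real n" using reals_Archimedean2 by blast
  then have n0: "n \<ge> 1" using assms(2) by (cases n) (auto simp: field_simps)
  obtain q :: nat and p :: int where qp: "n \<le> q" "0 < \<bar>real q * \<alpha> - of_int p\<bar>"
    "\<bar>real q * \<alpha> - of_int p\<bar> < exp (- (real n * real q))"
    using assms(1) unfolding liouville_def by blast
  define \<theta> where "\<theta> = real q * \<alpha> - of_int p"
  have "real n \<le> real n * real q" using qp n0 by (simp add: mult_le_cancel_left1)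
  then have "exp (- (real n * real q)) \<le> exp (- real n)" by simp
  also have "\<dots> \<le> 1 / real n"
    using n0 less_imp_le[OF exp_gt_self[of "real n"]] by (simp add: exp_minus field_simps)
  also have "\<dots> < \<delta>" using n n0 assms(2) by (simp add: field_simps)
  finally have \<theta>: "\<bar>\<theta>\<bar> < \<delta>" "\<theta> \<noteq> 0" using qp by (auto simp: \<theta>_def)
  define J where "J = nat \<lceil>1 / \<bar>\<theta>\<bar>\<rceil>"
  have step: "\<exists>j\<le>J. \<bar>u - real j * \<bar>\<theta>\<bar>\<bar> < \<delta>" if u: "0 \<le> u" "u < 1" for u
  proof (intro exI[of _ "nat \<lfloor>u / \<bar>\<theta>\<bar>\<rfloor>"] conjI)
    have 0: "0 \<le> u / \<bar>\<theta>\<bar>" using u by simp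
    have "u / \<bar>\<theta>\<bar> \<le> 1 / \<bar>\<theta>\<bar>" using u by (intro divide_right_mono) auto
    then show "nat \<lfloor>u / \<bar>\<theta>\<bar>\<rfloor> \<le> J" unfolding J_def by (intro nat_mono) linarith
    have "real (nat \<lfloor>u / \<bar>\<theta>\<bar>\<rfloor>) = of_int \<lfloor>u / \<bar>\<theta>\<bar>\<rfloor>" using 0 by simp
    moreover have "of_int \<lfloor>u / \<bar>\<theta>\<bar>\<rfloor> \<le> u / \<bar>\<theta>\<bar>" "u / \<bar>\<theta>\<bar> < of_int \<lfloor>u / \<bar>\<theta>\<bar>\<rfloor> + 1" by linarith+
    ultimately have "real (nat \<lfloor>u / \<bar>\<theta>\<bar>\<rfloor>) \<le> u / \<bar>\<theta>\<bar>" "u / \<bar>\<theta>\<bar> < real (nat \<lfloor>u / \<bar>\<theta>\<bar>\<rfloor>) + 1"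
      by simp_all
    then have "real (nat \<lfloor>u / \<bar>\<theta>\<bar>\<rfloor>) * \<bar>\<theta>\<bar> \<le> u" "u < (real (nat \<lfloor>u / \<bar>\<theta>\<bar>\<rfloor>) + 1) * \<bar>\<theta>\<bar>"
      using \<theta>(2) by (simp_all only: pos_le_divide_eq pos_divide_less_eq zero_less_abs_iff not_False_eq_True)
    then show "\<bar>u - real (nat \<lfloor>u / \<bar>\<theta>\<bar>\<rfloor>) * \<bar>\<theta>\<bar>\<bar> < \<delta>" using \<theta>(1) by (simp add: distrib_right)
  qed
  have "\<exists>m\<le>J * q. \<exists>a::int. \<bar>x + real m * \<alpha> - of_int a - x1\<bar> < \<delta>" for x x1
  proof (cases "\<theta> > 0")
    case True
    obtain j where j: "j \<le> J" "\<bar>frac (x1 - x) - real j * \<bar>\<theta>\<bar>\<bar> < \<delta>"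
      using step[of "frac (x1 - x)"] frac_ge_0 frac_lt_1 by blast
    have "x + real (j * q) * \<alpha> - of_int (int j * p - \<lfloor>x1 - x\<rfloor>) - x1 = - (frac (x1 - x) - real j * \<bar>\<theta>\<bar>)"
      using True by (simp add: frac_def \<theta>_def algebra_simps)
    then have "\<bar>x + real (j * q) * \<alpha> - of_int (int j * p - \<lfloor>x1 - x\<rfloor>) - x1\<bar> < \<delta>" using j by simp
    then show ?thesis using j(1) mult_le_mono1 by blast
  next
    case False
    \<comment> \<open>For negative \<theta> the steps go to the left, so the distance to be covered
      is \<open>x - x1\<close> modulo 1.\<close>
    obtain j where j: "j \<le> J" "\<bar>frac (x - x1) - real j * \<bar>\<theta>\<bar>\<bar> < \<delta>"
      using step[of "frac (x - x1)"] frac_ge_0 frac_lt_1 by blast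
    have "x + real (j * q) * \<alpha> - of_int (int j * p + \<lfloor>x - x1\<rfloor>) - x1 = frac (x - x1) - real j * \<bar>\<theta>\<bar>"
      using False by (simp add: frac_def \<theta>_def algebra_simps)
    then have "\<bar>x + real (j * q) * \<alpha> - of_int (int j * p + \<lfloor>x - x1\<rfloor>) - x1\<bar> < \<delta>" using j by simp
    then show ?thesis using j(1) mult_le_mono1 by blast
  qed
  then show ?thesis by blast
qed

lemma periodic_uniformly_continuous:
  fixes g :: "real \<Rightarrow> real"
  assumes "continuous_on UNIV g" "\<And>x. g (x + 1) = g x" "\<epsilon> > 0"
  shows "\<exists>\<delta>>0. \<forall>x y. \<bar>x - y\<bar> < \<delta> \<longrightarrow> \<bar>g x - g y\<bar> < \<epsilon>"
proof -
  \<comment> \<open>Two periods are taken so that two points at distance below 1 can be moved into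
    the interval by the same integer.\<close>
  have "uniformly_continuous_on {0..2} g"
    using assms(1) by (intro compact_uniformly_continuous) (auto intro: continuous_on_subset)
  then obtain d where d: "d > 0" "\<And>x y. x \<in> {0..2} \<Longrightarrow> y \<in> {0..2} \<Longrightarrow> dist y x < d \<Longrightarrow> dist (g y) (g x) < \<epsilon>"
    using assms(3) unfolding uniformly_continuous_on_def by metis
  have "\<bar>g x - g y\<bar> < \<epsilon>" if xy: "\<bar>x - y\<bar> < min d 1" for x y
  proof -
    define k :: real where "k = of_int (- \<lfloor>min x y\<rfloor>)"
    have g: "g (x + k) = g x" "g (y + k) = g y"
      using periodic_Ints[of g k, OF assms(2)] by (auto simp: k_def)
    have "x + k \<in> {0..2}" "y + k \<in> {0..2}" using xy unfolding k_def by (auto simp: min_def split: if_splits; linarith)+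
    moreover have "dist (x + k) (y + k) < d" using xy by (simp add: dist_real_def)
    ultimately have "dist (g (x + k)) (g (y + k)) < \<epsilon>" using d(2) by blast
    then show ?thesis by (simp add: g dist_real_def)
  qed
  then show ?thesis using d(1) by (intro exI[of _ "min d 1"]) auto
qed

text \<open>The oscillation hypothesis makes the graph of \<^term>\<open>g\<close> dense modulo 1 at scale \<^term>\<open>\<epsilon>\<close>;
  an orbit of the rotation conjugated by the shear along \<^term>\<open>g\<close> fills out a vertical translate of it.\<close>

lemma orbit_dense_if_oscillating:
  fixes g :: "real \<Rightarrow> real"
  assumes \<alpha>: "liouville \<alpha>" and g: "continuous_on UNIV g" "\<And>x. g (x + 1) = g x" and \<epsilon>: "\<epsilon> > 0"
    and osc: "\<And>x. \<exists>a b. x \<le> a \<and> a \<le> b \<and> b \<le> x + \<epsilon> / 2 \<and> g b + 1 \<le> g a"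
  shows "\<exists>N. orbit_dense \<alpha> g \<epsilon> N"
proof -
  obtain d where d: "d > 0" "\<And>x y. \<bar>x - y\<bar> < d \<Longrightarrow> \<bar>g x - g y\<bar> < \<epsilon>"
    using periodic_uniformly_continuous[OF g \<epsilon>] by blast
  \<comment> \<open>Here \<open>d\<close> controls the values of \<open>g\<close>;
    \<open>\<epsilon> / 2\<close> adds up with the length of the oscillation interval to the
    horizontal error \<epsilon>.\<close>
  have "min d (\<epsilon> / 2) > 0" using d \<epsilon> by simp
  then obtain N where N: "\<And>x x1. \<exists>m\<le>N. \<exists>a::int. \<bar>x + real m * \<alpha> - of_int a - x1\<bar> < min d (\<epsilon> / 2)"
    using liouville_rotation_dense[OF \<alpha>] by blast
  have "\<exists>m\<le>N. \<exists>a b::int. \<bar>x0 + real m * \<alpha> - of_int a - x1\<bar> < \<epsilon> \<and>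
      \<bar>y0 + g (x0 + real m * \<alpha>) - g x0 - of_int b - y1\<bar> < \<epsilon>" for x0 y0 x1 y1
  proof -
    obtain u v where uv: "x1 \<le> u" "u \<le> v" "v \<le> x1 + \<epsilon> / 2" "g v + 1 \<le> g u" using osc by blast
    \<comment> \<open>The vertical target is hit when \<open>g\<close> takes the value
      \<open>t\<close> modulo 1. The range between \<open>g v\<close> and \<open>g u\<close> has
      length at least 1, so it contains some \<open>t + of_int b\<close>, and the intermediate value
      theorem applies.\<close>
    define t where "t = y1 - y0 + g x0"
    define b where "b = \<lceil>g v - t\<rceil>"
    have "g v \<le> t + of_int b" "t + of_int b \<le> g u" using uv unfolding b_def by linarith+
    then obtain x' where x': "u \<le> x'" "x' \<le> v" "g x' = t + of_int b"
      using IVT2'[of g v "t + of_int b" u] uv continuous_on_subset[OF g(1)] by auto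
    obtain m a where m: "m \<le> N" "\<bar>x0 + real m * \<alpha> - of_int a - x'\<bar> < min d (\<epsilon> / 2)"
      using N by blast
    have "g (x0 + real m * \<alpha> - of_int a) = g (x0 + real m * \<alpha>)"
      using periodic_Ints[of g "- of_int a", OF g(2)] by simp
    then have "\<bar>g (x0 + real m * \<alpha>) - g x'\<bar> < \<epsilon>"
      using d(2)[of "x0 + real m * \<alpha> - of_int a" x'] m by simp
    then have "\<bar>y0 + g (x0 + real m * \<alpha>) - g x0 - of_int b - y1\<bar> < \<epsilon>" by (simp add: x'(3) t_def algebra_simps)
    moreover have "\<bar>x0 + real m * \<alpha> - of_int a - x1\<bar> < \<epsilon>" using m(2) x' uv by linarith
    ultimately show ?thesis using m(1) by blast
  qed
  then show ?thesis unfolding orbit_dense_def by blast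
qed

text \<open>A Fejer kernel of frequency \<open>q\<close>, normalised to height 2.\<close>

definition fejer :: "nat \<Rightarrow> nat \<Rightarrow> real \<Rightarrow> real" where
  "fejer M q x = 2 / (real M)\<^sup>2 * (\<Sum>j<M. \<Sum>l<M. cos (2 * pi * (real j - real l) * real q * x))"

definition cfejer :: "nat \<Rightarrow> nat \<Rightarrow> complex \<Rightarrow> complex" where
  "cfejer M q z = complex_of_real (2 / (real M)\<^sup>2) *
    (\<Sum>j<M. \<Sum>l<M. cos (complex_of_real (2 * pi * (real j - real l) * real q) * z))"

lemma cfejer_of_real: "cfejer M q (complex_of_real x) = complex_of_real (fejer M q x)"
proof -
  have "cos (complex_of_real a * complex_of_real x) = complex_of_real (cos (a * x))" for a
    by (simp add: cos_of_real flip: of_real_mult)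
  then show ?thesis by (simp only: cfejer_def fejer_def of_real_sum of_real_mult[of "2 / (real M)\<^sup>2"])
qed

text \<open>The double sum is the squared modulus of the sum of
  \<open>exp (2 * pi * \<i> * j * q * x)\<close> over \<open>j < M\<close>, split into real and
  imaginary parts. Non-negativity and the zeros are read off from this form.\<close>

lemma fejer_eq_squares:
  "fejer M q x = 2 / (real M)\<^sup>2 *
    ((\<Sum>j<M. cos (2 * pi * real j * real q * x))\<^sup>2 + (\<Sum>j<M. sin (2 * pi * real j * real q * x))\<^sup>2)"
proof -
  have "cos (2 * pi * (real j - real l) * real q * x) =
      cos (2 * pi * real j * real q * x) * cos (2 * pi * real l * real q * x) +
      sin (2 * pi * real j * real q * x) * sin (2 * pi * real l * real q * x)" for j l
    by (simp add: algebra_simps flip: cos_diff)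
  then show ?thesis
    by (simp add: fejer_def power2_eq_square sum_product sum.distrib)
qed

lemma fejer_nonneg: "fejer M q x \<ge> 0"
  by (simp add: fejer_eq_squares)

lemma fejer_periodic: "fejer M q (x + 1) = fejer M q x"
proof -
  have "cos (2 * pi * (real j - real l) * real q * (x + 1)) = cos (2 * pi * (real j - real l) * real q * x)" for j l
  proof -
    have "2 * pi * (real j - real l) * real q * (x + 1) =
        2 * pi * (real j - real l) * real q * x + 2 * pi * of_int ((int j - int l) * int q)"
      by (simp add: algebra_simps)
    then show ?thesis by (simp only: cos_add cos_int_2pin sin_int_2pin)
  qed
  then show ?thesis by (simp add: fejer_def)
qed

lemma fejer_peak:
  assumes "M > 0" "q > 0"
  shows "fejer M q (of_int i / real q) = 2"
proof -
  have "cos (2 * pi * (real j - real l) * real q * (of_int i / real q)) = 1" for j l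
  proof -
    have "2 * pi * (real j - real l) * real q * (of_int i / real q) = 2 * pi * of_int ((int j - int l) * i)"
      using assms by simp
    then show ?thesis by (simp only: cos_int_2pin)
  qed
  then show ?thesis using assms by (simp add: fejer_def power2_eq_square)
qed

text \<open>Half a period away from a peak the exponentials alternate between 1 and -1, and an even
  number of them cancels. This is why the order is taken even.\<close>

lemma fejer_zero:
  assumes "q > 0"
  shows "fejer (2 * K) q (of_int i / real q + 1 / (2 * real q)) = 0"
proof -
  have e: "2 * pi * real j * real q * (of_int i / real q + 1 / (2 * real q)) = real j * pi + 2 * pi * of_int (int j * i)" for j
    using assms by (simp add: field_simps)
  have c: "cos (2 * pi * real j * real q * (of_int i / real q + 1 / (2 * real q))) = (- 1) ^ j"
    "sin (2 * pi * real j * real q * (of_int i / real q + 1 / (2 * real q))) = 0" for j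
    by (simp_all only: e cos_add sin_add cos_int_2pin sin_int_2pin) simp_all
  have "(\<Sum>j<2 * K. (- 1 :: real) ^ j) = 0"
    by (induction K) simp_all
  then show ?thesis by (simp only: fejer_eq_squares c) simp
qed

lemma has_integral_cos_period:
  fixes d :: int
  assumes "d \<noteq> 0"
  shows "((\<lambda>x. cos (2 * pi * of_int d * x)) has_integral 0) {0..1::real}"
proof -
  have "((\<lambda>x. cos (2 * pi * of_int d * x)) has_integral
      (sin (2 * pi * of_int d * 1) / (2 * pi * of_int d) - sin (2 * pi * of_int d * 0) / (2 * pi * of_int d))) {0..1::real}"
  proof (rule fundamental_theorem_of_calculus)
    fix x :: real
    show "((\<lambda>x. sin (2 * pi * of_int d * x) / (2 * pi * of_int d)) has_vector_derivative cos (2 * pi * of_int d * x))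
        (at x within {0..1})"
      unfolding has_real_derivative_iff_has_vector_derivative[symmetric]
      using assms by (auto intro!: derivative_eq_intros)
  qed simp
  then show ?thesis using sin_int_2pin[of d] by simp
qed

text \<open>Only the \<open>M\<close> diagonal terms among the \<open>M * M\<close> have non-zero
  mean: the mean tends to 0 with growing \<open>M\<close> while the height remains 2.\<close>

lemma fejer_has_integral:
  assumes "M > 0" "q > 0"
  shows "(fejer M q has_integral 2 / real M) {0..1}"
proof -
  have "((\<lambda>x. cos (2 * pi * (real j - real l) * real q * x)) has_integral (if l = j then 1 else 0)) {0..1}" for j l
  proof (cases "l = j")
    case True
    then show ?thesis using has_integral_const_real[of "1::real" 0 1] by simp
  next
    case False
    then have "(int j - int l) * int q \<noteq> 0" using assms by simp
    from has_integral_cos_period[OF this] show ?thesis using False by (simp add: mult.assoc)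
  qed
  then have "((\<lambda>x. 2 / (real M)\<^sup>2 * (\<Sum>j<M. \<Sum>l<M. cos (2 * pi * (real j - real l) * real q * x))) has_integral
      2 / (real M)\<^sup>2 * (\<Sum>j<M. \<Sum>l<M. if l = j then 1 else 0)) {0..1}"
    by (intro has_integral_mult_right has_integral_sum) auto
  moreover have "(\<Sum>j<M. \<Sum>l<M. if l = j then 1 else 0) = real M"
    by (simp add: sum.delta)
  ultimately show ?thesis using assms by (simp add: fejer_def[abs_def] power2_eq_square)
qed

lemma fejer_continuous: "continuous_on UNIV (fejer M q)"
  unfolding fejer_def[abs_def] by (intro continuous_intros)

lemma fejer_nn_integral:
  assumes "M > 0" "q > 0"
  shows "(\<integral>\<^sup>+ x. ennreal (indicator {0..1} x * fejer M q x) \<partial>lborel) = ennreal (2 / real M)"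
  using fejer_nonneg fejer_has_integral[OF assms]
    borel_measurable_continuous_onI[OF fejer_continuous]
  by (intro nn_integral_has_integral_lebesgue) auto

section \<open>Fejer kernels on a complex strip\<close>

lemma norm_cos_le_exp_Im: "norm (cos z) \<le> exp \<bar>Im z\<bar>"
proof -
  have "norm (exp (\<i> * z) + exp (- (\<i> * z))) \<le> norm (exp (\<i> * z)) + norm (exp (- (\<i> * z)))"
    by (rule norm_triangle_ineq)
  also have "\<dots> \<le> exp \<bar>Im z\<bar> + exp \<bar>Im z\<bar>"
    by (intro add_mono) auto
  finally show ?thesis by (simp add: cos_exp_eq norm_divide)
qed

lemma norm_sin_le_exp_Im: "norm (sin z) \<le> exp \<bar>Im z\<bar>"
proof -
  have "norm (exp (\<i> * z) - exp (- (\<i> * z))) \<le> norm (exp (\<i> * z)) + norm (exp (- (\<i> * z)))"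
    by (rule norm_triangle_ineq4)
  also have "\<dots> \<le> exp \<bar>Im z\<bar> + exp \<bar>Im z\<bar>"
    by (intro add_mono) auto
  finally show ?thesis by (simp add: sin_exp_eq norm_divide norm_mult)
qed

text \<open>The difference is a product of two sines. The one at the midpoint has an argument with
  the same imaginary part as \<open>z\<close>, and the other, at a real point, supplies the factor
  \<open>\<bar>t\<bar>\<close>.\<close>

lemma norm_cos_shift_le: "norm (cos (z + complex_of_real t) - cos z) \<le> \<bar>t\<bar> * exp \<bar>Im z\<bar>"
proof -
  have "cos (z + complex_of_real t) - cos z =
      2 * sin ((z + complex_of_real t + z) / 2) * sin ((z - (z + complex_of_real t)) / 2)"
    by (rule cos_diff_cos)
  also have "\<dots> = 2 * sin (z + complex_of_real (t / 2)) * complex_of_real (sin (- (t / 2)))"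
    by (simp add: field_simps flip: sin_of_real)
  also have "norm \<dots> \<le> 2 * exp \<bar>Im z\<bar> * \<bar>t / 2\<bar>"
  proof -
    have "norm (sin (z + complex_of_real (t / 2))) \<le> exp \<bar>Im z\<bar>"
      using norm_sin_le_exp_Im[of "z + complex_of_real (t / 2)"] by simp
    moreover have "\<bar>sin (- (t / 2))\<bar> \<le> \<bar>t / 2\<bar>" using abs_sin_x_le_abs_x[of "- (t / 2)"] by simp
    ultimately show ?thesis
      unfolding norm_mult norm_of_real by (intro mult_mono) auto
  qed
  finally show ?thesis by (simp add: mult.commute)
qed

lemma fejer_frequency_bound:
  assumes "j < M" "l < M" "\<bar>Im z\<bar> < 1"
  shows "\<bar>Im (complex_of_real (2 * pi * (real j - real l) * real q) * z)\<bar> \<le> 2 * pi * real M * real q"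
proof -
  have "\<bar>real j - real l\<bar> * \<bar>Im z\<bar> \<le> real M * 1"
    using assms by (intro mult_mono) auto
  then have "2 * pi * real q * (\<bar>real j - real l\<bar> * \<bar>Im z\<bar>) \<le> 2 * pi * real q * (real M * 1)"
    by (intro mult_left_mono) auto
  moreover have "\<bar>Im (complex_of_real (2 * pi * (real j - real l) * real q) * z)\<bar> =
      2 * pi * real q * (\<bar>real j - real l\<bar> * \<bar>Im z\<bar>)"
  proof -
    have "Im (complex_of_real a * z) = a * Im z" for a by simp
    then show ?thesis by (simp only: abs_mult) (simp add: mult_ac)
  qed
  ultimately show ?thesis by (simp add: mult_ac)
qed

lemma norm_double_sum_le:
  fixes c :: "nat \<Rightarrow> nat \<Rightarrow> complex"
  assumes "M > 0" "\<And>j l. j < M \<Longrightarrow> l < M \<Longrightarrow> norm (c j l) \<le> B"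
  shows "norm (complex_of_real (2 / (real M)\<^sup>2) * (\<Sum>j<M. \<Sum>l<M. c j l)) \<le> 2 * B"
proof -
  have "norm (\<Sum>j<M. \<Sum>l<M. c j l) \<le> (\<Sum>j<M. \<Sum>l<M. B)"
    using assms(2) by (intro sum_norm_le order_trans[OF norm_sum] sum_mono) auto
  then have "norm (\<Sum>j<M. \<Sum>l<M. c j l) \<le> (real M)\<^sup>2 * B" by (simp add: power2_eq_square)
  then have "2 / (real M)\<^sup>2 * norm (\<Sum>j<M. \<Sum>l<M. c j l) \<le> 2 / (real M)\<^sup>2 * ((real M)\<^sup>2 * B)"
    by (intro mult_left_mono) auto
  then show ?thesis using assms(1) by (simp add: norm_mult norm_divide norm_power)
qed

lemma fejer_small_skew:
  assumes "M > 0"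
  shows "small_skew (2 * exp (2 * pi * real M * real q)) (fejer M q) (cfejer M q)"
  unfolding small_skew_def
proof (intro conjI allI impI cfejer_of_real fejer_periodic)
  show "cfejer M q holomorphic_on {z. \<bar>Im z\<bar> < 1}"
    unfolding cfejer_def[abs_def] by (intro holomorphic_intros)
  fix z :: complex assume z: "\<bar>Im z\<bar> < 1"
  show "norm (cfejer M q z) \<le> 2 * exp (2 * pi * real M * real q)"
    unfolding cfejer_def
  proof (rule norm_double_sum_le[OF assms])
    fix j l assume jl: "j < M" "l < M"
    show "norm (cos (complex_of_real (2 * pi * (real j - real l) * real q) * z)) \<le> exp (2 * pi * real M * real q)"
      by (rule order_trans[OF norm_cos_le_exp_Im]) (use fejer_frequency_bound[OF jl z] in simp)
  qed
qed

text \<open>All frequencies are multiples of \<open>q\<close>, so translation by \<alpha> shifts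
  each phase by a multiple of \<open>q * \<alpha>\<close>; modulo full periods only the multiple of
  \<open>q * \<alpha> - p\<close> remains. The exponential is the price of working on the
  strip.\<close>

lemma cfejer_shift_bound:
  assumes "M > 0" and z: "\<bar>Im z\<bar> < 1"
  shows "norm (cfejer M q (z + complex_of_real \<alpha>) - cfejer M q z) \<le>
    2 * (2 * pi * real M * \<bar>real q * \<alpha> - of_int p\<bar> * exp (2 * pi * real M * real q))"
proof -
  define \<theta> where "\<theta> = real q * \<alpha> - of_int p"
  define f where "f = (\<lambda>j l. complex_of_real (2 * pi * (real j - real l) * real q))"
  have "cfejer M q (z + complex_of_real \<alpha>) - cfejer M q z = complex_of_real (2 / (real M)\<^sup>2) *
      (\<Sum>j<M. \<Sum>l<M. (cos (f j l * (z + complex_of_real \<alpha>)) - cos (f j l * z)))"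
    by (simp add: cfejer_def f_def sum_subtractf right_diff_distrib)
  also have "norm \<dots> \<le> 2 * (2 * pi * real M * \<bar>\<theta>\<bar> * exp (2 * pi * real M * real q))"
  proof (rule norm_double_sum_le[OF assms(1)])
    fix j l assume jl: "j < M" "l < M"
    define t where "t = 2 * pi * (real j - real l) * \<theta>"
    have "f j l * (z + complex_of_real \<alpha>) =
        (f j l * z + complex_of_real t) + complex_of_real (2 * pi * of_int ((int j - int l) * p))"
      by (simp add: f_def t_def \<theta>_def algebra_simps)
    moreover have "cos (w + complex_of_real (2 * pi * of_int i)) = cos w" for w i
      by (simp only: cos_add cos_of_real sin_of_real cos_int_2pin sin_int_2pin) simp
    ultimately have "cos (f j l * (z + complex_of_real \<alpha>)) = cos (f j l * z + complex_of_real t)"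
      by metis
    then have "norm (cos (f j l * (z + complex_of_real \<alpha>)) - cos (f j l * z)) \<le> \<bar>t\<bar> * exp \<bar>Im (f j l * z)\<bar>"
      using norm_cos_shift_le by metis
    also have "\<dots> \<le> (2 * pi * real M * \<bar>\<theta>\<bar>) * exp (2 * pi * real M * real q)"
    proof (rule mult_mono)
      have "\<bar>real j - real l\<bar> * \<bar>\<theta>\<bar> \<le> real M * \<bar>\<theta>\<bar>" using jl by (intro mult_right_mono) auto
      then have "2 * pi * (\<bar>real j - real l\<bar> * \<bar>\<theta>\<bar>) \<le> 2 * pi * (real M * \<bar>\<theta>\<bar>)" by (intro mult_left_mono) auto
      then show "\<bar>t\<bar> \<le> 2 * pi * real M * \<bar>\<theta>\<bar>" by (simp only: t_def abs_mult) (simp add: mult.assoc)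
      show "exp \<bar>Im (f j l * z)\<bar> \<le> exp (2 * pi * real M * real q)"
        using fejer_frequency_bound[OF jl z, of q] by (simp add: f_def)
    qed auto
    finally show "norm (cos (f j l * (z + complex_of_real \<alpha>)) - cos (f j l * z)) \<le>
        2 * pi * real M * \<bar>\<theta>\<bar> * exp (2 * pi * real M * real q)" .
  qed
  finally show ?thesis by (simp add: \<theta>_def)
qed

lemma small_skew_add:
  assumes "small_skew C f F" "small_skew D g G"
  shows "small_skew (C + D) (\<lambda>x. f x + g x) (\<lambda>z. F z + G z)"
  using assms unfolding small_skew_def by (auto intro!: holomorphic_intros norm_triangle_mono)

text \<open>The order of choices is decisive: first \<open>M\<close>, from the prescribed mean; then
  \<open>n\<close>, depending on \<open>M\<close>, \<epsilon> and the modulus of continuity of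
  \<open>g\<close>; last the denominator \<open>q\<close>. Over half a period of \<open>h\<close>
  the old function \<open>g\<close> varies by less than 1/2 and cannot undo the drop by 2.\<close>

lemma oscillating_coboundary:
  assumes \<alpha>: "liouville \<alpha>" and g: "small_skew C g G" and \<epsilon>: "\<epsilon> > 0"
  shows "\<exists>h H D N. small_skew D h H \<and> (\<forall>x. 0 \<le> h x) \<and>
    (\<integral>\<^sup>+ x. ennreal (indicator {0..1} x * h x) \<partial>lborel) \<le> ennreal \<epsilon> \<and>
    (\<forall>z. \<bar>Im z\<bar> < 1 \<longrightarrow> norm (H (z + complex_of_real \<alpha>) - H z) \<le> \<epsilon>) \<and>
    orbit_dense \<alpha> (\<lambda>x. g x + h x) \<epsilon> N"
proof -
  have gc: "continuous_on UNIV g" and gp: "\<And>x. g (x + 1) = g x"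
    using small_skew_continuous[OF g] g by (auto simp: small_skew_def)
  obtain K :: nat where K: "1 / \<epsilon> < real K" using reals_Archimedean2 by blast
  then have K0: "K > 0" using \<epsilon> by (cases K) (auto simp: field_simps)
  define M where "M = 2 * K"
  have M: "M > 0" "2 / real M \<le> \<epsilon>" using K K0 \<epsilon> by (auto simp: M_def field_simps)
  obtain d where d: "d > 0" "\<And>x y. \<bar>x - y\<bar> < d \<Longrightarrow> \<bar>g x - g y\<bar> < 1 / 2"
    using periodic_uniformly_continuous[OF gc gp, of "1 / 2"] by auto
  \<comment> \<open>The summands serve in turn: to beat the growth on the strip with rate 1 to
    spare, to bring the remaining \<open>4 * pi * M / q\<close> below \<epsilon>, to make half a
    period shorter than \<open>d\<close>, and to fit a peak and the next zero into an interval of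
    length \<open>\<epsilon> / 2\<close>.\<close>
  obtain n :: nat where "2 * pi * real M + 1 + 4 * pi * real M / \<epsilon> + 1 / d + 4 / \<epsilon> < real n"
    using reals_Archimedean2 by blast
  moreover have "0 \<le> 2 * pi * real M" "0 \<le> 4 * pi * real M / \<epsilon>" "0 < 1 / d" "0 < 4 / \<epsilon>" using \<epsilon> d by auto
  ultimately have n: "2 * pi * real M + 1 \<le> real n" "4 * pi * real M / \<epsilon> \<le> real n" "1 / d < real n"
    "4 / \<epsilon> \<le> real n" "1 \<le> real n" by linarith+
  obtain q :: nat and p :: int where qp: "n \<le> q" "\<bar>real q * \<alpha> - of_int p\<bar> < exp (- (real n * real q))"
    using \<alpha> unfolding liouville_def by blast
  have q: "q > 0" "real n \<le> real q" using qp n by auto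
  define h where "h = fejer M q"
  have hs: "small_skew (2 * exp (2 * pi * real M * real q)) h (cfejer M q)"
    unfolding h_def by (rule fejer_small_skew[OF M(1)])
  have int: "(\<integral>\<^sup>+ x. ennreal (indicator {0..1} x * h x) \<partial>lborel) \<le> ennreal \<epsilon>"
    unfolding h_def fejer_nn_integral[OF M(1) q(1)] using M(2) by (rule ennreal_leI)
  have cob: "norm (cfejer M q (z + complex_of_real \<alpha>) - cfejer M q z) \<le> \<epsilon>" if z: "\<bar>Im z\<bar> < 1" for z
  proof -
    define \<theta> where "\<theta> = \<bar>real q * \<alpha> - of_int p\<bar>"
    have "\<theta> * exp (2 * pi * real M * real q) \<le> exp (- (real n * real q)) * exp (2 * pi * real M * real q)"
      using qp by (intro mult_right_mono) (auto simp: \<theta>_def)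
    also have "\<dots> = exp (- ((real n - 2 * pi * real M) * real q))"
      by (simp add: algebra_simps flip: exp_add)
    also have "\<dots> \<le> exp (- (1 * real q))"
    proof -
      have "1 * real q \<le> (real n - 2 * pi * real M) * real q" using n by (intro mult_right_mono) auto
      then show ?thesis by simp
    qed
    also have "\<dots> \<le> 1 / real q"
      using q less_imp_le[OF exp_gt_self[of "real q"]] by (simp add: exp_minus field_simps)
    finally have "\<theta> * exp (2 * pi * real M * real q) \<le> 1 / real q" .
    then have "4 * pi * real M * (\<theta> * exp (2 * pi * real M * real q)) \<le> 4 * pi * real M * (1 / real q)"
      by (intro mult_left_mono) auto
    also have "\<dots> \<le> \<epsilon>"
    proof -
      have "4 * pi * real M \<le> real n * \<epsilon>" using n(2) \<epsilon> by (simp add: field_simps)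
      also have "\<dots> \<le> real q * \<epsilon>" using q \<epsilon> by (intro mult_right_mono) auto
      finally show ?thesis using q by (simp add: field_simps)
    qed
    finally show ?thesis
      using cfejer_shift_bound[OF M(1) z, of q \<alpha> p] by (simp add: \<theta>_def mult_ac)
  qed
  have "\<exists>N. orbit_dense \<alpha> (\<lambda>x. g x + h x) \<epsilon> N"
  proof (rule orbit_dense_if_oscillating[OF \<alpha> _ _ \<epsilon>])
    show "continuous_on UNIV (\<lambda>x. g x + h x)"
      using gc fejer_continuous unfolding h_def by (intro continuous_on_add)
    show "g (x + 1) + h (x + 1) = g x + h x" for x by (simp add: gp h_def fejer_periodic)
    fix x
    \<comment> \<open>The point \<open>a\<close> is the first peak at or to the right of
      \<open>x\<close>, and \<open>b\<close> the zero half a period later.\<close>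
    define i where "i = \<lceil>real q * x\<rceil>"
    define a where "a = of_int i / real q"
    define b where "b = of_int i / real q + 1 / (2 * real q)"
    have "h a = 2" "h b = 0"
      unfolding h_def a_def b_def M_def using fejer_peak[of "2 * K" q i] fejer_zero[of q K i] K0 q by auto
    moreover have "\<bar>a - b\<bar> < d"
    proof -
      have "1 / d < 2 * real q" using n(3) q by linarith
      then show ?thesis using d(1) q by (simp add: a_def b_def field_simps)
    qed
    then have "\<bar>g a - g b\<bar> < 1 / 2" by (rule d(2))
    moreover have "x \<le> a" unfolding a_def i_def using q by (simp add: field_simps)
    moreover have "a \<le> b" using q by (simp add: a_def b_def)
    moreover have "b \<le> x + \<epsilon> / 2"
    proof -
      have "of_int i \<le> real q * x + 1" unfolding i_def by linarith
      then have "a \<le> x + 1 / real q" using q by (simp add: a_def field_simps)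
      moreover define s where "s = 1 / real q"
      moreover have "b = a + s / 2" "0 < s" "2 / real q = 2 * s" using q by (simp_all add: b_def a_def s_def)
      ultimately have "b \<le> x + 2 / real q" by linarith
      also have "2 / real q \<le> \<epsilon> / 2"
      proof -
        have "4 \<le> real n * \<epsilon>" using n(4) \<epsilon> by (simp add: field_simps)
        also have "\<dots> \<le> real q * \<epsilon>" using q \<epsilon> by (intro mult_right_mono) auto
        finally show ?thesis using q by (simp add: field_simps)
      qed
      finally show ?thesis by simp
    qed
    ultimately have "x \<le> a \<and> a \<le> b \<and> b \<le> x + \<epsilon> / 2 \<and> g b + h b + 1 \<le> g a + h a"
      by linarith
    then show "\<exists>a b. x \<le> a \<and> a \<le> b \<and> b \<le> x + \<epsilon> / 2 \<and> g b + h b + 1 \<le> g a + h a" by blast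
  qed
  moreover have "\<forall>x. 0 \<le> h x" by (simp add: h_def fejer_nonneg)
  ultimately show ?thesis using hs int cob by blast
qed

text \<open>The next \<epsilon> is known only after the waiting time \<open>N k\<close> of the
  current stage, so the objects are built by dependent choice. The factor 2 yields a geometric tail,
  the factor \<open>N k + 1\<close> pays for the accumulation of errors over \<open>N k\<close>
  steps.\<close>

lemma oscillating_sequence:
  assumes \<alpha>: "liouville \<alpha>" and \<eta>: "\<eta> > 0"
  shows "\<exists>h H \<epsilon> N. (\<forall>k. (\<exists>C. small_skew C (h k) (H k)) \<and> (\<forall>x. 0 \<le> h k x) \<and>
      (\<integral>\<^sup>+ x. ennreal (indicator {0..1} x * h k x) \<partial>lborel) \<le> ennreal (\<epsilon> k) \<and>
      (\<forall>z. \<bar>Im z\<bar> < 1 \<longrightarrow> norm (H k (z + complex_of_real \<alpha>) - H k z) \<le> \<epsilon> k) \<and>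
      orbit_dense \<alpha> (\<lambda>x. \<Sum>i\<le>k. h i x) (\<epsilon> k) (N k) \<and> 0 < \<epsilon> k \<and>
      \<epsilon> (Suc k) = \<epsilon> k / (2 * (real (N k) + 1))) \<and> \<epsilon> 0 = \<eta>"
proof -
  define good where "good = (\<lambda>h H \<epsilon> N g. (\<exists>C. small_skew C h H) \<and> (\<exists>C G. small_skew C g G) \<and> (\<forall>x. 0 \<le> h x) \<and>
      (\<integral>\<^sup>+ x. ennreal (indicator {0..1} x * h x) \<partial>lborel) \<le> ennreal \<epsilon> \<and>
      (\<forall>z. \<bar>Im z\<bar> < 1 \<longrightarrow> norm (H (z + complex_of_real \<alpha>) - H z) \<le> \<epsilon>) \<and> orbit_dense \<alpha> g \<epsilon> N \<and> 0 < \<epsilon>)"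
  have step: "\<exists>h H N. good h H \<epsilon> N (\<lambda>x. g x + h x)" if g: "small_skew C g G" and \<epsilon>: "\<epsilon> > 0" for g G C \<epsilon>
  proof -
    obtain h H D N where h: "small_skew D h H" "\<forall>x. 0 \<le> h x"
      "(\<integral>\<^sup>+ x. ennreal (indicator {0..1} x * h x) \<partial>lborel) \<le> ennreal \<epsilon>"
      "\<forall>z. \<bar>Im z\<bar> < 1 \<longrightarrow> norm (H (z + complex_of_real \<alpha>) - H z) \<le> \<epsilon>"
      "orbit_dense \<alpha> (\<lambda>x. g x + h x) \<epsilon> N"
      using oscillating_coboundary[OF \<alpha> g \<epsilon>] by blast
    have "good h H \<epsilon> N (\<lambda>x. g x + h x)"
      unfolding good_def using h \<epsilon> small_skew_add[OF g h(1)] by blast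
    then show ?thesis by blast
  qed
  \<comment> \<open>The state carries the running sum \<open>g\<close>, to which the next step is
    applied. The clause for index 0 pins down the initial \<epsilon> and starts the sum with its
    first term.\<close>
  define P where "P = (\<lambda>n (h, H, \<epsilon>, N, g). good h H \<epsilon> N g \<and> (n = (0::nat) \<longrightarrow> \<epsilon> = \<eta> \<and> g = h))"
  define Q where "Q = (\<lambda>n::nat. \<lambda>(h::real \<Rightarrow> real, H::complex \<Rightarrow> complex, \<epsilon>::real, N::nat, g::real \<Rightarrow> real)
      (h'::real \<Rightarrow> real, H'::complex \<Rightarrow> complex, \<epsilon>'::real, N'::nat, g'::real \<Rightarrow> real).
      \<epsilon>' = \<epsilon> / (2 * (real N + 1)) \<and> g' = (\<lambda>x. g x + h' x))"
  have "\<exists>f. \<forall>n. P n (f n) \<and> Q n (f n) (f (Suc n))"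
  proof (rule dependent_nat_choice)
    have "small_skew 0 (\<lambda>_. 0) (\<lambda>_. 0)" by (rule small_skew_zero) simp
    from step[OF this \<eta>] obtain h H N where "good h H \<eta> N (\<lambda>x. 0 + h x)" by blast
    then have "P 0 (h, H, \<eta>, N, h)" unfolding P_def by simp
    then show "\<exists>x. P 0 x" by blast
  next
    fix s n assume Ps: "P n s"
    obtain h H \<epsilon> N g where s: "s = (h, H, \<epsilon>, N, g)" by (cases s)
    have g: "good h H \<epsilon> N g" using Ps unfolding s P_def by simp
    then obtain C G where C: "small_skew C g G" unfolding good_def by blast
    have "\<epsilon> / (2 * (real N + 1)) > 0" using g unfolding good_def by simp
    from step[OF C this] obtain h' H' N' where
      "good h' H' (\<epsilon> / (2 * (real N + 1))) N' (\<lambda>x. g x + h' x)" by blast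
    then have "P (Suc n) (h', H', \<epsilon> / (2 * (real N + 1)), N', \<lambda>x. g x + h' x) \<and>
        Q n s (h', H', \<epsilon> / (2 * (real N + 1)), N', \<lambda>x. g x + h' x)"
      unfolding s P_def Q_def by simp
    then show "\<exists>y. P (Suc n) y \<and> Q n s y" by blast
  qed
  then obtain f where f: "\<And>n. P n (f n)" "\<And>n. Q n (f n) (f (Suc n))" by blast
  define h H \<epsilon> N g where "h = (\<lambda>n. fst (f n))" and "H = (\<lambda>n. fst (snd (f n)))"
    and "\<epsilon> = (\<lambda>n. fst (snd (snd (f n))))" and "N = (\<lambda>n. fst (snd (snd (snd (f n)))))"
    and "g = (\<lambda>n. snd (snd (snd (snd (f n)))))"
  have feq: "f n = (h n, H n, \<epsilon> n, N n, g n)" for n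
    by (simp add: h_def H_def \<epsilon>_def N_def g_def)
  have good: "good (h n) (H n) (\<epsilon> n) (N n) (g n)" for n using f(1)[of n] unfolding feq P_def by simp
  have 0: "\<epsilon> 0 = \<eta>" "g 0 = h 0" using f(1)[of 0] unfolding feq P_def by simp_all
  have Suc: "\<epsilon> (Suc n) = \<epsilon> n / (2 * (real (N n) + 1))" "g (Suc n) = (\<lambda>x. g n x + h (Suc n) x)" for n
    using f(2)[of n] unfolding feq Q_def by simp_all
  have "g n = (\<lambda>x. \<Sum>i\<le>n. h i x)" for n
    by (induction n) (simp_all add: 0 Suc)
  then have "\<forall>k. (\<exists>C. small_skew C (h k) (H k)) \<and> (\<forall>x. 0 \<le> h k x) \<and>
      (\<integral>\<^sup>+ x. ennreal (indicator {0..1} x * h k x) \<partial>lborel) \<le> ennreal (\<epsilon> k) \<and>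
      (\<forall>z. \<bar>Im z\<bar> < 1 \<longrightarrow> norm (H k (z + complex_of_real \<alpha>) - H k z) \<le> \<epsilon> k) \<and>
      orbit_dense \<alpha> (\<lambda>x. \<Sum>i\<le>k. h i x) (\<epsilon> k) (N k) \<and> 0 < \<epsilon> k \<and>
      \<epsilon> (Suc k) = \<epsilon> k / (2 * (real (N k) + 1))"
    using good Suc(1) unfolding good_def by simp
  then show ?thesis using 0(1) by (intro exI conjI)
qed

subsection \<open>The limit skew product\<close>

locale oscillating_skew =
  fixes \<alpha> :: real and h :: "nat \<Rightarrow> real \<Rightarrow> real" and H :: "nat \<Rightarrow> complex \<Rightarrow> complex"
    and \<epsilon> :: "nat \<Rightarrow> real" and N :: "nat \<Rightarrow> nat"
  assumes skew: "\<exists>C. small_skew C (h k) (H k)"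
    and h_nonneg: "0 \<le> h k x"
    and h_nn_integral: "(\<integral>\<^sup>+ x. ennreal (indicator {0..1} x * h k x) \<partial>lborel) \<le> ennreal (\<epsilon> k)"
    and shift: "\<bar>Im z\<bar> < 1 \<Longrightarrow> norm (H k (z + complex_of_real \<alpha>) - H k z) \<le> \<epsilon> k"
    and dense: "orbit_dense \<alpha> (\<lambda>x. \<Sum>i\<le>k. h i x) (\<epsilon> k) (N k)"
    and eps_pos: "0 < \<epsilon> k"
    and eps_Suc: "\<epsilon> (Suc k) = \<epsilon> k / (2 * (real (N k) + 1))"
begin

definition \<phi> :: "real \<Rightarrow> real" where
  "\<phi> x = (\<Sum>k. h k (x + \<alpha>) - h k x)"

definition \<Phi> :: "complex \<Rightarrow> complex" where
  "\<Phi> z = (\<Sum>k. H k (z + complex_of_real \<alpha>) - H k z)"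

definition g :: "nat \<Rightarrow> real \<Rightarrow> real" where
  "g n x = (\<Sum>i\<le>n. h i x)"

definition G :: "nat \<Rightarrow> complex \<Rightarrow> complex" where
  "G n z = (\<Sum>i\<le>n. H i z)"

lemma H_of_real: "H k (complex_of_real x) = complex_of_real (h k x)"
  using skew[of k] by (auto simp: small_skew_def)

lemma h_periodic: "h k (x + 1) = h k x"
  using skew[of k] by (auto simp: small_skew_def)

lemma h_continuous: "continuous_on UNIV (h k)"
  using skew[of k] small_skew_continuous by blast

lemma eps_decay: "\<epsilon> (k + m) \<le> \<epsilon> m / 2 ^ k"
proof (induction k)
  case (Suc k)
  have "\<epsilon> (Suc (k + m)) \<le> \<epsilon> (k + m) / (2 * 1)"
    unfolding eps_Suc using eps_pos[of "k + m"] by (intro divide_left_mono) auto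
  then show ?case using Suc by simp
qed simp

lemma geometric_tail: "(\<lambda>k. \<epsilon> m / 2 ^ k) sums (2 * \<epsilon> m)"
  using sums_mult[OF geometric_sums[of "1 / 2 :: real"], of "\<epsilon> m"] by (simp add: power_one_over field_simps)

lemma summable_eps: "summable (\<lambda>k. \<epsilon> (k + m))"
  using summable_comparison_test'[OF sums_summable[OF geometric_tail[of m]], of 0 "\<lambda>k. \<epsilon> (k + m)"]
    eps_decay eps_pos by (simp add: less_imp_le)

lemma eps_tail: "(\<Sum>k. \<epsilon> (k + m)) \<le> 2 * \<epsilon> m"
  using suminf_le[OF eps_decay summable_eps sums_summable[OF geometric_tail[of m]]]
    sums_unique[OF geometric_tail[of m]] by simp

lemma summable_shift:
  assumes "\<bar>Im z\<bar> < 1"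
  shows "summable (\<lambda>k. norm (H k (z + complex_of_real \<alpha>) - H k z))"
  by (rule summable_comparison_test'[OF summable_eps[of 0], of 0]) (use shift[OF assms] in simp)

text \<open>The tail beyond \<open>n\<close> is dominated by a geometric series of sum
  \<open>2 * \<epsilon> (Suc n)\<close>, which the recursion for \<epsilon> was designed to turn
  into this bound.\<close>

lemma \<Phi>_approx:
  assumes z: "\<bar>Im z\<bar> < 1"
  shows "norm (\<Phi> z - (G n (z + complex_of_real \<alpha>) - G n z)) \<le> \<epsilon> n / (real (N n) + 1)"
proof -
  let ?f = "\<lambda>k. H k (z + complex_of_real \<alpha>) - H k z"
  note s = summable_shift[OF z]
  have "\<Phi> z = (\<Sum>k. ?f (k + Suc n)) + (\<Sum>k<Suc n. ?f k)"
    unfolding \<Phi>_def by (rule suminf_split_initial_segment[OF summable_norm_cancel[OF s]])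
  then have "\<Phi> z - (G n (z + complex_of_real \<alpha>) - G n z) = (\<Sum>k. ?f (k + Suc n))"
    by (simp only: G_def lessThan_Suc_atMost sum_subtractf add_diff_cancel_right')
  also have "norm \<dots> \<le> (\<Sum>k. \<epsilon> (k + Suc n))"
    by (rule norm_suminf_le) (use shift[OF z] summable_eps[of "Suc n"] in auto)
  also have "\<dots> \<le> 2 * \<epsilon> (Suc n)" by (rule eps_tail)
  also have "\<dots> = \<epsilon> n / (real (N n) + 1)" by (simp add: eps_Suc field_simps)
  finally show ?thesis .
qed

lemma eps_div_le: "\<epsilon> n / (real (N n) + 1) \<le> \<epsilon> n"
  using eps_pos[of n] by (simp add: field_simps)

lemma eps_null: "\<epsilon> \<longlonglongrightarrow> 0"
  using summable_LIMSEQ_zero[OF summable_eps[of 0]] by simp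

lemma \<Phi>_uniform_approx:
  assumes "e > 0"
  shows "\<exists>n. \<forall>z. \<bar>Im z\<bar> < 1 \<longrightarrow> norm (\<Phi> z - (G n (z + complex_of_real \<alpha>) - G n z)) \<le> e"
proof -
  obtain n where "\<epsilon> n < e"
    using order_tendstoD(2)[OF eps_null assms] by (auto simp: eventually_sequentially)
  then show ?thesis using \<Phi>_approx[of _ n] eps_div_le[of n]
    by (intro exI[of _ n]) (meson less_imp_le order_trans)
qed

lemma H_holomorphic: "H k holomorphic_on {z. \<bar>Im z\<bar> < 1}"
  using skew[of k] by (auto simp: small_skew_def)

lemma G_shift_holomorphic: "(\<lambda>z. G n (z + complex_of_real \<alpha>) - G n z) holomorphic_on {z. \<bar>Im z\<bar> < 1}"
proof -
  have "(H k \<circ> (\<lambda>z. z + complex_of_real \<alpha>)) holomorphic_on {z. \<bar>Im z\<bar> < 1}" for k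
    by (rule holomorphic_on_compose_gen[OF _ H_holomorphic]) (auto intro!: holomorphic_intros)
  then show ?thesis unfolding G_def o_def using H_holomorphic by (intro holomorphic_intros)
qed

lemma norm_G_shift_le:
  assumes "\<bar>Im z\<bar> < 1"
  shows "norm (G n (z + complex_of_real \<alpha>) - G n z) \<le> 2 * \<epsilon> 0"
proof -
  have "norm (\<Sum>i\<le>n. H i (z + complex_of_real \<alpha>) - H i z) \<le> (\<Sum>i\<le>n. \<epsilon> i)"
    using shift[OF assms] by (rule sum_norm_le)
  also have "\<dots> \<le> (\<Sum>i. \<epsilon> (i + 0))"
    using sum_le_suminf[OF summable_eps[of 0], of "{..n}"] eps_pos by (simp add: less_imp_le)
  also have "\<dots> \<le> 2 * \<epsilon> 0" by (rule eps_tail)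
  finally show ?thesis by (simp add: G_def sum_subtractf)
qed

lemma small_skew_g: "\<exists>C. small_skew C (g n) (G n)"
proof (induction n)
  case 0
  then show ?case using skew[of 0] by (simp add: g_def[abs_def] G_def[abs_def])
next
  case (Suc n)
  then obtain C D where "small_skew C (g n) (G n)" "small_skew D (h (Suc n)) (H (Suc n))"
    using skew by blast
  from small_skew_add[OF this] show ?case by (auto simp: g_def[abs_def] G_def[abs_def])
qed

lemma G_of_real: "G n (complex_of_real x) = complex_of_real (g n x)"
  by (simp add: G_def g_def H_of_real)

lemma g_periodic: "g n (x + 1) = g n x"
  by (simp add: g_def h_periodic)

text \<open>The constant in \<open>small_skew_g\<close> depends on \<open>n\<close>; for the
  coboundary the bound is uniform, because it is summed term by term from the small differences.
  Thus all approximations stay in the family controlled by one \<delta>.\<close>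

lemma small_skew_coboundary:
  "small_skew (2 * \<epsilon> 0) (\<lambda>x. g n (x + \<alpha>) - g n x) (\<lambda>z. G n (z + complex_of_real \<alpha>) - G n z)"
  unfolding small_skew_def
proof (intro conjI allI impI G_shift_holomorphic norm_G_shift_le)
  fix x
  show "G n (complex_of_real x + complex_of_real \<alpha>) - G n (complex_of_real x) = complex_of_real (g n (x + \<alpha>) - g n x)"
    by (simp add: G_of_real flip: of_real_add)
  have "x + 1 + \<alpha> = x + \<alpha> + 1" by simp
  then show "g n (x + 1 + \<alpha>) - g n (x + 1) = g n (x + \<alpha>) - g n x" by (simp only: g_periodic)
qed

lemma summable_h_shift: "summable (\<lambda>k. h k (x + \<alpha>) - h k x)"
proof -
  have "norm (h k (x + \<alpha>) - h k x) \<le> \<epsilon> (k + 0)" for k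
    using shift[of "complex_of_real x" k] by (simp add: H_of_real norm_of_real flip: of_real_add of_real_diff)
  then show ?thesis by (rule summable_comparison_test'[OF summable_eps[of 0], of 0])
qed

lemma \<Phi>_of_real: "\<Phi> (complex_of_real x) = complex_of_real (\<phi> x)"
  unfolding \<Phi>_def \<phi>_def suminf_of_real[OF summable_h_shift]
  by (simp add: H_of_real flip: of_real_add)

lemma \<phi>_periodic: "\<phi> (x + 1) = \<phi> x"
proof -
  have "x + 1 + \<alpha> = x + \<alpha> + 1" by simp
  then show ?thesis by (simp only: \<phi>_def h_periodic)
qed

lemma small_skew_\<phi>: "small_skew (2 * \<epsilon> 0) \<phi> \<Phi>"
  unfolding small_skew_def
proof (intro conjI allI impI \<Phi>_of_real \<phi>_periodic)
  have o: "open {z. \<bar>Im z\<bar> < 1}" by (intro open_Collect_less continuous_intros)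
  show "\<Phi> holomorphic_on {z. \<bar>Im z\<bar> < 1}"
  proof (rule holomorphic_uniform_sequence[OF o, of "\<lambda>n z. G n (z + complex_of_real \<alpha>) - G n z"])
    show "(\<lambda>z. G n (z + complex_of_real \<alpha>) - G n z) holomorphic_on {z. \<bar>Im z\<bar> < 1}" for n
      by (rule G_shift_holomorphic)
    have ul: "uniform_limit {z. \<bar>Im z\<bar> < 1} (\<lambda>n z. G n (z + complex_of_real \<alpha>) - G n z) \<Phi> sequentially"
    proof (rule uniform_limitI)
      fix e :: real assume "e > 0"
      from order_tendstoD(2)[OF eps_null this]
      show "\<forall>\<^sub>F n in sequentially. \<forall>z\<in>{z. \<bar>Im z\<bar> < 1}. dist (G n (z + complex_of_real \<alpha>) - G n z) (\<Phi> z) < e"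
      proof eventually_elim
        case (elim n)
        show ?case
        proof
          fix z assume "z \<in> {z. \<bar>Im z\<bar> < 1}"
          then have "norm (\<Phi> z - (G n (z + complex_of_real \<alpha>) - G n z)) \<le> \<epsilon> n / (real (N n) + 1)"
            using \<Phi>_approx by blast
          then show "dist (G n (z + complex_of_real \<alpha>) - G n z) (\<Phi> z) < e"
            using elim eps_div_le[of n] unfolding dist_norm norm_minus_commute[of _ "\<Phi> z"] by linarith
        qed
      qed
    qed
    fix z assume "z \<in> {z. \<bar>Im z\<bar> < 1}"
    then obtain d where "d > 0" "cball z d \<subseteq> {z. \<bar>Im z\<bar> < 1}"
      using o open_contains_cball by blast
    then show "\<exists>d. 0 < d \<and> cball z d \<subseteq> {z. \<bar>Im z\<bar> < 1} \<and>
        uniform_limit (cball z d) (\<lambda>n z. G n (z + complex_of_real \<alpha>) - G n z) \<Phi> sequentially"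
      using uniform_limit_on_subset[OF ul] by blast
  qed
  fix z :: complex assume z: "\<bar>Im z\<bar> < 1"
  have "norm (\<Phi> z) \<le> (\<Sum>k. \<epsilon> (k + 0))"
    unfolding \<Phi>_def by (rule norm_suminf_le) (use shift[OF z] summable_eps[of 0] in auto)
  also have "\<dots> \<le> 2 * \<epsilon> 0" by (rule eps_tail)
  finally show "norm (\<Phi> z) \<le> 2 * \<epsilon> 0" .
qed

lemma sk_funpow: "(sk \<alpha> \<phi> ^^ m) (x, y) = (x + real m * \<alpha>, y + (\<Sum>j<m. \<phi> (x + real j * \<alpha>)))"
  by (induction m) (auto simp: sk_def algebra_simps)

lemma \<phi>_approx: "\<bar>\<phi> x - (g n (x + \<alpha>) - g n x)\<bar> \<le> \<epsilon> n / (real (N n) + 1)"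
  using \<Phi>_approx[of "complex_of_real x" n]
  by (simp add: \<Phi>_of_real G_of_real norm_of_real flip: of_real_add of_real_diff)

text \<open>For times up to \<^term>\<open>N n\<close> the orbits of the limit stay \<^term>\<open>\<epsilon> n\<close>-close to those of the
  \<^term>\<open>n\<close>-th approximation, which are already \<^term>\<open>\<epsilon> n\<close>-dense.\<close>

lemma sk_orbit_dense:
  assumes "e > 0"
  shows "\<exists>m. \<exists>k\<in>Z2. dist ((sk \<alpha> \<phi> ^^ m) p + k) q < e"
proof -
  obtain x y where p: "p = (x, y)" by (cases p)
  obtain x1 y1 where q: "q = (x1, y1)" by (cases q)
  have "e / 3 > 0" using assms by simp
  from order_tendstoD(2)[OF eps_null this] obtain n where n: "\<epsilon> n < e / 3"
    unfolding eventually_sequentially by blast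
  obtain m a b where m: "m \<le> N n" "\<bar>x + real m * \<alpha> - of_int a - x1\<bar> < \<epsilon> n"
    "\<bar>y + g n (x + real m * \<alpha>) - g n x - of_int b - y1\<bar> < \<epsilon> n"
    using dense[of n] unfolding orbit_dense_def g_def by blast
  have tele: "(\<Sum>j<m. g n (x + real j * \<alpha> + \<alpha>) - g n (x + real j * \<alpha>)) = g n (x + real m * \<alpha>) - g n x"
    using sum_lessThan_telescope[of "\<lambda>j. g n (x + real j * \<alpha>)" m] by (simp add: algebra_simps)
  have "\<bar>(\<Sum>j<m. \<phi> (x + real j * \<alpha>)) - (g n (x + real m * \<alpha>) - g n x)\<bar> =
      \<bar>\<Sum>j<m. \<phi> (x + real j * \<alpha>) - (g n (x + real j * \<alpha> + \<alpha>) - g n (x + real j * \<alpha>))\<bar>"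
    by (simp only: sum_subtractf flip: tele)
  also have "\<dots> \<le> (\<Sum>j<m. \<epsilon> n / (real (N n) + 1))"
    by (intro order_trans[OF sum_abs] sum_mono \<phi>_approx)
  also have "\<dots> = real m * (\<epsilon> n / (real (N n) + 1))" by simp
  also have "\<dots> \<le> (real (N n) + 1) * (\<epsilon> n / (real (N n) + 1))"
    using m(1) less_imp_le[OF eps_pos[of n]] by (intro mult_right_mono) auto
  also have "\<dots> = \<epsilon> n" by simp
  finally have *: "\<bar>(\<Sum>j<m. \<phi> (x + real j * \<alpha>)) - (g n (x + real m * \<alpha>) - g n x)\<bar> \<le> \<epsilon> n" .
  define k :: "real \<times> real" where "k = (- of_int a, - of_int b)"
  have k: "k \<in> Z2" by (simp add: k_def Z2_def)
  have "dist ((sk \<alpha> \<phi> ^^ m) p + k) q \<le>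
      \<bar>x + real m * \<alpha> - of_int a - x1\<bar> + \<bar>y + (\<Sum>j<m. \<phi> (x + real j * \<alpha>)) - of_int b - y1\<bar>"
    by (simp add: p q k_def sk_funpow dist_Pair_Pair dist_real_def sqrt_sum_squares_le_sum_abs)
  also have "\<dots> < e" using m * n by linarith
  finally show ?thesis using k by blast
qed

section \<open>The measurable transfer function and an invariant set\<close>

definition X0 :: "real set" where
  "X0 = {x. (\<Sum>k. ennreal (h k x)) \<noteq> top}"

text \<open>With \<open>u x = (\<Sum>k. h k x)\<close>, finite on \<open>X0\<close>, this is the
  half of each vertical circle that lies directly above the graph of \<open>u\<close>. Since
  \<open>\<phi>\<close> is the difference of \<open>u\<close> at \<open>x + \<alpha>\<close> and at
  \<open>x\<close>, the quantity \<open>y - u x\<close> modulo 1 is preserved over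
  \<open>X0\<close>.\<close>

definition invariant_set :: "(real \<times> real) set" where
  "invariant_set = {p. fst p \<in> X0 \<and> frac (snd p - (\<Sum>k. h k (fst p))) < 1 / 2}"

lemma X0_iff: "x \<in> X0 \<longleftrightarrow> summable (\<lambda>k. h k x)"
  unfolding X0_def mem_Collect_eq
  by (rule iffI[OF summable_suminf_not_top[OF h_nonneg] ennreal_suminf_neq_top[OF _ h_nonneg]])

lemma h_measurable [measurable]: "h k \<in> borel_measurable borel"
  using h_continuous by (rule borel_measurable_continuous_onI)

lemma X0_measurable [measurable]: "X0 \<in> sets borel"
proof -
  have "{x \<in> space borel. (\<Sum>k. ennreal (h k x)) \<noteq> top} \<in> sets borel" by measurable
  then show ?thesis by (simp add: X0_def)
qed

lemma invariant_set_measurable: "invariant_set \<in> sets borel"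
proof -
  have "{p \<in> space (borel \<Otimes>\<^sub>M borel). fst p \<in> X0 \<and>
      snd p - (\<Sum>k. h k (fst p)) - of_int \<lfloor>snd p - (\<Sum>k. h k (fst p))\<rfloor> < 1 / 2} \<in> sets (borel \<Otimes>\<^sub>M borel)"
    by measurable
  then show ?thesis unfolding borel_prod by (simp add: invariant_set_def frac_def)
qed

lemma X0_add_Ints: "k \<in> \<int> \<Longrightarrow> x + k \<in> X0 \<longleftrightarrow> x \<in> X0"
  using periodic_Ints[of "h _" k x, OF h_periodic] by (simp add: X0_def)

lemma frac_add_Ints: "k \<in> \<int> \<Longrightarrow> frac (x + k) = frac (x :: real)"
  by (auto simp: frac_def elim: Ints_cases)

lemma invariant_set_periodic: "k \<in> Z2 \<Longrightarrow> p + k \<in> invariant_set \<longleftrightarrow> p \<in> invariant_set"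
proof -
  assume k: "k \<in> Z2"
  then have "h i (fst p + fst k) = h i (fst p)" for i
    using periodic_Ints[of "h i", OF h_periodic] by (simp add: Z2_def)
  moreover have "frac (snd p + snd k - (\<Sum>i. h i (fst p))) = frac (snd p - (\<Sum>i. h i (fst p)))"
    using frac_add_Ints[of "snd k" "snd p - (\<Sum>i. h i (fst p))"] k by (simp add: Z2_def algebra_simps)
  ultimately show ?thesis using k X0_add_Ints by (simp add: invariant_set_def Z2_def)
qed

text \<open>The series of differences converges at every point, so the two series converge or
  diverge together.\<close>

lemma X0_rotation: "x + \<alpha> \<in> X0 \<longleftrightarrow> x \<in> X0"
proof -
  have "summable (\<lambda>k. h k (x + \<alpha>)) \<longleftrightarrow> summable (\<lambda>k. h k x)"
    using summable_add[OF summable_h_shift[of x], of "\<lambda>k. h k x"]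
      summable_diff[OF _ summable_h_shift[of x], of "\<lambda>k. h k (x + \<alpha>)"] by auto
  then show ?thesis by (simp add: X0_iff)
qed

lemma invariant_set_sk: "sk \<alpha> \<phi> p \<in> invariant_set \<longleftrightarrow> p \<in> invariant_set"
proof (cases "fst p \<in> X0")
  case True
  then have "\<phi> (fst p) = (\<Sum>k. h k (fst p + \<alpha>)) - (\<Sum>k. h k (fst p))"
    unfolding \<phi>_def using X0_rotation X0_iff by (intro suminf_diff[symmetric]) auto
  then show ?thesis using True X0_rotation by (simp add: invariant_set_def sk_def)
next
  case False
  then show ?thesis using X0_rotation by (simp add: invariant_set_def sk_def)
qed

text \<open>The integral of the non-negative series over one period is at most the sum of the
  \<epsilon>, hence finite, so the series is finite almost everywhere on
  \<open>{0..1}\<close>.\<close>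

lemma emeasure_X0: "emeasure lborel X0 \<noteq> 0"
proof
  assume 0: "emeasure lborel X0 = 0"
  have "(\<integral>\<^sup>+ x. (\<Sum>k. ennreal (indicator {0..1} x * h k x)) \<partial>lborel) =
      (\<Sum>k. \<integral>\<^sup>+ x. ennreal (indicator {0..1} x * h k x) \<partial>lborel)"
    by (rule nn_integral_suminf) measurable
  also have "\<dots> \<le> (\<Sum>k. ennreal (\<epsilon> k))"
    by (intro suminf_le h_nn_integral summableI)
  finally have "(\<integral>\<^sup>+ x. (\<Sum>k. ennreal (indicator {0..1} x * h k x)) \<partial>lborel) \<le> (\<Sum>k. ennreal (\<epsilon> k))" .
  moreover have "(\<Sum>k. ennreal (\<epsilon> k)) \<noteq> top"
    using summable_eps[of 0] eps_pos by (intro ennreal_suminf_neq_top) (auto simp: less_imp_le)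
  ultimately have fin: "(\<integral>\<^sup>+ x. (\<Sum>k. ennreal (indicator {0..1} x * h k x)) \<partial>lborel) \<noteq> \<infinity>"
    using neq_top_trans by auto
  have "AE x in lborel. (\<Sum>k. ennreal (indicator {0..1} x * h k x)) \<noteq> \<infinity>"
    by (rule nn_integral_PInf_AE[OF _ fin]) measurable
  moreover have "AE x in lborel. x \<notin> X0"
    using 0 by (intro AE_not_in) (auto simp: null_sets_def)
  ultimately have "AE x in lborel. x \<notin> {0..1::real}"
  proof eventually_elim
    case (elim x)
    then show ?case by (auto simp: X0_def)
  qed
  then have "emeasure lborel {0..1::real} = 0"
    by (subst (asm) AE_iff_measurable[where N = "{0..1}"]) auto
  then show False by simp
qed

lemma frac_half_shift: "frac (t + 1 / 2) < 1 / 2 \<longleftrightarrow> \<not> frac t < (1 / 2 :: real)"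
proof -
  have "frac (1 / 2 :: real) = 1 / 2" by (simp add: frac_eq)
  then show ?thesis using frac_lt_1[of t] frac_ge_0[of t] by (auto simp: frac_add leD[OF frac_ge_0])
qed

lemma invariant_set_half_shift:
  "p + (0, 1 / 2) \<in> invariant_set \<longleftrightarrow> fst p \<in> X0 \<and> p \<notin> invariant_set"
  using frac_half_shift[of "snd p - (\<Sum>k. h k (fst p))"] by (auto simp: invariant_set_def algebra_simps)

text \<open>Over \<open>X0\<close> the vertical shift by 1/2 exchanges the set with its complement,
  so the set and one translate of it cover \<open>X0 \<times> UNIV\<close>.\<close>

lemma emeasure_invariant_set: "emeasure lborel invariant_set \<noteq> 0"
proof
  let ?B = "(\<lambda>p. p + (0, 1 / 2)) -` invariant_set"
  assume 0: "emeasure lborel invariant_set = 0"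
  have m: "?B \<in> sets borel"
    by (rule measurable_sets_borel[OF borel_measurable_continuous_onI invariant_set_measurable])
      (intro continuous_intros)
  have "emeasure lborel ?B = 0"
    using 0 by (simp add: emeasure_lborel_vimage_add[OF invariant_set_measurable])
  then have "emeasure lborel (invariant_set \<union> ?B) = 0"
    using 0 m invariant_set_measurable emeasure_subadditive[of invariant_set lborel ?B] by simp
  moreover have "X0 \<times> UNIV \<subseteq> invariant_set \<union> ?B"
    using invariant_set_half_shift by auto
  ultimately have "emeasure lborel (X0 \<times> (UNIV :: real set)) = 0"
    using m invariant_set_measurable emeasure_mono[of "X0 \<times> UNIV" "invariant_set \<union> ?B" lborel] by simp
  moreover have "emeasure lborel (X0 \<times> (UNIV :: real set)) = emeasure lborel X0 * emeasure lborel (UNIV :: real set)"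
    using lborel.emeasure_pair_measure_Times[of X0 lborel "UNIV :: real set"] by (simp add: lborel_prod)
  ultimately show False using emeasure_X0 by simp
qed

text \<open>The half shift carries the invariant set into the complement, which is therefore at
  least as large.\<close>

lemma emeasure_Compl_invariant_set: "emeasure lborel (- invariant_set) \<noteq> 0"
proof
  assume 0: "emeasure lborel (- invariant_set) = 0"
  have m: "- invariant_set \<in> sets borel" using invariant_set_measurable by (rule borel_comp)
  have m': "(\<lambda>p. p + (0, 1 / 2)) -` (- invariant_set) \<in> sets borel"
    by (rule measurable_sets_borel[OF borel_measurable_continuous_onI m]) (intro continuous_intros)
  have "invariant_set \<subseteq> (\<lambda>p. p + (0, 1 / 2)) -` (- invariant_set)"
    using invariant_set_half_shift by auto
  then have "emeasure lborel invariant_set \<le> emeasure lborel ((\<lambda>p. p + (0, 1 / 2)) -` (- invariant_set))"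
    using m' by (intro emeasure_mono) auto
  also have "\<dots> = 0" using 0 by (simp only: emeasure_lborel_vimage_add[OF m])
  finally show False using emeasure_invariant_set by simp
qed

end

subsection \<open>Transfer through an area-preserving conjugacy\<close>

text \<open>Orbits of the conjugate are the \<open>S\<close>-images of orbits of \<open>G\<close> up
  to lattice vectors, which accumulate from \<open>k\<close> and are absorbed by the saturation
  under \<open>Z2\<close>. A continuous surjection maps dense sets to dense sets.\<close>

lemma minimal_T2_conjugate:
  assumes T: "torus_an_map T" and S: "torus_an_map S" and ST: "S \<circ> T = id" and TS: "T \<circ> S = id"
    and k: "k \<in> Z2" and G: "\<And>q m. m \<in> Z2 \<Longrightarrow> G (q + m) = G q + m"
    and dense: "\<And>p q e. e > 0 \<Longrightarrow> \<exists>n. \<exists>m\<in>Z2. dist ((G ^^ n) p + m) q < e"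
  shows "minimal_T2 (\<lambda>p. S (G (T p)) + k)"
  unfolding minimal_T2_def
proof
  fix p
  define F where "F = (\<lambda>p. S (G (T p)) + k)"
  have STp: "S (T p) = p" "T (S p) = p" for p
    using fun_cong[OF ST, of p] fun_cong[OF TS, of p] by auto
  have orb: "\<exists>l\<in>Z2. (F ^^ n) p = S ((G ^^ n) (T p)) + l" for n
  proof (induction n)
    case 0
    then show ?case by (auto simp: STp Z2_def intro!: bexI[of _ 0])
  next
    case (Suc n)
    then obtain l where l: "l \<in> Z2" "(F ^^ n) p = S ((G ^^ n) (T p)) + l" by blast
    obtain m where m: "m \<in> Z2" "\<And>q. T (q + l) = T q + m" using torus_an_map_shift[OF T l(1)] by blast
    obtain j where j: "j \<in> Z2" "\<And>q. S (q + m) = S q + j" using torus_an_map_shift[OF S m(1)] by blast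
    have "(F ^^ Suc n) p = S ((G ^^ Suc n) (T p)) + (j + k)"
      by (simp add: F_def[abs_def] l(2)[unfolded F_def] m(2) STp G[OF m(1)] j(2) add.assoc)
    then show ?case using Z2_add[OF j(1) k] by blast
  qed
  define O' where "O' = {(G ^^ n) (T p) + m | n m. m \<in> Z2}"
  have "q \<in> closure O'" for q
    unfolding closure_approachable O'_def using dense[of _ "T p" q] by blast
  then have "closure O' = UNIV" by blast
  moreover have "continuous_on (closure O') S"
    using torus_an_map_continuous[OF S] by (rule continuous_on_subset) simp
  moreover have "S ` O' \<subseteq> closure {(F ^^ n) p + l | n l. l \<in> Z2}"
  proof (rule order_trans[OF _ closure_subset], rule image_subsetI)
    fix q assume "q \<in> O'"
    then obtain n m where m: "m \<in> Z2" "q = (G ^^ n) (T p) + m" unfolding O'_def by blast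
    obtain j where j: "j \<in> Z2" "\<And>q. S (q + m) = S q + j" using torus_an_map_shift[OF S m(1)] by blast
    obtain l where l: "l \<in> Z2" "(F ^^ n) p = S ((G ^^ n) (T p)) + l" using orb by blast
    have "S q = (F ^^ n) p + (j + - l)" by (simp add: m(2) j(2) l(2))
    then show "S q \<in> {(F ^^ n) p + l | n l. l \<in> Z2}" using Z2_add[OF j(1) Z2_minus[OF l(1)]] by blast
  qed
  ultimately have "S ` UNIV \<subseteq> closure {(F ^^ n) p + l | n l. l \<in> Z2}"
    using image_closure_subset[of O' S] by simp
  moreover have "S ` UNIV = UNIV" using STp by (metis surjI)
  ultimately show "closure {((\<lambda>p. S (G (T p)) + k) ^^ n) p + l | n l. l \<in> Z2} = UNIV"
    unfolding F_def by auto
qed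

text \<open>Countably many integer translates of the part in the unit square cover \<open>C\<close>.
  Read contrapositively, it turns positive measure in the plane into positive measure in the
  square.\<close>

lemma periodic_null_set:
  fixes C :: "(real \<times> real) set"
  assumes C: "C \<in> sets borel" and per: "\<And>p k. k \<in> Z2 \<Longrightarrow> p + k \<in> C \<longleftrightarrow> p \<in> C"
    and 0: "emeasure lborel (C \<inter> ({0..<1} \<times> {0..<1})) = 0"
  shows "emeasure lborel C = 0"
proof -
  define Q where "Q = C \<inter> ({0..<1} \<times> {0..<1::real})"
  have "{0..<1} \<times> {0..<1::real} \<in> sets (borel \<Otimes>\<^sub>M borel :: (real \<times> real) measure)"
    by (intro pair_measureI) auto
  then have "{0..<1} \<times> {0..<1::real} \<in> sets (borel :: (real \<times> real) measure)" by (simp only: borel_prod)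
  then have Q: "Q \<in> sets borel" unfolding Q_def by (intro sets.Int C)
  define V where "V = (\<lambda>ij::int \<times> int. (\<lambda>p. p + (- of_int (fst ij), - of_int (snd ij))) -` Q)"
  have Vm: "V ij \<in> sets borel" for ij
    unfolding V_def by (rule measurable_sets_borel[OF borel_measurable_continuous_onI Q]) (intro continuous_intros)
  have "V ij \<in> null_sets lborel" for ij
    using 0 Vm[of ij] emeasure_lborel_vimage_add[OF Q] by (simp add: null_sets_def V_def Q_def)
  then have "(\<Union>ij. V ij) \<in> null_sets lborel" by (intro null_sets_UN) auto
  moreover have "C \<subseteq> (\<Union>ij. V ij)"
  proof
    fix p assume p: "p \<in> C"
    have "p + (- of_int \<lfloor>fst p\<rfloor>, - of_int \<lfloor>snd p\<rfloor>) \<in> C"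
      using p per by (simp add: Z2_def)
    moreover have "p + (- of_int \<lfloor>fst p\<rfloor>, - of_int \<lfloor>snd p\<rfloor>) \<in> {0..<1} \<times> {0..<1}"
      by (cases p) (auto, linarith+)
    ultimately have "p \<in> V (\<lfloor>fst p\<rfloor>, \<lfloor>snd p\<rfloor>)" by (simp add: V_def Q_def)
    then show "p \<in> (\<Union>ij. V ij)" by blast
  qed
  ultimately show ?thesis using C null_sets_subset[of "\<Union>ij. V ij" lborel C] by (auto simp: null_sets_def)
qed

lemma not_ergodic_T2_conjugate:
  assumes T: "torus_an_map T" "T \<in> borel_measurable borel" "distr lborel lborel T = lborel"
    and TS: "T \<circ> S = id" and k: "k \<in> Z2"
    and B: "B \<in> sets borel" "\<And>p k. k \<in> Z2 \<Longrightarrow> p + k \<in> B \<longleftrightarrow> p \<in> B" "\<And>p. G p \<in> B \<longleftrightarrow> p \<in> B"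
    and pos: "emeasure lborel B \<noteq> 0" "emeasure lborel (- B) \<noteq> 0"
  shows "\<not> ergodic_T2 (\<lambda>p. S (G (T p)) + k)"
proof
  assume erg: "ergodic_T2 (\<lambda>p. S (G (T p)) + k)"
  define Q :: "(real \<times> real) set" where "Q = {0..<1} \<times> {0..<1}"
  have "Q \<in> sets (borel \<Otimes>\<^sub>M borel)" unfolding Q_def by (intro pair_measureI) auto
  then have Qm: "Q \<in> sets borel" by (simp only: borel_prod)
  have Q1: "emeasure lborel Q = 1"
    using lborel.emeasure_pair_measure_Times[of "{0..<1::real}" lborel "{0..<1::real}"]
    by (simp add: Q_def lborel_prod)
  have Tper: "T (p + l) \<in> B \<longleftrightarrow> T p \<in> B" if l: "l \<in> Z2" for p l
    using torus_an_map_shift[OF T(1) l] B(2) by metis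
  have TSp: "T (S p) = p" for p using fun_cong[OF TS, of p] by simp
  have em: "emeasure lborel (T -` A) = emeasure lborel A" if "A \<in> sets borel" for A
    using that T(2) by (subst (2) T(3)[symmetric]) (simp add: emeasure_distr)
  have Bm: "T -` B \<in> sets borel" "T -` (- B) \<in> sets borel"
    using measurable_sets_borel[OF T(2)] B(1) by (auto simp del: vimage_Compl)
  have p0: "emeasure lborel (T -` B \<inter> Q) \<noteq> 0"
    using periodic_null_set[OF Bm(1)] Tper pos(1) em[OF B(1)] unfolding Q_def by auto
  have p1: "emeasure lborel (T -` (- B) \<inter> Q) \<noteq> 0"
    using periodic_null_set[OF Bm(2)] Tper pos(2) em[OF borel_comp[OF B(1)]] unfolding Q_def by auto
  have leb: "measure lebesgue A = measure lborel A" if "A \<in> sets borel" for A :: "(real \<times> real) set"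
    using that by simp
  have fin: "emeasure lborel (A \<inter> Q) \<noteq> \<infinity>" if "A \<in> sets borel" for A
    using emeasure_mono[of "A \<inter> Q" Q lborel] Qm Q1 by (auto simp: top_unique)
  have "T -` B \<in> sets lebesgue" using Bm by simp
  moreover have "\<forall>p l. l \<in> Z2 \<longrightarrow> (p + l \<in> T -` B \<longleftrightarrow> p \<in> T -` B)" using Tper by simp
  \<comment> \<open>Periodicity removes the translation by \<open>k\<close>, then \<open>T\<close>
    cancels \<open>S\<close>, and the invariance of \<open>B\<close> under \<open>G\<close>
    remains.\<close>
  moreover have "(\<lambda>p. S (G (T p)) + k) -` (T -` B) = T -` B"
    unfolding vimage_def by (simp add: Tper[OF k] TSp B(3))
  ultimately consider "measure lebesgue (T -` B \<inter> Q) = 0" | "measure lebesgue (T -` B \<inter> Q) = 1"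
    using erg unfolding ergodic_T2_def Q_def by blast
  then show False
  proof cases
    case 1
    then have "measure lborel (T -` B \<inter> Q) = 0" using leb[of "T -` B \<inter> Q"] Bm Qm by simp
    then show False using p0 fin[OF Bm(1)] by (simp add: measure_def enn2real_eq_0_iff)
  next
    case 2
    then have m1: "measure lborel (T -` B \<inter> Q) = 1" using leb[of "T -` B \<inter> Q"] Bm Qm by simp
    have "measure lborel Q = measure lborel (T -` B \<inter> Q) + measure lborel (T -` (- B) \<inter> Q)"
    proof -
      have "Q = (T -` B \<inter> Q) \<union> (T -` (- B) \<inter> Q)" by auto
      then have "measure lborel Q = measure lborel ((T -` B \<inter> Q) \<union> (T -` (- B) \<inter> Q))" by simp
      also have "\<dots> = measure lborel (T -` B \<inter> Q) + measure lborel (T -` (- B) \<inter> Q)"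
        using fin[OF Bm(1)] fin[OF Bm(2)] Bm Qm by (intro measure_Union) auto
      finally show ?thesis .
    qed
    moreover have "measure lborel Q = 1" using Q1 by (simp add: measure_def)
    ultimately have "measure lborel (T -` (- B) \<inter> Q) = 0" using m1 by simp
    then show False using p1 fin[OF Bm(2)] by (simp add: measure_def enn2real_eq_0_iff)
  qed
qed

section \<open>Approximation in the inductive limit topology\<close>

lemma topspace_tau: "topspace tau = Diff_all"
proof -
  have "openin tau Diff_all" unfolding openin_tau tau_open_def Diff_r_def by (auto intro: zero_less_one)
  moreover have "openin tau U \<Longrightarrow> U \<subseteq> Diff_all" for U unfolding openin_tau tau_open_def by blast
  ultimately show ?thesis unfolding topspace_def by blast
qed

text \<open>An open set of \<open>tau\<close> meets each \<open>Diff_r r\<close> in a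
  \<open>dist_r\<close>-open set, so approximation in one fixed strip implies approximation in
  \<open>tau\<close>.\<close>

lemma in_tau_closureI:
  assumes "r > 0" "F \<in> Diff_r r" "\<And>e. e > 0 \<Longrightarrow> \<exists>G\<in>A \<inter> Diff_r r. dist_r r F G < e"
  shows "F \<in> tau closure_of A"
  unfolding in_closure_of
proof (intro conjI allI impI)
  show "F \<in> topspace tau" using assms(2) by (simp add: topspace_tau Diff_r_def)
  fix U assume "F \<in> U \<and> openin tau U"
  then obtain e where e: "e > 0" "\<And>G. G \<in> Diff_r r \<Longrightarrow> dist_r r F G < e \<Longrightarrow> G \<in> U"
    using assms(1,2) unfolding openin_tau tau_open_def by blast
  then show "\<exists>G. G \<in> A \<and> G \<in> U" using assms(3)[OF e(1)] by blast
qed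

text \<open>Two approximations share the strip \<rho>: the limit \<open>D \<phi>\<close> is close to
  \<open>F\<close>, and \<open>D\<close> of the coboundary of \<open>g n\<close>, an element of
  \<open>A_set \<alpha>\<close>, is close to \<open>D \<phi>\<close>. The second one puts the limit
  into the closure.\<close>

lemma A_set_in_closure_minimal_not_ergodic:
  assumes \<alpha>: "liouville \<alpha>" and F: "F \<in> A_set \<alpha>"
  shows "F \<in> tau closure_of {F \<in> tau closure_of A_set \<alpha>. minimal_T2 F \<and> \<not> ergodic_T2 F}"
proof -
  obtain T S k where T: "torus_an_map T" "T \<in> borel_measurable borel" "distr lborel lborel T = lborel"
    and S: "torus_an_map S" and ST: "S \<circ> T = id" and TS: "T \<circ> S = id" and k: "k \<in> Z2"
    and F_eq: "F = (\<lambda>p. S (Rot \<alpha> (T p)) + k)"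
    using A_set_conjugacy[OF F] by metis
  have FD: "F \<in> Diff_all" using F by (simp add: A_set_def)
  define D where "D = (\<lambda>\<phi> p. S (sk \<alpha> \<phi> (T p)) + k)"
  obtain \<rho> \<delta> L where \<rho>: "\<rho> > 0" "\<delta> > 0" "L \<ge> 0"
    and Dr: "\<And>\<phi> \<Phi>. small_skew \<delta> \<phi> \<Phi> \<Longrightarrow> D \<phi> \<in> Diff_r \<rho>"
    and Dd: "\<And>\<phi>1 \<phi>2 \<Phi>1 \<Phi>2 \<eta>. small_skew \<delta> \<phi>1 \<Phi>1 \<Longrightarrow> small_skew \<delta> \<phi>2 \<Phi>2 \<Longrightarrow>
      (\<forall>z. \<bar>Im z\<bar> < 1 \<longrightarrow> norm (\<Phi>1 z - \<Phi>2 z) \<le> \<eta>) \<Longrightarrow> dist_r \<rho> (D \<phi>1) (D \<phi>2) \<le> L * \<eta>"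
    using skew_family_Diff_r[OF FD F_eq T(1) S ST TS] unfolding D_def by blast
  have F0: "F = D (\<lambda>_. 0)" by (simp add: F_eq D_def Rot_eq_sk)
  have s0: "small_skew \<delta> (\<lambda>_. 0) (\<lambda>_. 0)" using \<rho> by (intro small_skew_zero) simp
  show ?thesis
  proof (rule in_tau_closureI[OF \<rho>(1)])
    show "F \<in> Diff_r \<rho>" unfolding F0 by (rule Dr[OF s0])
    fix e :: real assume e: "e > 0"
    \<comment> \<open>The bound on \<open>\<Phi>\<close> is
      \<open>2 * \<epsilon> 0 = 2 * \<eta>\<close>, which explains the division by 2. The
      denominator \<open>L + 1\<close> covers \<open>L = 0\<close> and makes the final estimate
      strict.\<close>
    define \<eta> where "\<eta> = min \<delta> (e / (L + 1)) / 2"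
    have \<eta>: "\<eta> > 0" "2 * \<eta> \<le> \<delta>" "2 * \<eta> \<le> e / (L + 1)" using \<rho> e by (auto simp: \<eta>_def)
    have small: "L * x < d" if "0 < d" "x \<le> d / (L + 1)" for x d :: real
    proof -
      have "L * x \<le> L * (d / (L + 1))" using that \<rho> by (intro mult_left_mono) auto
      also have "\<dots> < d" using that \<rho> by (simp add: field_simps)
      finally show ?thesis .
    qed
    obtain h H \<epsilon> N where seq: "\<forall>k. (\<exists>C. small_skew C (h k) (H k)) \<and> (\<forall>x. 0 \<le> h k x) \<and>
      (\<integral>\<^sup>+ x. ennreal (indicator {0..1} x * h k x) \<partial>lborel) \<le> ennreal (\<epsilon> k) \<and>
      (\<forall>z. \<bar>Im z\<bar> < 1 \<longrightarrow> norm (H k (z + complex_of_real \<alpha>) - H k z) \<le> \<epsilon> k) \<and>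
      orbit_dense \<alpha> (\<lambda>x. \<Sum>i\<le>k. h i x) (\<epsilon> k) (N k) \<and> 0 < \<epsilon> k \<and>
      \<epsilon> (Suc k) = \<epsilon> k / (2 * (real (N k) + 1))" and \<epsilon>0: "\<epsilon> 0 = \<eta>"
      using oscillating_sequence[OF \<alpha> \<eta>(1)] by blast
    interpret oscillating_skew \<alpha> h H \<epsilon> N
      by unfold_locales (use seq in blast)+
    have s: "small_skew \<delta> \<phi> \<Phi>"
      using small_skew_mono[OF small_skew_\<phi>] \<eta>(2) by (simp add: \<epsilon>0)
    have sn: "small_skew \<delta> (\<lambda>x. g n (x + \<alpha>) - g n x) (\<lambda>z. G n (z + complex_of_real \<alpha>) - G n z)" for n
      using small_skew_mono[OF small_skew_coboundary] \<eta>(2) by (simp add: \<epsilon>0)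
    have "D \<phi> \<in> tau closure_of A_set \<alpha>"
    proof (rule in_tau_closureI[OF \<rho>(1) Dr[OF s]])
      fix d :: real assume d: "d > 0"
      then have "d / (L + 1) > 0" using \<rho> by simp
      then obtain n where "\<forall>z. \<bar>Im z\<bar> < 1 \<longrightarrow> norm (\<Phi> z - (G n (z + complex_of_real \<alpha>) - G n z)) \<le> d / (L + 1)"
        using \<Phi>_uniform_approx by blast
      from Dd[OF s sn this] have "dist_r \<rho> (D \<phi>) (D (\<lambda>x. g n (x + \<alpha>) - g n x)) < d"
        using small[OF d order_refl] by linarith
      moreover have Dn: "D (\<lambda>x. g n (x + \<alpha>) - g n x) \<in> Diff_r \<rho>" by (rule Dr[OF sn])
      moreover obtain C where C: "small_skew C (g n) (G n)" using small_skew_g by blast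
      moreover have "D (\<lambda>x. g n (x + \<alpha>) - g n x) \<in> A_set \<alpha>"
        unfolding D_def
        by (rule coboundary_skew_in_A_set[OF T S ST TS k C]) (use Dn in \<open>simp add: D_def Diff_r_def\<close>)
      ultimately show "\<exists>G\<in>A_set \<alpha> \<inter> Diff_r \<rho>. dist_r \<rho> (D \<phi>) G < d" by blast
    qed
    moreover have "minimal_T2 (D \<phi>)"
      unfolding D_def
      by (rule minimal_T2_conjugate[OF T(1) S ST TS k]) (use sk_shift[of \<phi>, OF \<phi>_periodic] sk_orbit_dense in auto)
    moreover have "\<not> ergodic_T2 (D \<phi>)"
      unfolding D_def
      by (rule not_ergodic_T2_conjugate[OF T TS k invariant_set_measurable invariant_set_periodic
          invariant_set_sk emeasure_invariant_set emeasure_Compl_invariant_set])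
    moreover have "dist_r \<rho> F (D \<phi>) < e"
    proof -
      have "\<forall>z. \<bar>Im z\<bar> < 1 \<longrightarrow> norm (0 - \<Phi> z) \<le> 2 * \<eta>"
        using small_skew_\<phi> by (simp add: small_skew_def \<epsilon>0)
      from Dd[OF s0 s this] show ?thesis using small[OF e \<eta>(3)] unfolding F0 by linarith
    qed
    ultimately show "\<exists>G\<in>{F \<in> tau closure_of A_set \<alpha>. minimal_T2 F \<and> \<not> ergodic_T2 F} \<inter> Diff_r \<rho>. dist_r \<rho> F G < e"
      using Dr[OF s] by blast
  qed
qed

subsection \<open>Liouville numbers are generic\<close>

text \<open>The two existential quantifiers of \<open>liouville\<close> become unions of open sets;
  the remaining one over \<open>n\<close> becomes the countable intersection that yields a G-delta
  set.\<close>

definition liouville_approx :: "nat \<Rightarrow> real set" where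
  "liouville_approx n = (\<Union>q\<in>{n..}. \<Union>p::int. {\<alpha>. 0 < \<bar>real q * \<alpha> - of_int p\<bar> \<and>
    \<bar>real q * \<alpha> - of_int p\<bar> < exp (- (real n * real q))})"

lemma liouville_iff: "liouville \<alpha> \<longleftrightarrow> (\<forall>n. \<alpha> \<in> liouville_approx n)"
  unfolding liouville_def liouville_approx_def by (simp add: Bex_def)

lemma open_liouville_approx: "open (liouville_approx n)"
  unfolding liouville_approx_def
  by (intro open_UN ballI open_Collect_conj open_Collect_less continuous_intros)

lemma liouville_approx_dense:
  fixes x e :: real
  assumes "x \<in> {0..1}" "e > 0"
  shows "\<exists>\<alpha>\<in>{0..1} \<inter> liouville_approx n. dist \<alpha> x < e"
proof -
  obtain m :: nat where m: "2 / e < real m" using reals_Archimedean2 by blast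
  define q where "q = m + n + 1"
  have q: "q \<ge> n" "q > 0" by (simp_all add: q_def)
  have q2: "2 / real q < e"
  proof -
    have "2 < e * real m" using m assms(2) by (simp add: field_simps)
    also have "\<dots> \<le> e * real q" using assms(2) by (intro mult_left_mono) (auto simp: q_def)
    finally show ?thesis using q by (simp add: field_simps)
  qed
  text \<open>Near \<open>x\<close> choose \<open>i / q\<close> with \<open>i < q\<close> and move slightly to the right, which stays inside \<open>[0, 1]\<close>.\<close>
  define i where "i = min \<lfloor>real q * x\<rfloor> (int q - 1)"
  \<comment> \<open>Half of the allowed error satisfies both strict inequalities, and
    \<open>q * \<alpha> - i\<close> will be exactly \<open>t\<close>, so the numerator of the
    approximation is \<open>i\<close>.\<close>
  define t where "t = exp (- (real n * real q)) / 2"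
  have t: "0 < t" "t < 1" "t < exp (- (real n * real q))"
    using exp_le_one_iff[of "- (real n * real q)"] unfolding t_def by (auto simp del: exp_le_one_iff)
  define \<alpha> where "\<alpha> = (of_int i + t) / real q"
  have qx: "0 \<le> real q * x" "real q * x \<le> real q" using assms(1) q by (auto simp: mult_left_le)
  have i0: "0 \<le> i" "i \<le> int q - 1" using qx q by (auto simp: i_def)
  have "\<bar>of_int i + t - real q * x\<bar> \<le> 1"
  proof -
    have "of_int i \<le> real q * x" unfolding i_def by linarith
    moreover have "real q * x \<le> of_int i + 1"
      using qx(2) unfolding i_def by (auto simp: min_def)
    ultimately show ?thesis using t by linarith
  qed
  then have "\<bar>\<alpha> - x\<bar> \<le> 1 / real q"
    using q by (simp add: \<alpha>_def field_simps abs_le_iff)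
  also have "\<dots> < e" using q2 q by (simp add: field_simps)
  finally have "dist \<alpha> x < e" by (simp add: dist_real_def)
  moreover have "real_of_int i \<le> real q - 1" using i0(2) by linarith
  then have "\<alpha> \<in> {0..1}" using i0 t q by (auto simp: \<alpha>_def field_simps)
  moreover have "real q * \<alpha> - of_int i = t" using q by (simp add: \<alpha>_def)
  then have "\<alpha> \<in> liouville_approx n"
    unfolding liouville_approx_def using t q by (auto intro!: bexI[of _ q] exI[of _ i])
  ultimately show ?thesis by blast
qed

theorem theoremB:
  shows "\<exists>E. E \<subseteq> {0..1} \<and> gdelta_in (top_of_set {0..1}) E \<and> {0..1} \<subseteq> closure E \<and>
    (\<forall>\<alpha>\<in>E. \<exists>D. D \<subseteq> tau closure_of A_set \<alpha> \<and>
        subtopology tau (tau closure_of A_set \<alpha>) closure_of D = tau closure_of A_set \<alpha> \<and>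
        (\<forall>F\<in>D. minimal_T2 F \<and> \<not> ergodic_T2 F))"
proof -
  define E :: "real set" where "E = (\<Inter>n. {0..1} \<inter> liouville_approx n)"
  have ope: "openin (top_of_set {0..1}) ({0..1} \<inter> liouville_approx n)" for n
    by (rule openin_open_Int[OF open_liouville_approx])
  have "gdelta_in (top_of_set {0..1}) E"
    unfolding E_def using ope by (intro gdelta_in_Inter open_imp_gdelta_in) auto
  moreover have "{0..1} \<subseteq> closure E"
    unfolding E_def
  proof (rule Baire)
    fix U assume "U \<in> range (\<lambda>n. {0..1} \<inter> liouville_approx n)"
    then obtain n where n: "U = {0..1} \<inter> liouville_approx n" by blast
    show "openin (top_of_set {0..1}) U \<and> {0..1} \<subseteq> closure U"
      unfolding n using ope liouville_approx_dense[of _ _ n] by (auto simp: closure_approachable)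
  qed auto
  moreover have "\<exists>D. D \<subseteq> tau closure_of A_set \<alpha> \<and>
        subtopology tau (tau closure_of A_set \<alpha>) closure_of D = tau closure_of A_set \<alpha> \<and>
        (\<forall>F\<in>D. minimal_T2 F \<and> \<not> ergodic_T2 F)" if \<alpha>: "\<alpha> \<in> E" for \<alpha>
  proof -
    \<comment> \<open>With \<open>D\<close> all minimal non-ergodic elements of \<open>C\<close>, it
      is enough to approximate the elements of \<open>A_set \<alpha>\<close>: the closure of
      \<open>D\<close> is closed, hence contains \<open>C\<close> as soon as it contains
      \<open>A_set \<alpha>\<close>.\<close>
    define C where "C = tau closure_of A_set \<alpha>"
    define D where "D = {F \<in> C. minimal_T2 F \<and> \<not> ergodic_T2 F}"
    have "liouville \<alpha>" using \<alpha> by (auto simp: E_def liouville_iff)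
    then have "A_set \<alpha> \<subseteq> tau closure_of D"
      using A_set_in_closure_minimal_not_ergodic unfolding C_def D_def by blast
    then have "C \<subseteq> tau closure_of D"
      unfolding C_def by (rule closure_of_minimal) (rule closedin_closure_of)
    then have "subtopology tau C closure_of D = C"
      using closure_of_subtopology[of tau C D] by (auto simp: D_def Int_absorb1)
    moreover have "D \<subseteq> C" "\<forall>F\<in>D. minimal_T2 F \<and> \<not> ergodic_T2 F" by (auto simp: D_def)
    ultimately show ?thesis unfolding C_def by blast
  qed
  moreover have "E \<subseteq> {0..1}" by (auto simp: E_def)
  ultimately show ?thesis by blast
qed

end
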